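(* Let $L$ be a slowly varying function at $\infty$ and let $\mu$ be a probability measure on $\mathbb{Z}_{\ge 0}$ with mean $\sum_{i\ge 0} i\mu(i)=1$ and $\mu(n)\sim L(n)/n^2$ as $n\to\infty$. For $n$ large, let $\mathcal{T}_n$ be a $\mathrm{BGW}_\mu$ tree conditioned on having exactly $n$ vertices and let $H^*_n$ be the height (graph distance to the root) of the vertex with maximal degree in $\mathcal{T}_n$. Then there is a slowly varying function $\Lambda$ with $\Lambda(x)\to\infty$ as $x\to\infty$ such that $$\frac{H^*_n}{\Lambda(n)}\ \longrightarrow\ \mathsf{Exp}(1)\quad\text{in distribution as } n\to\infty,$$ where $\mathsf{Exp}(1)$ is an exponential random variable with parameter $1$.
   Context: A plane tree $\tau$ is a rooted ordered tree; $k_v(\tau)$ denotes the number of children (out-degree) of the vertex $v$. A $\mathrm{BGW}_\mu$ tree is a random plane tree with law $\mathrm{BGW}_\mu(\tau)=\prod_{u\in\tau}\mu(k_u(\tau))$ for every finite plane tree $\tau$. The vertex with maximal degree means the first vertex, in lexicographical (depth-first) order, with maximal out-degree. *)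

theory Defs
  imports "HOL-Probability.Probability" "HOL-Library.Landau_Symbols" "HOL-Library.List_Lexorder"
begin

text \<open>
  Slow variation in the usual sense of Karamata: positive and measurable on a neighbourhood of
  infinity. Values to the left of that neighbourhood are irrelevant.
\<close>

definition slowly_varying :: "(real \<Rightarrow> real) \<Rightarrow> bool" where
  "slowly_varying L \<longleftrightarrow>
     (\<exists>X. (\<forall>x\<ge>X. L x > 0) \<and> set_borel_measurable borel {X..} L) \<and>
     (\<forall>a>0. ((\<lambda>x. L (a * x) / L x) \<longlongrightarrow> 1) at_top)"

datatype plane_tree = Node "plane_tree list"

lemma size_nth_less [termination_simp]:
  "i < length ts \<Longrightarrow> size (ts ! i) < Suc (size_list size ts)"
  by (simp add: less_Suc_eq_le size_list_estimation'[OF nth_mem order_refl])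

text \<open>
  Vertices are Ulam-Harris words: the root is the empty word, and \<open>i # u\<close> is the vertex \<open>u\<close> of the
  subtree hanging off the \<open>i\<close>-th child (counted from \<open>0\<close>) of the root.
\<close>

fun vertices :: "plane_tree \<Rightarrow> nat list set" where
  "vertices (Node ts) = insert [] (\<Union>i\<in>{..<length ts}. (#) i ` vertices (ts ! i))"

text \<open>Only meaningful when the word is a vertex of the tree.\<close>

fun outdegree :: "plane_tree \<Rightarrow> nat list \<Rightarrow> nat" where
  "outdegree (Node ts) [] = length ts"
| "outdegree (Node ts) (i # u) = outdegree (ts ! i) u"

lemma finite_vertices [simp]: "finite (vertices t)"
  by (induction t rule: vertices.induct) auto

lemma Nil_in_vertices [simp]: "[] \<in> vertices t"
  by (cases t) simp

text \<open>
  The minimum is with respect to the lexicographic order of \<^theory>\<open>HOL-Library.List_Lexorder\<close>, in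
  which a proper prefix is smaller; on vertices this is the depth-first order.
\<close>

definition max_degree_vertex :: "plane_tree \<Rightarrow> nat list" where
  "max_degree_vertex t =
     Min {u \<in> vertices t. \<forall>v \<in> vertices t. outdegree t v \<le> outdegree t u}"

definition max_degree_height :: "plane_tree \<Rightarrow> nat" where
  "max_degree_height t = length (max_degree_vertex t)"

text \<open>
  The type \<^typ>\<open>plane_tree\<close> contains finite trees only, so in general this is a sub-probability
  measure (the law of the branching tree restricted to finite trees).
\<close>

definition BGW :: "nat pmf \<Rightarrow> plane_tree measure" where
  "BGW \<mu> = density (count_space UNIV) (\<lambda>t. ennreal (\<Prod>u\<in>vertices t. pmf \<mu> (outdegree t u)))"

text \<open>
  Conditional law given that there are exactly \<open>n\<close> vertices; it is the null measure if that event
  has probability zero.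
\<close>

definition BGW_cond :: "nat pmf \<Rightarrow> nat \<Rightarrow> plane_tree measure" where
  "BGW_cond \<mu> n = uniform_measure (BGW \<mu>) {t. card (vertices t) = n}"

end

theory Submission imports Defs begin

text \<open>
  Write \<open>p\<close> for the offspring law, \<open>f\<close> for its generating function, \<open>f\<^sub>K\<close> for the truncation of \<open>f\<close> to
  degrees at most \<open>K\<close>, and \<open>ell x\<close> for the sum of \<open>k p(k)\<close> over \<open>k > x\<close>, which is slowly varying and
  dominates \<open>L\<close>. Let \<open>b\<^sub>n\<close> be the solution of \<open>b = n ell b\<close>, so that a sum of \<open>n\<close> steps falls short of \<open>n\<close>
  by about \<open>b\<^sub>n\<close>. Decomposing a tree along the path to a vertex of degree \<open>k > K\<close> at height \<open>h\<close>, all other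
  degrees being at most \<open>K\<close>, and applying the Otter-Dwass formula bounds the weight of such trees with
  \<open>n = h + 1 + m\<close> vertices from below by \<open>p(k) (k / m)\<close> times the coefficient of order \<open>m - k\<close> in
  \<open>f\<^sub>K'^h f\<^sub>K^m\<close>. Exponential moments show that, for \<open>K\<close> of order \<open>b\<^sub>n\<close>, almost all of the mass
  \<open>(1 - ell K)^h\<close> of this product sits at \<open>k\<close> close to \<open>b\<^sub>n\<close>. Hence the height falls in an interval with at
  least the asymptotic probability given by the geometric law with parameter \<open>ell b\<^sub>n\<close>, provided the total weight of trees with
  \<open>n\<close> vertices is at most \<open>(1 + o(1)) L(b\<^sub>n) / b\<^sub>n^2\<close>; the latter is the principle of one big jump. Lower bounds
  on all intervals suffice since the total mass is one, and \<open>\<Lambda>(n) = 1 / ell b\<^sub>n\<close>.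
\<close>

section \<open>Slowly varying functions\<close>

text \<open>The two bounds meet because of the equation solved by \<open>b\<close>. A spine vertex
  of degree \<open>d\<close> contributes \<open>d * p d\<close>, as the child continuing the spine
  can sit in \<open>d\<close> positions; over \<open>d \<le> K\<close> these masses add up to
  \<open>1 - ell K\<close>, the origin of the geometric law. The factor \<open>k / m\<close> is
  close to \<open>bn n / n\<close>, hence to \<open>ell (bn n)\<close>, which is exactly the
  normalisation of that law, so the lower bounds add up to
  \<open>rho n = L (bn n) / (bn n)^2\<close>. A cut at a fraction of \<open>bn n\<close> works
  because \<open>ell\<close> does not distinguish this level from \<open>bn n\<close>, while
  \<open>n\<close> steps rarely exceed it (\<open>n * tail K\<close> tends to 0) and have negligible
  variance (\<open>n * V K\<close> is of smaller order than \<open>(bn n)^2\<close>). The obstacle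
  is that conditioning on the size concerns the mass of a single point. In the lower bound it is met
  by summing over the large degree \<open>k\<close>, on whose range \<open>p\<close> is nearly
  constant, so that only a law of large numbers is needed for the other steps; in the upper bound
  the largest jump plays the same role.\<close>

lemma measure_increment_tendsto_0:
  fixes h :: "real \<Rightarrow> real" and v :: "nat \<Rightarrow> real"
  assumes [measurable]: "h \<in> borel_measurable borel"
    and lim: "\<And>t. ((\<lambda>u. h (u + t) - h u) \<longlongrightarrow> 0) at_top"
    and v: "filterlim v at_top sequentially" and e: "e > 0"
  shows "(\<lambda>n. measure lborel {s \<in> {0..T}. e \<le> \<bar>h (v n + s) - h (v n)\<bar>}) \<longlonglongrightarrow> 0"
proof -
  let ?E = "\<lambda>n. {s \<in> {0..T}. e \<le> \<bar>h (v n + s) - h (v n)\<bar>}"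
  have [measurable]: "?E n \<in> sets borel" for n by measurable
  have "(\<lambda>n. integral\<^sup>L lborel (indicator (?E n) :: real \<Rightarrow> real)) \<longlonglongrightarrow> integral\<^sup>L lborel (\<lambda>_::real. 0 :: real)"
  proof (rule integral_dominated_convergence[where w = "indicator {0..T}" and M = lborel
      and s = "\<lambda>n. indicator (?E n)" and f = "\<lambda>_. 0"])
    show "AE s in lborel. (\<lambda>n. indicator (?E n) s :: real) \<longlonglongrightarrow> 0"
    proof (rule AE_I2)
      fix s :: real
      have "((\<lambda>n. h (v n + s) - h (v n)) \<longlongrightarrow> 0) sequentially"
        using filterlim_compose[OF lim v] by simp
      then have "eventually (\<lambda>n. \<bar>h (v n + s) - h (v n)\<bar> < e) sequentially"
        using e by (auto simp: tendsto_iff dist_real_def)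
      then have "eventually (\<lambda>n. (indicator (?E n) s :: real) = 0) sequentially"
        by eventually_elim (auto simp: indicator_def)
      then show "(\<lambda>n. indicator (?E n) s :: real) \<longlonglongrightarrow> 0"
        by (rule tendsto_eventually)
    qed
    show "integrable lborel (indicator {0..T} :: real \<Rightarrow> real)"
      by (rule integrable_real_indicator) (auto simp: emeasure_lborel_Icc_eq)
  qed (auto simp: indicator_def)
  then show ?thesis by simp
qed

text \<open>Suppose the bound fails at points \<open>u n\<close> with shifts \<open>t n\<close>. By
  the triangle inequality every \<open>s\<close> in \<open>{t n..t n + T}\<close> is exceptional
  either for the base point \<open>u n\<close> or, after shifting by \<open>t n\<close>, for
  \<open>v n = u n + t n\<close>. Both exceptional sets have measure tending to 0, so they cannot
  cover an interval of length \<open>T\<close>.\<close>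

lemma additive_uniform_convergence:
  fixes h :: "real \<Rightarrow> real"
  assumes meas: "h \<in> borel_measurable borel"
    and lim: "\<And>t. ((\<lambda>u. h (u + t) - h u) \<longlongrightarrow> 0) at_top"
    and T: "T > 0" and e: "e > 0"
  shows "eventually (\<lambda>u. \<forall>t\<in>{0..T}. \<bar>h (u + t) - h u\<bar> < e) at_top"
proof (rule ccontr)
  assume "\<not> ?thesis"
  then have *: "\<exists>u\<ge>N. \<exists>t\<in>{0..T}. e \<le> \<bar>h (u + t) - h u\<bar>" for N
    unfolding eventually_at_top_linorder by (simp add: not_less)
  have "\<forall>n::nat. \<exists>u t. u \<ge> real n \<and> t \<in> {0..T} \<and> e \<le> \<bar>h (u + t) - h u\<bar>"
    using * by blast
  then obtain u t where ut: "\<And>n::nat. u n \<ge> real n" "\<And>n. t n \<in> {0..T}"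
    "\<And>n. e \<le> \<bar>h (u n + t n) - h (u n)\<bar>" by metis
  define v where "v n = u n + t n" for n
  have u: "filterlim u at_top sequentially"
    by (rule filterlim_at_top_mono[OF filterlim_real_sequentially]) (use ut(1) in auto)
  have v: "filterlim v at_top sequentially"
    by (rule filterlim_at_top_mono[OF u]) (use ut(2) in \<open>auto simp: v_def\<close>)
  \<comment> \<open>The range is doubled because the interval to be covered can reach up to
    \<open>2 * T\<close>.\<close>
  define E where "E n = {s \<in> {0..2*T}. e/2 \<le> \<bar>h (u n + s) - h (u n)\<bar>}" for n
  define E' where "E' n = {s \<in> {0..T}. e/2 \<le> \<bar>h (v n + s) - h (v n)\<bar>}" for n
  have Es: "E n \<in> sets borel" "E' n \<in> sets borel" for n
    using meas unfolding E_def E'_def by measurable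
  have fm: "E n \<in> lmeasurable" "E' n \<in> lmeasurable" for n
  proof -
    have "bounded (E n)" "bounded (E' n)"
      by (rule bounded_subset[OF bounded_closed_interval[of 0 "2*T"]], use T in \<open>force simp: E_def E'_def\<close>)+
    then show "E n \<in> lmeasurable" "E' n \<in> lmeasurable"
      using Es[of n] by (auto intro!: bounded_set_imp_lmeasurable)
  qed
  have "(\<lambda>n. measure lborel (E n) + measure lborel (E' n)) \<longlonglongrightarrow> 0 + 0"
    unfolding E_def E'_def
    by (intro tendsto_add measure_increment_tendsto_0 meas lim u v) (use e in auto)
  then have "eventually (\<lambda>n. measure lborel (E n) + measure lborel (E' n) < T) sequentially"
    using T by (intro order_tendstoD(2)) auto
  then obtain n where n: "measure lborel (E n) + measure lborel (E' n) < T"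
    by (auto simp: eventually_sequentially)
  have "{t n..t n + T} \<subseteq> E n \<union> (+) (t n) ` E' n"
  proof
    fix s assume s: "s \<in> {t n..t n + T}"
    show "s \<in> E n \<union> (+) (t n) ` E' n"
    proof (cases "e/2 \<le> \<bar>h (u n + s) - h (u n)\<bar>")
      case True
      then show ?thesis using s ut(2)[of n] by (auto simp: E_def)
    next
      case False
      then have "e/2 \<le> \<bar>h (v n + (s - t n)) - h (v n)\<bar>"
        using ut(3)[of n] abs_triangle_ineq[of "h (v n) - h (u n + s)" "h (u n + s) - h (u n)"]
        by (simp add: v_def abs_minus_commute)
      then have "s - t n \<in> E' n" using s by (auto simp: E'_def)
      then show ?thesis by (auto simp: image_iff intro!: bexI[of _ "s - t n"])
    qed
  qed
  then have "measure lebesgue {t n..t n + T} \<le> measure lebesgue (E n \<union> (+) (t n) ` E' n)"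
    by (intro measure_mono_fmeasurable fmeasurable.Un fm measurable_translation) auto
  also have "\<dots> \<le> measure lebesgue (E n) + measure lebesgue ((+) (t n) ` E' n)"
    by (intro measure_Un_le) (auto intro!: fmeasurableD fm measurable_translation)
  also have "\<dots> = measure lborel (E n) + measure lborel (E' n)"
    using Es by (simp add: measure_translation)
  finally show False using n T by simp
qed

lemma slowly_varyingD:
  assumes "slowly_varying L"
  obtains X where "\<And>x. x \<ge> X \<Longrightarrow> L x > 0" "set_borel_measurable borel {X..} L" "X > 0"
proof -
  obtain X where X: "\<forall>x\<ge>X. L x > 0" "set_borel_measurable borel {X..} L"
    using assms by (auto simp: slowly_varying_def)
  have "set_borel_measurable borel {max X 1..} L"
    by (rule set_borel_measurable_subset[OF X(2)]) auto
  then show ?thesis using X(1) by (intro that[of "max X 1"]) auto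
qed

lemma slowly_varying_lim: "slowly_varying L \<Longrightarrow> a > 0 \<Longrightarrow> ((\<lambda>x. L (a * x) / L x) \<longlongrightarrow> 1) at_top"
  by (simp add: slowly_varying_def)

lemma slowly_varying_eventually_pos: "slowly_varying L \<Longrightarrow> eventually (\<lambda>x. L x > 0) at_top"
  by (auto simp: slowly_varying_def eventually_at_top_linorder)

text \<open>Karamata's uniform convergence theorem; the substitution \<open>x = exp u\<close>
  reduces it to \<open>additive_uniform_convergence\<close>.\<close>

theorem slowly_varying_uniform:
  assumes L: "slowly_varying L" and A: "A > 1" and e: "e > 0"
  shows "eventually (\<lambda>x. \<forall>a\<in>{1..A}. \<bar>L (a * x) / L x - 1\<bar> < e) at_top"
proof -
  obtain X where X: "\<And>x. x \<ge> X \<Longrightarrow> L x > 0" "set_borel_measurable borel {X..} L" "X > 0"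
    using slowly_varyingD[OF L] by blast
  \<comment> \<open>Setting the value to 1 left of \<open>X\<close> gives a positive Borel function
    on the whole line with unchanged behaviour at infinity, so its logarithm can be used
    everywhere.\<close>
  define g where "g x = (if x \<in> {X..} then L x else 1)" for x
  have g: "g \<in> borel_measurable borel"
  proof -
    have "g = (\<lambda>x. indicator {X..} x *\<^sub>R L x + (if x \<in> {X..} then 0 else 1))"
      by (auto simp: g_def fun_eq_iff)
    also have "\<dots> \<in> borel_measurable borel"
      using X(2) by (intro borel_measurable_add) (auto simp: set_borel_measurable_def)
    finally show ?thesis .
  qed
  have gpos: "g x > 0" for x using X(1) by (auto simp: g_def)
  define h where "h u = ln (g (exp u))" for u
  have h: "h \<in> borel_measurable borel"
    using g unfolding h_def by measurable
  have evX: "eventually (\<lambda>u. exp u \<ge> X \<and> exp (u + t) \<ge> X) at_top" for t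
  proof -
    have "eventually (\<lambda>u. u \<ge> ln X) at_top" "eventually (\<lambda>u. u \<ge> ln X - t) at_top"
      by (rule eventually_ge_at_top)+
    then show ?thesis
    proof eventually_elim
      case (elim u)
      have "exp (ln X) \<le> exp u" "exp (ln X) \<le> exp (u + t)" using elim by auto
      then show ?case using X(3) by simp
    qed
  qed
  have lim: "((\<lambda>u. h (u + t) - h u) \<longlongrightarrow> 0) at_top" for t
  proof -
    have "((\<lambda>u. ln (L (exp t * exp u) / L (exp u))) \<longlongrightarrow> ln 1) at_top"
      by (rule tendsto_ln[OF filterlim_compose[OF slowly_varying_lim[OF L] exp_at_top]]) auto
    moreover have "eventually (\<lambda>u. ln (L (exp t * exp u) / L (exp u)) = h (u + t) - h u) at_top"
      using evX[of t]
    proof eventually_elim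
      case (elim u)
      then show ?case using X(1)[of "exp u"] X(1)[of "exp (u+t)"]
        by (simp add: h_def g_def exp_add mult.commute ln_div)
    qed
    ultimately show ?thesis by (simp add: tendsto_cong)
  qed
  \<comment> \<open>A log-ratio smaller than \<open>d\<close> in absolute value puts the ratio
    between \<open>1 - e\<close> and \<open>1 + e\<close>; the lower end comes from
    \<open>1 - m < 1 / (1 + m)\<close> with \<open>m = min e (1/2)\<close>.\<close>
  define d where "d = ln (1 + min e (1/2))"
  have d: "d > 0" "exp d \<le> 1 + e" "exp (-d) > 1 - e"
  proof -
    show "d > 0" "exp d \<le> 1 + e" using e by (auto simp: d_def)
    have m: "min e (1/2) > 0" using e by auto
    have "1 - min e (1/2) < 1 / (1 + min e (1/2))"
      using m by (simp add: field_simps)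
    then have "1 - min e (1/2) < exp (-d)" using m by (simp add: d_def exp_minus field_simps)
    then show "exp (-d) > 1 - e" by auto
  qed
  have "eventually (\<lambda>u. \<forall>t\<in>{0..ln A}. \<bar>h (u + t) - h u\<bar> < d) at_top"
    by (rule additive_uniform_convergence[OF h lim]) (use A d in auto)
  then have "eventually (\<lambda>x. \<forall>t\<in>{0..ln A}. \<bar>h (ln x + t) - h (ln x)\<bar> < d) at_top"
    by (rule eventually_compose_filterlim[OF _ ln_at_top])
  then show ?thesis using eventually_ge_at_top[of "max X 1"]
  proof eventually_elim
    case (elim x)
    show ?case
    proof
      fix a assume a: "a \<in> {1..A}"
      have x: "x \<ge> X" "x > 0" "a * x \<ge> X"
      proof -
        show "x \<ge> X" "x > 0" using elim by auto
        then have "1 * x \<le> a * x" using a by (intro mult_right_mono) auto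
        then show "a * x \<ge> X" using \<open>x \<ge> X\<close> by linarith
      qed
      have Lp: "L x > 0" "L (a * x) > 0" using X(1) x by auto
      have "\<bar>h (ln x + ln a) - h (ln x)\<bar> < d" using elim(1) a by auto
      moreover have "h (ln x + ln a) - h (ln x) = ln (L (a * x) / L x)"
      proof -
        have "exp (ln x + ln a) = a * x" using x a by (simp add: exp_add)
        then show ?thesis using x Lp by (simp add: h_def g_def ln_div)
      qed
      ultimately have "ln (L (a * x) / L x) < d" "- d < ln (L (a * x) / L x)" by auto
      then have "exp (ln (L (a * x) / L x)) < exp d" "exp (- d) < exp (ln (L (a * x) / L x))"
        by (auto simp only: exp_less_cancel_iff)
      then have "L (a * x) / L x < 1 + e" "1 - e < L (a * x) / L x"
        using Lp d by auto
      then show "\<bar>L (a * x) / L x - 1\<bar> < e" by auto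
    qed
  qed
qed

text \<open>A full doubling of the argument costs a factor \<open>sqrt 2\<close>, which is the
  growth of the square root itself; the extra \<open>sqrt 2\<close> pays for the last, incomplete
  doubling. The hypothesis is one-sided so that both a slowly varying function and its reciprocal
  can be inserted.\<close>

lemma sqrt_growth_iterate:
  fixes g :: "real \<Rightarrow> real"
  assumes step: "\<And>x a. x \<ge> X \<Longrightarrow> a \<in> {1..2} \<Longrightarrow> g (a * x) \<le> sqrt 2 * g x"
    and pos: "\<And>x. x \<ge> X \<Longrightarrow> g x > 0" and X: "X > 0"
  shows "X \<le> x \<Longrightarrow> x \<le> y \<Longrightarrow> y \<le> 2 ^ i * x \<Longrightarrow> g y \<le> sqrt 2 * sqrt (y / x) * g x"
proof (induction i arbitrary: x)
  case 0
  then have "y = x" by auto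
  moreover have "1 * g x \<le> sqrt 2 * g x" using pos[OF 0(1)] by (intro mult_right_mono) auto
  ultimately show ?case using 0 X by simp
next
  case (Suc i)
  have x: "x > 0" using Suc X by auto
  show ?case
  proof (cases "y \<le> 2 * x")
    case True
    have "g ((y / x) * x) \<le> sqrt 2 * g x"
      using Suc True x by (intro step) (auto simp: field_simps)
    then have "g y \<le> sqrt 2 * 1 * g x" using x by simp
    moreover have "1 \<le> sqrt (y / x)" using Suc x by (auto simp: field_simps)
    then have "sqrt 2 * 1 * g x \<le> sqrt 2 * sqrt (y / x) * g x"
      using pos[OF Suc(2)] by (intro mult_right_mono mult_left_mono) auto
    ultimately show ?thesis by linarith
  next
    case False
    have "g y \<le> sqrt 2 * sqrt (y / (2 * x)) * g (2 * x)"
      using Suc False x by (intro Suc.IH) auto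
    also have "\<dots> = sqrt (y / x) * g (2 * x)"
      using x by (simp add: real_sqrt_divide real_sqrt_mult)
    also have "\<dots> \<le> sqrt (y / x) * (sqrt 2 * g x)"
      using Suc x by (intro mult_left_mono step) auto
    finally show ?thesis by (simp add: mult_ac)
  qed
qed

text \<open>Potter bounds with exponent 1/2: the uniform convergence theorem on
  \<open>[1, 2]\<close> controls one doubling, and iteration gives the power.\<close>

lemma potter_bounds:
  assumes g: "slowly_varying g"
  obtains X where "X > 0" "\<And>x. x \<ge> X \<Longrightarrow> g x > 0"
    "\<And>x y. X \<le> x \<Longrightarrow> x \<le> y \<Longrightarrow> g y \<le> 2 * sqrt (y / x) * g x"
    "\<And>x y. X \<le> x \<Longrightarrow> x \<le> y \<Longrightarrow> g x \<le> 2 * sqrt (y / x) * g y"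
proof -
  \<comment> \<open>The tolerance 1/5 below confines the ratio to the interval from 4/5 to 6/5; both
    6/5 and 5/4, the reciprocal of 4/5, are at most \<open>sqrt 2\<close>.\<close>
  have s2: "sqrt 2 \<ge> 5/4" by (rule real_le_rsqrt) (simp add: power2_eq_square)
  have "eventually (\<lambda>x. (\<forall>a\<in>{1..2}. \<bar>g (a * x) / g x - 1\<bar> < 1/5) \<and> g x > 0) at_top"
    by (intro eventually_conj slowly_varying_uniform slowly_varying_eventually_pos g) auto
  then obtain X0 where X0: "\<And>x. x \<ge> X0 \<Longrightarrow> (\<forall>a\<in>{1..2}. \<bar>g (a * x) / g x - 1\<bar> < 1/5) \<and> g x > 0"
    by (auto simp: eventually_at_top_linorder)
  define X where "X = max X0 1"
  have X: "X > 0" by (simp add: X_def)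
  have pos: "g x > 0" if "x \<ge> X" for x using X0 that by (auto simp: X_def)
  have st: "g (a * x) \<le> sqrt 2 * g x \<and> g x \<le> sqrt 2 * g (a * x)" if "x \<ge> X" "a \<in> {1..2}" for x a
  proof -
    have "\<bar>g (a * x) / g x - 1\<bar> < 1/5" using X0 that by (auto simp: X_def)
    then have "g (a * x) < 6/5 * g x" "4/5 * g x < g (a * x)"
      using pos[OF that(1)] by (simp_all only: abs_less_iff) (simp_all add: field_simps)
    moreover have "5/4 * g x \<le> sqrt 2 * g x"
      using s2 pos[OF that(1)] by (intro mult_right_mono) auto
    moreover have "5/4 * g (a * x) \<le> sqrt 2 * g (a * x)"
      using s2 calculation pos[OF that(1)] by (intro mult_right_mono) auto
    ultimately show ?thesis using pos[OF that(1)] by linarith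
  qed
  have le: "sqrt 2 * s \<le> 2 * s" if "s \<ge> 0" for s
    using that by (intro mult_right_mono) (auto intro: real_le_lsqrt)
  have ex: "\<exists>i. y \<le> 2 ^ i * x" if "x \<ge> X" for x y :: real
  proof -
    obtain i where "y / x < 2 ^ i" using real_arch_pow[of 2 "y/x"] by auto
    then show ?thesis using that X by (intro exI[of _ i]) (auto simp: field_simps)
  qed
  show ?thesis
  proof (rule that[OF X pos])
    fix x y assume xy: "X \<le> x" "x \<le> y"
    obtain i where i: "y \<le> 2 ^ i * x" using ex xy by blast
    have "g y \<le> sqrt 2 * sqrt (y / x) * g x"
      by (rule sqrt_growth_iterate[where X = X, OF _ pos X xy i]) (use st in auto)
    also have "\<dots> \<le> 2 * sqrt (y / x) * g x"
      using xy X pos[OF xy(1)] by (intro mult_right_mono le) auto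
    finally show "g y \<le> 2 * sqrt (y / x) * g x" .
    have "inverse (g y) \<le> sqrt 2 * sqrt (y / x) * inverse (g x)"
    proof (rule sqrt_growth_iterate[where X = X and g = "\<lambda>x. inverse (g x)", OF _ _ X xy i])
      fix x a :: real assume "X \<le> x" "a \<in> {1..2}"
      moreover from this X have "1 * x \<le> a * x" by (intro mult_right_mono) auto
      ultimately show "inverse (g (a * x)) \<le> sqrt 2 * inverse (g x)"
        using st[of x a] pos[of x] pos[of "a * x"] by (auto simp: field_simps)
    qed (use pos in auto)
    also have "\<dots> \<le> 2 * sqrt (y / x) * inverse (g x)"
      using xy X pos[OF xy(1)] by (intro mult_right_mono le) auto
    finally show "g x \<le> 2 * sqrt (y / x) * g y"
      using pos[of x] pos[of y] xy by (auto simp: field_simps)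
  qed auto
qed

section \<open>Generating functions of plane trees\<close>

lemma card_vertices_Node: "card (vertices (Node ts)) = Suc (\<Sum>t\<leftarrow>ts. card (vertices t))"
proof -
  have "card (\<Union>i\<in>{..<length ts}. (#) i ` vertices (ts ! i)) = (\<Sum>i<length ts. card ((#) i ` vertices (ts ! i)))"
    by (rule card_UN_disjoint) auto
  also have "\<dots> = (\<Sum>i<length ts. card (vertices (ts ! i)))"
    by (intro sum.cong card_image) (auto simp: inj_on_def)
  also have "\<dots> = (\<Sum>t\<leftarrow>ts. card (vertices t))"
    by (simp add: sum_list_sum_nth atLeast0LessThan)
  finally have "card (\<Union>i\<in>{..<length ts}. (#) i ` vertices (ts ! i)) = (\<Sum>t\<leftarrow>ts. card (vertices t))" .
  moreover have "[] \<notin> (\<Union>i\<in>{..<length ts}. (#) i ` vertices (ts ! i))" by auto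
  ultimately show ?thesis by (simp add: card_insert_if)
qed

lemma vertices_nonempty [simp]: "vertices t \<noteq> {}"
  using Nil_in_vertices[of t] by blast

lemma card_vertices_pos: "card (vertices t) \<ge> 1"
  by (cases t) (simp add: card_vertices_Node del: vertices.simps)

lemma length_le_total_size: "length ts \<le> (\<Sum>t\<leftarrow>ts. card (vertices t))"
proof (induction ts)
  case (Cons t ts)
  then show ?case using card_vertices_pos[of t] by simp
qed simp

lemma member_le_total_size: "t \<in> set ts \<Longrightarrow> card (vertices t) \<le> (\<Sum>t\<leftarrow>ts. card (vertices t))"
  by (rule member_le_sum_list) auto

definition tree_weight :: "(nat \<Rightarrow> real) \<Rightarrow> plane_tree \<Rightarrow> real" where
  "tree_weight p t = (\<Prod>u\<in>vertices t. p (outdegree t u))"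

lemma tree_weight_Node: "tree_weight p (Node ts) = p (length ts) * (\<Prod>t\<leftarrow>ts. tree_weight p t)"
proof -
  have "tree_weight p (Node ts) = p (length ts) * (\<Prod>u\<in>(\<Union>i\<in>{..<length ts}. (#) i ` vertices (ts ! i)). p (outdegree (Node ts) u))"
    unfolding tree_weight_def vertices.simps by (subst prod.insert) auto
  also have "(\<Prod>u\<in>(\<Union>i\<in>{..<length ts}. (#) i ` vertices (ts ! i)). p (outdegree (Node ts) u)) =
      (\<Prod>i<length ts. \<Prod>u\<in>(#) i ` vertices (ts ! i). p (outdegree (Node ts) u))"
    by (rule prod.UNION_disjoint) auto
  also have "\<dots> = (\<Prod>i<length ts. tree_weight p (ts ! i))"
    by (intro prod.cong) (auto simp: prod.reindex inj_on_def tree_weight_def)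
  also have "\<dots> = (\<Prod>t\<leftarrow>ts. tree_weight p t)"
    by (induction ts) (simp_all add: prod.lessThan_Suc_shift del: prod.lessThan_Suc)
  finally show ?thesis .
qed

lemma finite_trees_le: "finite {t. card (vertices t) \<le> n}"
proof (induction n)
  case 0
  have "{t. card (vertices t) \<le> 0} = {}" using card_vertices_pos
    by (metis (mono_tags, lifting) Collect_empty_eq not_one_le_zero order_trans)
  then show ?case by simp
next
  case (Suc n)
  have "{t. card (vertices t) \<le> Suc n} \<subseteq> Node ` {ts. set ts \<subseteq> {t. card (vertices t) \<le> n} \<and> length ts \<le> n}"
  proof
    fix t assume "t \<in> {t. card (vertices t) \<le> Suc n}"
    moreover obtain ts where t: "t = Node ts" by (cases t)
    ultimately have "(\<Sum>t\<leftarrow>ts. card (vertices t)) \<le> n"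
      by (simp add: card_vertices_Node del: vertices.simps)
    then have "ts \<in> {ts. set ts \<subseteq> {t. card (vertices t) \<le> n} \<and> length ts \<le> n}"
      using length_le_total_size[of ts] member_le_total_size[of _ ts] by fastforce
    then show "t \<in> Node ` {ts. set ts \<subseteq> {t. card (vertices t) \<le> n} \<and> length ts \<le> n}"
      using t by blast
  qed
  then show ?case using finite_lists_length_le[OF Suc] finite_surj by blast
qed

lemma finite_trees [simp]: "finite {t. P t \<and> card (vertices t) = n}"
  by (rule finite_subset[OF _ finite_trees_le[of n]]) auto

lemma finite_forests [simp]: "finite {ts. P ts \<and> (\<Sum>t\<leftarrow>ts. card (vertices t)) = n}"
proof (rule finite_subset)
  show "{ts. P ts \<and> (\<Sum>t\<leftarrow>ts. card (vertices t)) = n} \<subseteq> {ts. set ts \<subseteq> {t. card (vertices t) \<le> n} \<and> length ts \<le> n}"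
    using length_le_total_size member_le_total_size by fastforce
  show "finite {ts. set ts \<subseteq> {t. card (vertices t) \<le> n} \<and> length ts \<le> n}"
    using finite_lists_length_le finite_trees_le by blast
qed

section \<open>Weighted generating functions of trees and forests by number of vertices\<close>

definition tree_fps :: "(nat \<Rightarrow> real) \<Rightarrow> plane_tree set \<Rightarrow> real fps" where
  "tree_fps p A = Abs_fps (\<lambda>n. \<Sum>t | t \<in> A \<and> card (vertices t) = n. tree_weight p t)"

definition forest_fps :: "(nat \<Rightarrow> real) \<Rightarrow> plane_tree list set \<Rightarrow> real fps" where
  "forest_fps p B = Abs_fps (\<lambda>n. \<Sum>ts | ts \<in> B \<and> (\<Sum>t\<leftarrow>ts. card (vertices t)) = n. \<Prod>t\<leftarrow>ts. tree_weight p t)"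

lemma forest_fps_Cons:
  "forest_fps p {t # ts | t ts. t \<in> A \<and> ts \<in> B} = tree_fps p A * forest_fps p B"
proof (rule fps_ext)
  fix n
  let ?sz = "\<lambda>ts. \<Sum>t\<leftarrow>ts. card (vertices t)"
  have "fps_nth (tree_fps p A * forest_fps p B) n =
      (\<Sum>i\<in>{0..n}. \<Sum>t\<in>{t \<in> A. card (vertices t) = i}. \<Sum>ts\<in>{ts \<in> B. ?sz ts = n - i}.
         tree_weight p t * (\<Prod>t\<leftarrow>ts. tree_weight p t))"
    by (simp add: fps_mult_nth tree_fps_def forest_fps_def sum_product)
  also have "\<dots> = (\<Sum>i\<in>{0..n}. \<Sum>(t, ts)\<in>{t \<in> A. card (vertices t) = i} \<times> {ts \<in> B. ?sz ts = n - i}.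
         tree_weight p t * (\<Prod>t\<leftarrow>ts. tree_weight p t))"
    by (simp add: sum.cartesian_product)
  also have "\<dots> = (\<Sum>(i, t, ts)\<in>(SIGMA i:{0..n}. {t \<in> A. card (vertices t) = i} \<times> {ts \<in> B. ?sz ts = n - i}).
         tree_weight p t * (\<Prod>t\<leftarrow>ts. tree_weight p t))"
    by (subst sum.Sigma) auto
  also have "\<dots> = (\<Sum>ts\<in>{us \<in> {t # ts | t ts. t \<in> A \<and> ts \<in> B}. ?sz us = n}. \<Prod>t\<leftarrow>ts. tree_weight p t)"
    by (rule sum.reindex_bij_witness[where j = "\<lambda>(i, t, ts). t # ts"
          and i = "\<lambda>us. (card (vertices (hd us)), hd us, tl us)"]) auto
  finally show "fps_nth (forest_fps p {t # ts | t ts. t \<in> A \<and> ts \<in> B}) n = fps_nth (tree_fps p A * forest_fps p B) n"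
    by (simp add: forest_fps_def)
qed

lemma forest_fps_lists: "forest_fps p {ts. set ts \<subseteq> A \<and> length ts = k} = tree_fps p A ^ k"
proof (induction k)
  case 0
  have "{ts. set ts \<subseteq> A \<and> length ts = 0} = {[]}" by auto
  moreover have "{ts. ts = [] \<and> (\<Sum>t\<leftarrow>ts. card (vertices t)) = n} = (if n = 0 then {[]} else {})" for n
    by auto
  ultimately show ?case by (intro fps_ext) (auto simp: forest_fps_def)
next
  case (Suc k)
  have "{ts. set ts \<subseteq> A \<and> length ts = Suc k} = {t # ts | t ts. t \<in> A \<and> ts \<in> {ts. set ts \<subseteq> A \<and> length ts = k}}"
    by (auto simp: length_Suc_conv)
  then show ?case using Suc by (simp only: forest_fps_Cons power_Suc)
qed

text \<open>The children of a spine vertex: the child in position \<open>i\<close> continues the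
  spine and has class \<open>C\<close>, its \<open>i + j\<close> siblings are unmarked trees of
  class \<open>A\<close>.\<close>

definition spine_forests :: "plane_tree set \<Rightarrow> plane_tree set \<Rightarrow> nat \<Rightarrow> nat \<Rightarrow> plane_tree list set" where
  "spine_forests A C i j =
     {l @ t # r | l t r. t \<in> C \<and> set l \<subseteq> A \<and> set r \<subseteq> A \<and> length l = i \<and> length r = j}"

lemma spine_forestsE:
  assumes "x \<in> spine_forests A C i j"
  obtains l t r where "x = l @ t # r" "t \<in> C" "set l \<subseteq> A" "set r \<subseteq> A" "length l = i" "length r = j"
  using assms unfolding spine_forests_def by blast

text \<open>Only the number of siblings enters, not the position of the spine child. Summed over the
  \<open>d\<close> positions this yields the factor \<open>d\<close> that turns the generating
  function of the degrees into its derivative.\<close>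

lemma forest_fps_spine: "forest_fps p (spine_forests A C i j) = tree_fps p A ^ (i + j) * tree_fps p C"
proof (induction i)
  case 0
  have "spine_forests A C 0 j = {t # ts | t ts. t \<in> C \<and> ts \<in> {ts. set ts \<subseteq> A \<and> length ts = j}}"
    by (auto simp: spine_forests_def)
  then show ?case by (simp only: forest_fps_Cons forest_fps_lists) (simp add: mult.commute)
next
  case (Suc i)
  have "spine_forests A C (Suc i) j = {t # ts | t ts. t \<in> A \<and> ts \<in> spine_forests A C i j}" (is "?L = ?R")
  proof (intro set_eqI iffI)
    fix x assume "x \<in> ?L"
    then obtain l t r where "x = l @ t # r" "t \<in> C" "set l \<subseteq> A" "set r \<subseteq> A" "length l = Suc i" "length r = j"
      by (elim spine_forestsE)
    then show "x \<in> ?R" by (cases l) (auto simp: spine_forests_def)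
  next
    fix x assume "x \<in> ?R"
    then obtain a y where x: "x = a # y" "a \<in> A" "y \<in> spine_forests A C i j" by blast
    from x(3) obtain l t r where "y = l @ t # r" "t \<in> C" "set l \<subseteq> A" "set r \<subseteq> A" "length l = i" "length r = j"
      by (elim spine_forestsE)
    then show "x \<in> ?L" using x unfolding spine_forests_def
      by (intro CollectI exI[of _ "a # l"] exI[of _ t] exI[of _ r]) auto
  qed
  then show ?case using Suc by (simp only: forest_fps_Cons) (simp add: mult_ac)
qed

lemma forest_fps_UN:
  assumes "finite I" "\<And>i j. i \<in> I \<Longrightarrow> j \<in> I \<Longrightarrow> i \<noteq> j \<Longrightarrow> B i \<inter> B j = {}"
  shows "forest_fps p (\<Union>i\<in>I. B i) = (\<Sum>i\<in>I. forest_fps p (B i))"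
proof (rule fps_ext)
  fix n
  let ?sz = "\<lambda>ts. \<Sum>t\<leftarrow>ts. card (vertices t)"
  have "{ts. ts \<in> (\<Union>i\<in>I. B i) \<and> ?sz ts = n} = (\<Union>i\<in>I. {ts. ts \<in> B i \<and> ?sz ts = n})" by auto
  then have "fps_nth (forest_fps p (\<Union>i\<in>I. B i)) n = (\<Sum>ts\<in>(\<Union>i\<in>I. {ts. ts \<in> B i \<and> ?sz ts = n}). \<Prod>t\<leftarrow>ts. tree_weight p t)"
    by (simp add: forest_fps_def)
  also have "\<dots> = (\<Sum>i\<in>I. \<Sum>ts | ts \<in> B i \<and> ?sz ts = n. \<Prod>t\<leftarrow>ts. tree_weight p t)"
    using assms by (intro sum.UNION_disjoint) (auto simp: disjoint_iff)
  finally show "fps_nth (forest_fps p (\<Union>i\<in>I. B i)) n = fps_nth (\<Sum>i\<in>I. forest_fps p (B i)) n"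
    by (simp add: fps_sum_nth forest_fps_def)
qed

lemma tree_fps_Node:
  assumes "\<And>ts. ts \<in> B \<Longrightarrow> length ts = k"
  shows "tree_fps p (Node ` B) = fps_X * (fps_const (p k) * forest_fps p B)"
proof (rule fps_ext)
  fix n
  let ?sz = "\<lambda>ts. \<Sum>t\<leftarrow>ts. card (vertices t)"
  show "fps_nth (tree_fps p (Node ` B)) n = fps_nth (fps_X * (fps_const (p k) * forest_fps p B)) n"
  proof (cases n)
    case 0
    then show ?thesis by (simp add: tree_fps_def del: vertices.simps)
  next
    case (Suc m)
    have "{t. t \<in> Node ` B \<and> card (vertices t) = n} = Node ` {ts. ts \<in> B \<and> ?sz ts = m}"
      using Suc by (auto simp: card_vertices_Node simp del: vertices.simps)
    then have "fps_nth (tree_fps p (Node ` B)) n = (\<Sum>ts | ts \<in> B \<and> ?sz ts = m. tree_weight p (Node ts))"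
      by (simp add: tree_fps_def sum.reindex inj_on_def)
    also have "\<dots> = (\<Sum>ts | ts \<in> B \<and> ?sz ts = m. p k * (\<Prod>t\<leftarrow>ts. tree_weight p t))"
      by (intro sum.cong) (auto simp: tree_weight_Node assms)
    finally show ?thesis using Suc by (simp add: forest_fps_def sum_distrib_left)
  qed
qed

lemma tree_fps_nth_0: "fps_nth (tree_fps p A) 0 = 0"
  by (simp add: tree_fps_def)

definition trees_with_degrees :: "nat set \<Rightarrow> plane_tree set" where
  "trees_with_degrees D = {t. \<forall>v\<in>vertices t. outdegree t v \<in> D}"

lemma Node_in_trees_with_degrees:
  "Node ts \<in> trees_with_degrees D \<longleftrightarrow> length ts \<in> D \<and> set ts \<subseteq> trees_with_degrees D"
  by (auto simp: trees_with_degrees_def in_set_conv_nth subset_iff)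

lemma tree_fps_eq:
  "tree_fps p (trees_with_degrees D) =
     fps_X * (Abs_fps (\<lambda>k. if k \<in> D then p k else 0) oo tree_fps p (trees_with_degrees D))"
  (is "?T = fps_X * (?f oo _)")
proof (rule fps_ext)
  fix n
  let ?sz = "\<lambda>ts. \<Sum>t\<leftarrow>ts. card (vertices t)"
  let ?B = "trees_with_degrees D"
  show "fps_nth ?T n = fps_nth (fps_X * (?f oo ?T)) n"
  proof (cases n)
    case 0
    then show ?thesis by (simp add: tree_fps_nth_0)
  next
    case (Suc m)
    let ?F = "\<lambda>k. {ts. (set ts \<subseteq> ?B \<and> length ts = k) \<and> ?sz ts = m}"
    \<comment> \<open>A forest of \<open>k\<close> trees has at least \<open>k\<close> vertices, so
      after deletion of the root only degrees \<open>k \<le> m\<close> occur, as in the finite sum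
      that defines a coefficient of the composition.\<close>
    have "{t. t \<in> ?B \<and> card (vertices t) = n} = Node ` (\<Union>k\<in>{0..m} \<inter> D. ?F k)"
    proof (intro set_eqI iffI)
      fix t assume t: "t \<in> {t. t \<in> ?B \<and> card (vertices t) = n}"
      obtain ts where ts: "t = Node ts" by (cases t)
      have "?sz ts = m" "length ts \<in> D" "set ts \<subseteq> ?B"
        using t ts Suc by (auto simp: card_vertices_Node Node_in_trees_with_degrees simp del: vertices.simps)
      then show "t \<in> Node ` (\<Union>k\<in>{0..m} \<inter> D. ?F k)"
        using ts length_le_total_size[of ts] by auto
    qed (use Suc in \<open>auto simp: card_vertices_Node Node_in_trees_with_degrees simp del: vertices.simps\<close>)
    then have "fps_nth ?T n = (\<Sum>ts\<in>(\<Union>k\<in>{0..m} \<inter> D. ?F k). tree_weight p (Node ts))"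
      by (simp add: tree_fps_def sum.reindex inj_on_def)
    also have "\<dots> = (\<Sum>k\<in>{0..m} \<inter> D. \<Sum>ts\<in>?F k. tree_weight p (Node ts))"
      by (intro sum.UNION_disjoint) auto
    also have "\<dots> = (\<Sum>k\<in>{0..m} \<inter> D. \<Sum>ts\<in>?F k. p k * (\<Prod>t\<leftarrow>ts. tree_weight p t))"
      by (intro sum.cong) (auto simp: tree_weight_Node)
    also have "\<dots> = (\<Sum>k\<in>{0..m} \<inter> D. p k * fps_nth (?T ^ k) m)"
      by (simp add: forest_fps_lists[symmetric] forest_fps_def sum_distrib_left)
    also have "\<dots> = (\<Sum>k\<in>{0..m}. (if k \<in> D then p k else 0) * fps_nth (?T ^ k) m)"
      by (rule sum.mono_neutral_cong_left) auto
    finally show ?thesis using Suc by (simp add: fps_compose_nth)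
  qed
qed

text \<open>
  Induction on \<open>m\<close> after van der Hofstad and Keane: conditioning on the first step reduces the claim
  to the identity \<open>m f' f^(m-1) = (f^m)'\<close>.
\<close>

lemma otter_dwass:
  fixes T f :: "real fps"
  assumes T: "T = fps_X * (f oo T)" and T0: "fps_nth T 0 = 0"
  shows "0 < m \<Longrightarrow> j \<le> m \<Longrightarrow> real m * fps_nth (T ^ j) m = real j * fps_nth (f ^ m) (m - j)"
proof (induction m arbitrary: j)
  case 0
  then show ?case by simp
next
  case (Suc m)
  show ?case
  proof (cases j)
    case 0
    then show ?thesis by simp
  next
    case j: (Suc j')
    have "(fps_X ^ j' * f) oo T = T ^ j' * (f oo T)"
      by (simp add: fps_compose_mult_distrib[OF T0] fps_compose_power[OF T0, symmetric] T0)
    moreover have "T ^ j = T ^ j' * (fps_X * (f oo T))"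
      by (subst T[symmetric]) (simp add: j mult_ac)
    ultimately have "T ^ j = fps_X * ((fps_X ^ j' * f) oo T)"
      by (simp add: mult_ac)
    then have TS: "fps_nth (T ^ j) (Suc m) = (\<Sum>i=0..m. fps_nth (fps_X ^ j' * f) i * fps_nth (T ^ i) m)"
      by (simp add: fps_compose_nth)
    show ?thesis
    \<comment> \<open>The induction hypothesis comes multiplied by \<open>m\<close>, and this factor
      is cancelled at the end; \<open>m = 0\<close> is the base of the recursion.\<close>
    proof (cases "m = 0")
      case True
      then have "j' = 0" using Suc.prems j by auto
      then show ?thesis using TS True j by simp
    next
      case False
      have f': "real m * fps_nth (T ^ j) (Suc m) = (\<Sum>i=0..m. fps_nth (fps_X ^ j' * f) i * (real i * fps_nth (f ^ m) (m - i)))"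
        unfolding TS sum_distrib_left
      proof (intro sum.cong refl)
        fix i assume "i \<in> {0..m}"
        then show "real m * (fps_nth (fps_X ^ j' * f) i * fps_nth (T ^ i) m) =
            fps_nth (fps_X ^ j' * f) i * (real i * fps_nth (f ^ m) (m - i))"
          using Suc.IH[of i] False by (simp add: mult_ac)
      qed
      \<comment> \<open>The factor \<open>i\<close> is the effect of \<open>X d/dX\<close> on
        coefficients, so the sum is one coefficient of a product with \<open>f ^ m\<close>.\<close>
      also have "\<dots> = fps_nth (fps_X * fps_deriv (fps_X ^ j' * f) * f ^ m) m"
      proof -
        have *: "fps_nth (fps_X * fps_deriv G) i = real i * fps_nth G i" for G :: "real fps" and i
          by (cases i) auto
        show ?thesis unfolding fps_mult_nth[of "fps_X * _"] * by (simp add: mult_ac)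
      qed
      also have "fps_X * fps_deriv (fps_X ^ j' * f) * f ^ m =
          fps_const (real j') * (fps_X ^ j' * f ^ Suc m) + fps_X ^ Suc j' * (fps_deriv f * f ^ m)"
      proof -
        have "fps_X * fps_deriv (fps_X ^ j' :: real fps) = fps_const (real j') * fps_X ^ j'"
        proof (cases j')
          case (Suc i)
          then show ?thesis using fps_deriv_power[of "fps_X :: real fps" j'] by (simp add: mult_ac del: of_nat_Suc)
        qed simp
        then have "fps_X * fps_deriv (fps_X ^ j' * f) * f ^ m =
            fps_const (real j') * fps_X ^ j' * f * f ^ m + fps_X * fps_X ^ j' * (fps_deriv f * f ^ m)"
          by (simp add: algebra_simps)
        then show ?thesis by (simp add: mult_ac)
      qed
      also have "fps_deriv f * f ^ m = fps_const (1 / real (Suc m)) * fps_deriv (f ^ Suc m)"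
      proof -
        have "fps_const (1 / real (Suc m)) * fps_deriv (f ^ Suc m) =
          (fps_const (1 / real (Suc m)) * fps_const (real (Suc m))) * (fps_deriv f * f ^ m)"
          by (simp only: fps_deriv_power diff_Suc_1 mult_ac)
        then show ?thesis by (simp add: fps_const_mult del: of_nat_Suc)
      qed
      finally have eq: "real m * fps_nth (T ^ j) (Suc m) =
          real j' * fps_nth (fps_X ^ j' * f ^ Suc m) m +
          fps_nth (fps_X ^ Suc j' * (fps_const (1 / real (Suc m)) * fps_deriv (f ^ Suc m))) m"
        by simp
      have "fps_nth (fps_X ^ Suc j' * (fps_const (1 / real (Suc m)) * fps_deriv (f ^ Suc m))) m =
          real (m - j') / real (Suc m) * fps_nth (f ^ Suc m) (m - j')"
      proof (cases "j' < m")
        case True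
        then obtain d where "m = Suc (j' + d)" using less_imp_Suc_add by blast
        then show ?thesis by (simp only: fps_X_power_mult_nth) (simp del: power_Suc)
      qed (simp only: fps_X_power_mult_nth, simp)
      moreover have "fps_nth (fps_X ^ j' * f ^ Suc m) m = fps_nth (f ^ Suc m) (m - j')"
        using Suc.prems j by (simp only: fps_X_power_mult_nth) simp
      ultimately have "real m * fps_nth (T ^ j) (Suc m) =
          (real j' + real (m - j') / real (Suc m)) * fps_nth (f ^ Suc m) (m - j')"
        using eq by (simp only: distrib_right)
      \<comment> \<open>The two terms come from differentiating \<open>X ^ j'\<close> and
        \<open>f\<close>; together they give the factor \<open>j / (m + 1)\<close> once
        \<open>m\<close> is cancelled.\<close>
      moreover have "real j' + real (m - j') / real (Suc m) = real m * real (Suc j') / real (Suc m)"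
        using Suc.prems j by (simp add: of_nat_diff field_simps)
      ultimately have "real m * fps_nth (T ^ j) (Suc m) =
          real m * (real (Suc j') / real (Suc m) * fps_nth (f ^ Suc m) (m - j'))" by simp
      then have "fps_nth (T ^ j) (Suc m) = real (Suc j') / real (Suc m) * fps_nth (f ^ Suc m) (m - j')"
        using False by (simp only: mult_cancel_left) simp
      then show ?thesis using j by (simp del: of_nat_Suc power_Suc)
    qed
  qed
qed

lemma tree_fps_UN:
  assumes "finite I" "\<And>i j. i \<in> I \<Longrightarrow> j \<in> I \<Longrightarrow> i \<noteq> j \<Longrightarrow> A i \<inter> A j = {}"
  shows "tree_fps p (\<Union>i\<in>I. A i) = (\<Sum>i\<in>I. tree_fps p (A i))"
proof (rule fps_ext)
  fix n
  have "{t. t \<in> (\<Union>i\<in>I. A i) \<and> card (vertices t) = n} = (\<Union>i\<in>I. {t. t \<in> A i \<and> card (vertices t) = n})" by auto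
  then have "fps_nth (tree_fps p (\<Union>i\<in>I. A i)) n = (\<Sum>t\<in>(\<Union>i\<in>I. {t. t \<in> A i \<and> card (vertices t) = n}). tree_weight p t)"
    by (simp add: tree_fps_def)
  also have "\<dots> = (\<Sum>i\<in>I. \<Sum>t | t \<in> A i \<and> card (vertices t) = n. tree_weight p t)"
    using assms by (intro sum.UNION_disjoint) (auto simp: disjoint_iff)
  finally show "fps_nth (tree_fps p (\<Union>i\<in>I. A i)) n = fps_nth (\<Sum>i\<in>I. tree_fps p (A i)) n"
    by (simp add: fps_sum_nth tree_fps_def)
qed

section \<open>Trees with one vertex of large degree and all other degrees bounded\<close>

text \<open>A polynomial rather than a power series, because it is evaluated at \<open>exp l\<close>
  in the Chernoff bounds; \<open>fps_of_poly\<close> carries it back to the tree equations.\<close>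

definition trunc_poly :: "(nat \<Rightarrow> real) \<Rightarrow> nat \<Rightarrow> real poly" where
  "trunc_poly p K = (\<Sum>k\<le>K. monom (p k) k)"

lemma coeff_trunc_poly: "coeff (trunc_poly p K) k = (if k \<le> K then p k else 0)"
  by (simp add: trunc_poly_def coeff_sum)

lemma fps_of_trunc_poly: "fps_of_poly (trunc_poly p K) = Abs_fps (\<lambda>k. if k \<in> {..K} then p k else 0)"
  by (rule fps_ext) (simp add: coeff_trunc_poly)

lemma pderiv_trunc_poly: "pderiv (trunc_poly p K) = (\<Sum>d\<in>{1..K}. monom (real d * p d) (d - 1))"
proof (rule poly_eqI)
  fix n
  have "coeff (\<Sum>d\<in>{1..K}. monom (real d * p d) (d - 1)) n = (\<Sum>d\<in>{1..K}. if d = Suc n then real d * p d else 0)"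
    unfolding coeff_sum by (intro sum.cong) auto
  then show "coeff (pderiv (trunc_poly p K)) n = coeff (\<Sum>d\<in>{1..K}. monom (real d * p d) (d - 1)) n"
    by (simp add: coeff_pderiv coeff_trunc_poly)
qed

text \<open>The recursion runs along the path from the root to a marked vertex of degree
  \<open>k\<close> at height \<open>h\<close>: \<open>d\<close> is the degree of the current spine
  vertex and \<open>i\<close> the position of its child on the path. All vertices but the marked one
  have degree at most \<open>K\<close>.\<close>

fun spine_trees :: "nat \<Rightarrow> nat \<Rightarrow> nat \<Rightarrow> plane_tree set" where
  "spine_trees K k 0 = Node ` {ts. set ts \<subseteq> trees_with_degrees {..K} \<and> length ts = k}"
| "spine_trees K k (Suc h) = (\<Union>d\<in>{1..K}. Node ` (\<Union>i\<in>{..<d}.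
     spine_forests (trees_with_degrees {..K}) (spine_trees K k h) i (d - 1 - i)))"

lemma spine_trees_vertex:
  "t \<in> spine_trees K k h \<Longrightarrow>
    \<exists>u\<in>vertices t. length u = h \<and> outdegree t u = k \<and> (\<forall>v\<in>vertices t. v \<noteq> u \<longrightarrow> outdegree t v \<le> K)"
proof (induction h arbitrary: t)
  case 0
  then obtain ts where ts: "t = Node ts" "set ts \<subseteq> trees_with_degrees {..K}" "length ts = k" by auto
  have "outdegree t v \<le> K" if "v \<in> vertices t" "v \<noteq> []" for v
    using that ts by (auto simp: trees_with_degrees_def subset_iff)
  then show ?case using ts by (intro bexI[of _ "[]"]) auto
next
  case (Suc h)
  then obtain d i x where "d \<le> K" "i < d" "t = Node x"
    "x \<in> spine_forests (trees_with_degrees {..K}) (spine_trees K k h) i (d - 1 - i)"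
    by auto
  then obtain l s r where *: "d \<le> K" "i < d" "t = Node (l @ s # r)" "s \<in> spine_trees K k h"
    "set l \<subseteq> trees_with_degrees {..K}" "set r \<subseteq> trees_with_degrees {..K}" "length l = i" "length r = d - 1 - i"
    by (elim spine_forestsE) blast
  obtain u where u: "u \<in> vertices s" "length u = h" "outdegree s u = k"
    "\<forall>v\<in>vertices s. v \<noteq> u \<longrightarrow> outdegree s v \<le> K"
    using Suc.IH[OF *(4)] by blast
  have small: "outdegree t v \<le> K" if v: "v \<in> vertices t" "v \<noteq> i # u" for v
  proof (cases v)
    case Nil
    then show ?thesis using * by simp
  next
    case (Cons j w)
    have j: "j < length (l @ s # r)" "w \<in> vertices ((l @ s # r) ! j)"
      using v Cons *(3) by auto
    show ?thesis
    proof (cases "j = i")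
      case True
      then show ?thesis using j v Cons * u by (auto simp: nth_append)
    next
      case False
      then have "(l @ s # r) ! j \<in> set l \<union> set r"
        using j(1) *(7) by (auto simp: nth_append nth_Cons split: nat.splits)
      then show ?thesis using j Cons * by (auto simp: trees_with_degrees_def subset_iff)
    qed
  qed
  have mem: "i # u \<in> vertices t" "outdegree t (i # u) = k"
    using *(3,7) u by (auto simp: nth_append intro!: bexI[of _ "length l"])
  show ?case by (rule bexI[OF _ mem(1)]) (use mem small u in auto)
qed

text \<open>For \<open>K < k\<close> the marked vertex is the only one of degree above
  \<open>K\<close>, so the set of maximisers is a singleton and height and degree of its element can
  be read off.\<close>

lemma max_degree_spine_trees:
  assumes "t \<in> spine_trees K k h" "K < k"
  shows "max_degree_height t = h" "outdegree t (max_degree_vertex t) = k"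
proof -
  obtain u where u: "u \<in> vertices t" "length u = h" "outdegree t u = k"
    "\<forall>v\<in>vertices t. v \<noteq> u \<longrightarrow> outdegree t v \<le> K"
    using spine_trees_vertex[OF assms(1)] by blast
  have "{v \<in> vertices t. \<forall>w \<in> vertices t. outdegree t w \<le> outdegree t v} = {u}"
    (is "?M = _")
  proof (intro equalityI subsetI)
    fix v assume v: "v \<in> ?M"
    then have "k \<le> outdegree t v" using u by auto
    then show "v \<in> {u}" using u(4) v assms(2) by force
  next
    fix v assume "v \<in> {u}"
    moreover have "outdegree t w \<le> outdegree t u" if "w \<in> vertices t" for w
      using u that assms(2) by (cases "w = u") force+
    ultimately show "v \<in> ?M" using u by auto
  qed
  then have "max_degree_vertex t = u" by (simp add: max_degree_vertex_def)
  then show "max_degree_height t = h" "outdegree t (max_degree_vertex t) = k"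
    using u by (auto simp: max_degree_height_def)
qed

lemma spine_trees_disjoint_bounded:
  assumes "K < k" shows "spine_trees K k h \<inter> trees_with_degrees {..K} = {}"
  using spine_trees_vertex[of _ K k h] assms by (fastforce simp: trees_with_degrees_def)

text \<open>Each of the \<open>h\<close> spine vertices below height \<open>h\<close> contributes
  \<open>X\<close> for itself and the sum of \<open>d * p d * T ^ (d - 1)\<close> for its degree and
  its other subtrees, which is the derivative of the truncated generating function at
  \<open>T\<close>. The marked vertex contributes \<open>X * p k * T ^ k\<close>.\<close>

lemma tree_fps_spine_trees:
  fixes p :: "nat \<Rightarrow> real"
  assumes "K < k"
  defines "T \<equiv> tree_fps p (trees_with_degrees {..K})"
  shows "tree_fps p (spine_trees K k h) =
    fps_const (p k) * fps_X ^ Suc h * T ^ k * (fps_of_poly (pderiv (trunc_poly p K)) oo T) ^ h"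
proof (induction h)
  case 0
  have "tree_fps p (spine_trees K k 0) = fps_X * (fps_const (p k) * T ^ k)"
    unfolding spine_trees.simps T_def forest_fps_lists[symmetric] by (rule tree_fps_Node) simp
  then show ?case by (simp add: mult_ac)
next
  case (Suc h)
  let ?A = "trees_with_degrees {..K}" and ?C = "spine_trees K k h"
  let ?L = "\<lambda>d i. spine_forests ?A ?C i (d - 1 - i)"
  have T0: "fps_nth T 0 = 0" by (simp add: T_def tree_fps_nth_0)
  have disj: "x \<notin> ?A" if "x \<in> ?C" for x
    using spine_trees_disjoint_bounded[OF assms(1), of h] that by auto
  \<comment> \<open>The spine child contains a vertex of degree above \<open>K\<close> and its
    siblings do not, so its position is determined by the forest. This makes the union over
    positions disjoint.\<close>
  have inj: "length l = length l'" if "l @ t # r = l' @ t' # r'" "t \<in> ?C" "t' \<in> ?C" "set l \<subseteq> ?A" "set l' \<subseteq> ?A"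
    for l t r l' t' r'
  proof (rule ccontr)
    assume "length l \<noteq> length l'"
    then consider "length l < length l'" | "length l' < length l" by linarith
    then show False
    proof cases
      case 1
      then have "t = l' ! length l" using arg_cong[OF that(1), of "\<lambda>x. x ! length l"] by (simp add: nth_append)
      then show False using 1 that disj by (meson nth_mem subsetD)
    next
      case 2
      then have "t' = l ! length l'" using arg_cong[OF that(1), of "\<lambda>x. x ! length l'"] by (simp add: nth_append)
      then show False using 2 that disj by (meson nth_mem subsetD)
    qed
  qed
  have len: "length x = d" if "x \<in> ?L d i" "i < d" for x d i
    using that by (elim spine_forestsE) auto
  have "tree_fps p (spine_trees K k (Suc h)) = (\<Sum>d\<in>{1..K}. tree_fps p (Node ` (\<Union>i\<in>{..<d}. ?L d i)))"
    unfolding spine_trees.simps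
  proof (rule tree_fps_UN)
    fix d d' :: nat assume "d \<noteq> d'"
    define A where "A = (\<Union>i\<in>{..<d}. ?L d i)"
    define B where "B = (\<Union>i\<in>{..<d'}. ?L d' i)"
    have "\<forall>x\<in>A. length x = d" "\<forall>x\<in>B. length x = d'"
      unfolding A_def B_def using len by blast+
    with \<open>d \<noteq> d'\<close> have "Node ` A \<inter> Node ` B = {}" by auto
    then show "Node ` (\<Union>i\<in>{..<d}. ?L d i) \<inter> Node ` (\<Union>i\<in>{..<d'}. ?L d' i) = {}"
      unfolding A_def B_def .
  qed simp
  also have "\<dots> = (\<Sum>d\<in>{1..K}. fps_X * (fps_const (p d) * (\<Sum>i<d. T ^ (d - 1) * tree_fps p ?C)))"
  proof (intro sum.cong refl)
    fix d assume d: "d \<in> {1..K}"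
    have "tree_fps p (Node ` (\<Union>i\<in>{..<d}. ?L d i)) = fps_X * (fps_const (p d) * forest_fps p (\<Union>i\<in>{..<d}. ?L d i))"
      by (rule tree_fps_Node) (use len in blast)
    also have "forest_fps p (\<Union>i\<in>{..<d}. ?L d i) = (\<Sum>i<d. forest_fps p (?L d i))"
    proof (rule forest_fps_UN)
      fix i j :: nat assume "i \<noteq> j"
      then have "x \<notin> ?L d j" if "x \<in> ?L d i" for x
        using that inj by (elim spine_forestsE) (metis spine_forestsE)
      then show "?L d i \<inter> ?L d j = {}" by blast
    qed simp
    also have "\<dots> = (\<Sum>i<d. T ^ (d - 1) * tree_fps p ?C)"
      by (intro sum.cong refl) (simp add: forest_fps_spine T_def)
    finally show "tree_fps p (Node ` (\<Union>i\<in>{..<d}. ?L d i)) =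
      fps_X * (fps_const (p d) * (\<Sum>i<d. T ^ (d - 1) * tree_fps p ?C))" .
  qed
  also have "\<dots> = fps_X * (\<Sum>d\<in>{1..K}. fps_const (real d * p d) * T ^ (d - 1)) * tree_fps p ?C"
    by (simp add: sum_distrib_left sum_distrib_right mult_ac fps_const_mult[symmetric] fps_of_nat del: fps_const_mult)
  also have "(\<Sum>d\<in>{1..K}. fps_const (real d * p d) * T ^ (d - 1)) = fps_of_poly (pderiv (trunc_poly p K)) oo T"
    by (simp add: pderiv_trunc_poly fps_of_poly_sum fps_of_poly_monom fps_compose_sum_distrib
        fps_compose_mult_distrib[OF T0] fps_compose_power[OF T0, symmetric] T0)
  finally show ?case using Suc by (simp add: mult_ac)
qed

definition nonneg_fps :: "real fps \<Rightarrow> bool" where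
  "nonneg_fps f \<longleftrightarrow> (\<forall>n. 0 \<le> fps_nth f n)"

lemma nonneg_fps_mult: "nonneg_fps f \<Longrightarrow> nonneg_fps g \<Longrightarrow> nonneg_fps (f * g)"
  by (auto simp: nonneg_fps_def fps_mult_nth intro!: sum_nonneg)

lemma nonneg_fps_power: "nonneg_fps f \<Longrightarrow> nonneg_fps (f ^ n)"
proof (induction n)
  case 0
  then show ?case by (simp add: nonneg_fps_def)
qed (auto intro: nonneg_fps_mult)

lemma nonneg_fps_trunc_poly:
  assumes "\<And>k. 0 \<le> p k"
  shows "nonneg_fps (fps_of_poly (trunc_poly p K))" "nonneg_fps (fps_of_poly (pderiv (trunc_poly p K)))"
  using assms by (auto simp: nonneg_fps_def coeff_trunc_poly coeff_pderiv)

lemma tree_fps_degrees_power: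
  assumes "0 < m" "j \<le> m"
  shows "fps_nth (tree_fps p (trees_with_degrees D) ^ j) m =
    real j / real m * fps_nth (Abs_fps (\<lambda>k. if k \<in> D then p k else 0) ^ m) (m - j)"
  using otter_dwass[OF tree_fps_eq tree_fps_nth_0 assms, of p D] assms by (simp add: field_simps)

text \<open>Expanding in powers \<open>T ^ i\<close> gives only exponents \<open>i \<ge> k\<close>,
  and Otter-Dwass attaches the weight \<open>i / m\<close> to each. Lowering it to
  \<open>k / m\<close> turns the sum into a plain product coefficient at the price of an inequality
  in the useful direction.\<close>

lemma tree_fps_spine_trees_ge:
  fixes p :: "nat \<Rightarrow> real"
  assumes p: "\<And>k. 0 \<le> p k" and "K < k" "k \<le> m" "0 < m"
  defines "P \<equiv> trunc_poly p K"
  shows "p k * (real k / real m) * coeff (pderiv P ^ h * P ^ m) (m - k)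
    \<le> fps_nth (tree_fps p (spine_trees K k h)) (Suc h + m)"
proof -
  let ?T = "tree_fps p (trees_with_degrees {..K})" and ?f = "fps_of_poly P" and ?g = "fps_of_poly (pderiv P)"
  have T0: "fps_nth ?T 0 = 0" by (simp add: tree_fps_nth_0)
  have "?T ^ k * (?g oo ?T) ^ h = (fps_X ^ k * ?g ^ h) oo ?T"
    by (simp add: fps_compose_mult_distrib[OF T0] fps_compose_power[OF T0, symmetric] T0)
  then have eq: "fps_nth (tree_fps p (spine_trees K k h)) (Suc h + m) = p k * fps_nth ((fps_X ^ k * ?g ^ h) oo ?T) m"
    using tree_fps_spine_trees[OF \<open>K < k\<close>, of p h]
    by (simp add: P_def mult.assoc fps_X_power_mult_nth del: power_Suc)
  have "fps_nth ((fps_X ^ k * ?g ^ h) oo ?T) m = (\<Sum>i=0..m. fps_nth (fps_X ^ k * ?g ^ h) i * fps_nth (?T ^ i) m)"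
    by (simp add: fps_compose_nth)
  also have "\<dots> \<ge> (\<Sum>i=0..m. fps_nth (fps_X ^ k * ?g ^ h) i * (real k / real m * fps_nth (?f ^ m) (m - i)))"
  proof (rule sum_mono)
    fix i assume i: "i \<in> {0..m}"
    have T: "fps_nth (?T ^ i) m = real i / real m * fps_nth (?f ^ m) (m - i)"
      using tree_fps_degrees_power[of m i p "{..K}"] i \<open>0 < m\<close> by (simp add: P_def fps_of_trunc_poly)
    have nn: "0 \<le> fps_nth (?f ^ m) (m - i)" "0 \<le> fps_nth (fps_X ^ k * ?g ^ h) i"
      using nonneg_fps_trunc_poly[of p K] p nonneg_fps_power
      by (auto simp: P_def nonneg_fps_def fps_X_power_mult_nth)
    show "fps_nth (fps_X ^ k * ?g ^ h) i * (real k / real m * fps_nth (?f ^ m) (m - i))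
       \<le> fps_nth (fps_X ^ k * ?g ^ h) i * fps_nth (?T ^ i) m"
    proof (cases "i < k")
      case True
      then show ?thesis by (simp add: fps_X_power_mult_nth)
    next
      case False
      then show ?thesis unfolding T using nn
        by (intro mult_left_mono mult_right_mono divide_right_mono) auto
    qed
  qed
  finally have "(\<Sum>i=0..m. fps_nth (fps_X ^ k * ?g ^ h) i * (real k / real m * fps_nth (?f ^ m) (m - i)))
      \<le> fps_nth ((fps_X ^ k * ?g ^ h) oo ?T) m" .
  also have "(\<Sum>i=0..m. fps_nth (fps_X ^ k * ?g ^ h) i * (real k / real m * fps_nth (?f ^ m) (m - i))) =
      real k / real m * fps_nth (fps_X ^ k * ?g ^ h * ?f ^ m) m"
    unfolding fps_mult_nth[of "fps_X ^ k * ?g ^ h"] sum_distrib_left by (simp add: mult_ac)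
  also have "fps_nth (fps_X ^ k * ?g ^ h * ?f ^ m) m = coeff (pderiv P ^ h * P ^ m) (m - k)"
    using \<open>k \<le> m\<close> by (simp add: mult.assoc fps_X_power_mult_nth fps_of_poly_mult[symmetric] fps_of_poly_power[symmetric] del: fps_of_poly_pderiv)
  finally show ?thesis unfolding eq mult.assoc[of "p k"] using p by (rule mult_left_mono)
qed

lemma tree_weight_nonneg: "(\<And>k. 0 \<le> p k) \<Longrightarrow> 0 \<le> tree_weight p t"
  by (auto simp: tree_weight_def intro!: prod_nonneg)

text \<open>Trees belonging to different \<open>k\<close> are disjoint because \<open>k\<close> is
  their maximal degree, so the single bounds may be added over a window of degrees.\<close>

lemma max_degree_height_weight_ge:
  fixes p :: "nat \<Rightarrow> real"
  assumes p: "\<And>k. 0 \<le> p k" and W: "finite W" "\<And>k. k \<in> W \<Longrightarrow> K < k \<and> k \<le> m" and m: "0 < m"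
  defines "P \<equiv> trunc_poly p K"
  shows "(\<Sum>k\<in>W. p k * (real k / real m) * coeff (pderiv P ^ h * P ^ m) (m - k))
    \<le> (\<Sum>t | max_degree_height t = h \<and> card (vertices t) = Suc h + m. tree_weight p t)"
proof -
  have "(\<Sum>k\<in>W. p k * (real k / real m) * coeff (pderiv P ^ h * P ^ m) (m - k))
      \<le> (\<Sum>k\<in>W. fps_nth (tree_fps p (spine_trees K k h)) (Suc h + m))"
    unfolding P_def using W m by (intro sum_mono tree_fps_spine_trees_ge p) auto
  also have "\<dots> = fps_nth (tree_fps p (\<Union>k\<in>W. spine_trees K k h)) (Suc h + m)"
  proof (subst tree_fps_UN)
    fix i j assume "i \<in> W" "j \<in> W" "i \<noteq> j"
    then show "spine_trees K i h \<inter> spine_trees K j h = {}"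
      using max_degree_spine_trees(2) W(2) by blast
  qed (use W in \<open>auto simp: fps_sum_nth\<close>)
  also have "\<dots> \<le> (\<Sum>t | max_degree_height t = h \<and> card (vertices t) = Suc h + m. tree_weight p t)"
    unfolding tree_fps_def fps_nth_Abs_fps
    using W(2) max_degree_spine_trees(1) by (intro sum_mono2 tree_weight_nonneg p) auto
  finally show ?thesis .
qed

text \<open>Otter-Dwass for a single tree, with all degrees allowed.\<close>

lemma total_weight_eq:
  assumes "0 < n"
  shows "(\<Sum>t | card (vertices t) = n. tree_weight p t) = fps_nth (Abs_fps p ^ n) (n - 1) / real n"
  using tree_fps_degrees_power[of n 1 p UNIV] assms
  by (simp add: trees_with_degrees_def tree_fps_def)

section \<open>The law of the tree conditioned on its size\<close>

lemma emeasure_BGW: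
  "emeasure (BGW \<mu>) {t. P t \<and> card (vertices t) = n} =
     ennreal (\<Sum>t | P t \<and> card (vertices t) = n. tree_weight (pmf \<mu>) t)"
proof -
  let ?S = "{t. P t \<and> card (vertices t) = n}"
  have "emeasure (BGW \<mu>) ?S = (\<integral>\<^sup>+ t. ennreal (tree_weight (pmf \<mu>) t) * indicator ?S t \<partial>count_space UNIV)"
    unfolding BGW_def tree_weight_def by (subst emeasure_density) auto
  also have "\<dots> = (\<Sum>t\<in>?S. ennreal (tree_weight (pmf \<mu>) t))"
    by (simp add: nn_integral_count_space_indicator[symmetric] nn_integral_count_space_finite)
  also have "\<dots> = ennreal (\<Sum>t\<in>?S. tree_weight (pmf \<mu>) t)"
    by (intro sum_ennreal tree_weight_nonneg) auto
  finally show ?thesis .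
qed

lemma measure_BGW_cond:
  "measure (BGW_cond \<mu> n) {t. P t} =
     (\<Sum>t | P t \<and> card (vertices t) = n. tree_weight (pmf \<mu>) t) / (\<Sum>t | card (vertices t) = n. tree_weight (pmf \<mu>) t)"
proof -
  have "{t. card (vertices t) = n} \<inter> {t. P t} = {t. P t \<and> card (vertices t) = n}" by auto
  moreover have "emeasure (BGW \<mu>) {t. card (vertices t) = n} = ennreal (\<Sum>t | card (vertices t) = n. tree_weight (pmf \<mu>) t)"
    using emeasure_BGW[of \<mu> "\<lambda>_. True" n] by simp
  moreover have "sets (BGW \<mu>) = UNIV" by (simp add: BGW_def)
  moreover have "0 \<le> (\<Sum>t | P t \<and> card (vertices t) = n. tree_weight (pmf \<mu>) t)"
     "0 \<le> (\<Sum>t | card (vertices t) = n. tree_weight (pmf \<mu>) t)"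
    by (intro sum_nonneg tree_weight_nonneg; simp)+
  \<comment> \<open>For \<open>b = 0\<close> the extended quotient is 0 or infinite, and
    \<open>enn2real\<close> sends both to 0, in agreement with division by zero in the reals. So the
    formula covers sizes of probability zero too.\<close>
  moreover have "enn2real (ennreal a / ennreal b) = a / b" if "0 \<le> a" "0 \<le> b" for a b
  proof (cases "b = 0")
    case True
    then show ?thesis by (cases "a = 0") (use that in \<open>auto simp: divide_ennreal_def ennreal_mult_top\<close>)
  qed (use that in \<open>auto simp: divide_ennreal\<close>)
  ultimately show ?thesis
    unfolding BGW_cond_def measure_def
    by (subst emeasure_uniform_measure) (auto simp: emeasure_BGW)
qed

section \<open>Truncated moments of the offspring law\<close>

lemma le_nat_floor_iff: "0 \<le> y \<Longrightarrow> k \<le> nat \<lfloor>y\<rfloor> \<longleftrightarrow> real k \<le> y"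
  by (simp add: le_nat_iff le_floor_iff)

lemma mem_nat_floor_interval:
  "0 \<le> x \<Longrightarrow> 0 \<le> y \<Longrightarrow> k \<in> {nat \<lfloor>x\<rfloor><..nat \<lfloor>y\<rfloor>} \<longleftrightarrow> x < real k \<and> real k \<le> y"
  by (auto simp: le_nat_floor_iff not_le[symmetric] simp del: not_le)

lemma sum_nat_floor_diff:
  fixes f :: "nat \<Rightarrow> real"
  assumes "x \<le> y"
  shows "(\<Sum>k\<le>nat \<lfloor>y\<rfloor>. f k) - (\<Sum>k\<le>nat \<lfloor>x\<rfloor>. f k) = (\<Sum>k\<in>{nat \<lfloor>x\<rfloor><..nat \<lfloor>y\<rfloor>}. f k)"
proof -
  have "nat \<lfloor>x\<rfloor> \<le> nat \<lfloor>y\<rfloor>" using assms by (intro nat_mono floor_mono)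
  then have "{..nat \<lfloor>y\<rfloor>} = {..nat \<lfloor>x\<rfloor>} \<union> {nat \<lfloor>x\<rfloor><..nat \<lfloor>y\<rfloor>}" by auto
  then have "(\<Sum>k\<le>nat \<lfloor>y\<rfloor>. f k) = (\<Sum>k\<le>nat \<lfloor>x\<rfloor>. f k) + (\<Sum>k\<in>{nat \<lfloor>x\<rfloor><..nat \<lfloor>y\<rfloor>}. f k)"
    by (simp, subst sum.union_disjoint) auto
  then show ?thesis by simp
qed

text \<open>For a monotone function the factor 2 suffices: iteration gives powers of 2, monotonicity
  squeezes every \<open>a \<ge> 1\<close> between 1 and such a power, and \<open>a < 1\<close>
  follows by taking reciprocals.\<close>

lemma slowly_varying_antimonoI:
  assumes mono: "antimono g" and pos: "\<And>x. g x > 0"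
    and lim: "((\<lambda>x. g (2 * x) / g x) \<longlongrightarrow> 1) at_top"
  shows "slowly_varying g"
  unfolding slowly_varying_def
proof (intro conjI exI[of _ 0] allI impI)
  have "g \<in> borel_measurable borel"
  proof -
    have "(\<lambda>x. - (- g x)) \<in> borel_measurable borel"
      using mono by (intro borel_measurable_uminus borel_measurable_mono) (auto simp: mono_def antimono_def)
    then show ?thesis by simp
  qed
  then show "set_borel_measurable borel {0..} g" by (simp add: set_borel_measurable_def)
  have pow: "((\<lambda>x. g (2 ^ j * x) / g x) \<longlongrightarrow> 1) at_top" for j :: nat
  proof (induction j)
    case 0
    have "g x \<noteq> 0" for x using pos[of x] by simp
    then show ?case by simp
  next
    case (Suc j)
    have "filterlim (\<lambda>x::real. 2 ^ j * x) at_top at_top"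
      by (rule filterlim_tendsto_pos_mult_at_top[OF tendsto_const _ filterlim_ident]) simp
    then have "((\<lambda>x. g (2 * (2 ^ j * x)) / g (2 ^ j * x) * (g (2 ^ j * x) / g x)) \<longlongrightarrow> 1 * 1) at_top"
      by (intro tendsto_mult Suc filterlim_compose[OF lim])
    moreover have "g (2 * (2 ^ j * x)) / g (2 ^ j * x) * (g (2 ^ j * x) / g x) = g (2 ^ Suc j * x) / g x" for x
      using pos[of "2 ^ j * x"] by (simp add: mult.assoc)
    ultimately show ?case by (simp only: mult_1)
  qed
  have ge1: "((\<lambda>x. g (a * x) / g x) \<longlongrightarrow> 1) at_top" if "a \<ge> 1" for a :: real
  proof -
    obtain j where j: "a < 2 ^ j" using real_arch_pow[of 2 a] by auto
    show ?thesis
    proof (rule tendsto_sandwich[OF _ _ pow[of j] tendsto_const])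
      show "eventually (\<lambda>x. g (2 ^ j * x) / g x \<le> g (a * x) / g x) at_top"
        using eventually_ge_at_top[of 0]
      proof eventually_elim
        case (elim x)
        have "a * x \<le> 2 ^ j * x" using elim j by (intro mult_right_mono) auto
        then show ?case using pos[of x] antimonoD[OF mono] by (intro divide_right_mono) auto
      qed
      show "eventually (\<lambda>x. g (a * x) / g x \<le> 1) at_top"
        using eventually_ge_at_top[of 0]
      proof eventually_elim
        case (elim x)
        have "1 * x \<le> a * x" using elim that by (intro mult_right_mono) auto
        then show ?case using pos[of x] antimonoD[OF mono, of "1 * x" "a * x"] by simp
      qed
    qed
  qed
  fix a :: real assume a: "a > 0"
  show "((\<lambda>x. g (a * x) / g x) \<longlongrightarrow> 1) at_top"
  proof (cases "a \<ge> 1")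
    case False
    have "((\<lambda>x. inverse (g (1 / a * x) / g x)) \<longlongrightarrow> inverse 1) at_top"
      using a False by (intro tendsto_inverse ge1) auto
    moreover have "filterlim (\<lambda>x. a * x) at_top at_top"
      by (rule filterlim_tendsto_pos_mult_at_top[OF tendsto_const a filterlim_ident])
    ultimately have "((\<lambda>x. inverse (g (1 / a * (a * x)) / g (a * x))) \<longlongrightarrow> inverse 1) at_top"
      by (rule filterlim_compose)
    then show ?thesis using a by simp
  qed (use ge1 in auto)
qed (use pos in auto)

text \<open>The constant is \<open>(1 + e)^3 - 1 = 3 e + 3 e^2 + e^3 \<le> 7 e\<close> for
  \<open>e \<le> 1\<close>.\<close>

lemma abs_prod3_minus_1_le:
  fixes u v w e :: real
  assumes "\<bar>u - 1\<bar> \<le> e" "\<bar>v - 1\<bar> \<le> e" "\<bar>w - 1\<bar> \<le> e" "e \<le> 1"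
  shows "\<bar>u * v * w - 1\<bar> \<le> 7 * e"
proof -
  have e: "0 \<le> e" using assms(1) by linarith
  have ee: "e * e \<le> e * 1" using e assms(4) by (intro mult_left_mono)
  have "\<bar>(u - 1) * (v - 1)\<bar> \<le> e * e"
    using assms e by (simp only: abs_mult) (intro mult_mono, auto)
  moreover have "u * v - 1 = (u - 1) * (v - 1) + (u - 1) + (v - 1)" by (simp add: algebra_simps)
  ultimately have uv: "\<bar>u * v - 1\<bar> \<le> 3 * e" using assms ee by linarith
  have "\<bar>(u * v - 1) * (w - 1)\<bar> \<le> 3 * e * e"
    using assms e uv by (simp only: abs_mult) (intro mult_mono, auto)
  moreover have "u * v * w - 1 = (u * v - 1) * (w - 1) + (u * v - 1) + (w - 1)" by (simp add: algebra_simps)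
  ultimately show ?thesis using assms uv ee by linarith
qed

section \<open>Truncated moments of an offspring law with regularly varying masses of index
  -2\<close>

locale cauchy_offspring =
  fixes L :: "real \<Rightarrow> real" and p :: "nat \<Rightarrow> real"
  assumes L: "slowly_varying L"
    and p_nonneg: "\<And>k. 0 \<le> p k"
    and p_sums: "p sums 1"
    and mean: "(\<lambda>k. real k * p k) sums 1"
    and asymp: "p \<sim>[at_top] (\<lambda>n. L (real n) / (real n)\<^sup>2)"
begin

text \<open>Because the mean is 1, the tail of the first moment is the complement of a finite sum;
  \<open>tail\<close> is treated alike, so that differences are finite sums over integer
  intervals.\<close>

definition ell :: "real \<Rightarrow> real" where
  "ell x = 1 - (\<Sum>k\<le>nat \<lfloor>x\<rfloor>. real k * p k)"

definition tail :: "real \<Rightarrow> real" where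
  "tail x = 1 - (\<Sum>k\<le>nat \<lfloor>x\<rfloor>. p k)"

definition V :: "real \<Rightarrow> real" where
  "V x = (\<Sum>k\<le>nat \<lfloor>x\<rfloor>. (real k)\<^sup>2 * p k)"

lemma ell_diff: "x \<le> y \<Longrightarrow> ell x - ell y = (\<Sum>k\<in>{nat \<lfloor>x\<rfloor><..nat \<lfloor>y\<rfloor>}. real k * p k)"
  using sum_nat_floor_diff[of x y "\<lambda>k. real k * p k"] by (simp add: ell_def)

lemma tail_diff: "x \<le> y \<Longrightarrow> tail x - tail y = (\<Sum>k\<in>{nat \<lfloor>x\<rfloor><..nat \<lfloor>y\<rfloor>}. p k)"
  using sum_nat_floor_diff[of x y p] by (simp add: tail_def)

lemma V_diff: "x \<le> y \<Longrightarrow> V y - V x = (\<Sum>k\<in>{nat \<lfloor>x\<rfloor><..nat \<lfloor>y\<rfloor>}. (real k)\<^sup>2 * p k)"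
  using sum_nat_floor_diff[of x y "\<lambda>k. (real k)\<^sup>2 * p k"] by (simp add: V_def)

lemma ell_antimono: "x \<le> y \<Longrightarrow> ell y \<le> ell x"
  using ell_diff[of x y] p_nonneg sum_nonneg[of "{nat \<lfloor>x\<rfloor><..nat \<lfloor>y\<rfloor>}" "\<lambda>k. real k * p k"] by simp

lemma V_mono: "x \<le> y \<Longrightarrow> V x \<le> V y"
  using V_diff[of x y] p_nonneg sum_nonneg[of "{nat \<lfloor>x\<rfloor><..nat \<lfloor>y\<rfloor>}" "\<lambda>k. (real k)\<^sup>2 * p k"] by simp

lemma V_nonneg: "0 \<le> V x"
  unfolding V_def by (intro sum_nonneg) (simp add: p_nonneg)

lemma ell_le_1: "ell x \<le> 1"
  unfolding ell_def using p_nonneg by (simp add: sum_nonneg)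

lemma nat_floor_at_top: "filterlim (\<lambda>x::real. nat \<lfloor>x\<rfloor>) at_top at_top"
  unfolding filterlim_at_top
proof
  fix Z :: nat
  show "eventually (\<lambda>x::real. Z \<le> nat \<lfloor>x\<rfloor>) at_top"
    using eventually_ge_at_top[of "real Z"] by eventually_elim (simp add: le_nat_floor_iff)
qed

lemma ell_tendsto_0: "(ell \<longlongrightarrow> 0) at_top"
proof -
  have "(\<lambda>n. \<Sum>k\<le>n. real k * p k) \<longlonglongrightarrow> 1" using mean by (simp add: sums_def_le)
  from filterlim_compose[OF this nat_floor_at_top]
  have "(ell \<longlongrightarrow> 1 - 1) at_top" unfolding ell_def by (intro tendsto_diff) auto
  then show ?thesis by simp
qed

lemma tail_tendsto_0: "(tail \<longlongrightarrow> 0) at_top"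
proof -
  have "(\<lambda>n. \<Sum>k\<le>n. p k) \<longlonglongrightarrow> 1" using p_sums by (simp add: sums_def_le)
  from filterlim_compose[OF this nat_floor_at_top]
  have "(tail \<longlongrightarrow> 1 - 1) at_top" unfolding tail_def by (intro tendsto_diff) auto
  then show ?thesis by simp
qed

text \<open>The ratio of \<open>p k\<close> to \<open>L x / k^2\<close> is a product of three ratios
  near 1: the assumed asymptotics at \<open>k\<close>, the change from \<open>L k\<close> to
  \<open>L (d * x)\<close>, uniform in \<open>k\<close>, and the change from
  \<open>L (d * x)\<close> to \<open>L x\<close>. The base point is \<open>d * x\<close> because the
  uniform theorem covers multipliers of at least 1.\<close>

lemma p_asymp_uniform:
  assumes d: "0 < d" "d \<le> 1" and A: "1 \<le> A" and e: "0 < e"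
  shows "eventually (\<lambda>x. \<forall>k. d * x \<le> real k \<and> real k \<le> A * x \<longrightarrow>
    (1 - e) * L x / (real k)\<^sup>2 \<le> p k \<and> p k \<le> (1 + e) * L x / (real k)\<^sup>2) at_top"
proof -
  define h where "h = min (e / 7) 1"
  have h: "0 < h" "h \<le> 1" "7 * h \<le> e" using e by (auto simp: h_def)
  have Lpos: "eventually (\<lambda>n. L (real n) > 0) sequentially"
    by (rule eventually_compose_filterlim[OF slowly_varying_eventually_pos[OF L] filterlim_real_sequentially])
  have "((\<lambda>n. p n / (L (real n) / (real n)\<^sup>2)) \<longlongrightarrow> 1) at_top"
  proof (rule asymp_equivD_strong[OF asymp])
    show "eventually (\<lambda>n. p n \<noteq> 0 \<or> L (real n) / (real n)\<^sup>2 \<noteq> 0) sequentially"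
      using eventually_gt_at_top[of 0] Lpos by eventually_elim auto
  qed
  then have "eventually (\<lambda>n. dist (p n / (L (real n) / (real n)\<^sup>2)) 1 < h) sequentially"
    using h by (auto simp: tendsto_iff)
  then obtain N where N: "\<And>n. n \<ge> N \<Longrightarrow> \<bar>p n / (L (real n) / (real n)\<^sup>2) - 1\<bar> < h"
    by (auto simp: eventually_sequentially dist_real_def)
  have top: "filterlim (\<lambda>x. d * x) at_top at_top"
    by (rule filterlim_tendsto_pos_mult_at_top[OF tendsto_const d(1) filterlim_ident])
  \<comment> \<open>The factor 2 keeps the range of multipliers nondegenerate when
    \<open>d = A = 1\<close>, as the uniform theorem requires a right end strictly above 1.\<close>
  have "2 * A / d > 1"
  proof -
    have "1 * d < 2 * A" using d A by simp
    then show ?thesis using d by (simp add: field_simps)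
  qed
  then have U: "eventually (\<lambda>x. \<forall>a\<in>{1..2 * A / d}. \<bar>L (a * (d * x)) / L (d * x) - 1\<bar> < h) at_top"
    by (intro eventually_compose_filterlim[OF slowly_varying_uniform[OF L] top]) (use h in auto)
  have W: "eventually (\<lambda>x. \<bar>L (d * x) / L x - 1\<bar> < h) at_top"
    using slowly_varying_lim[OF L d(1)] h by (auto simp: tendsto_iff dist_real_def)
  have P: "eventually (\<lambda>x. L (d * x) > 0) at_top"
    by (rule eventually_compose_filterlim[OF slowly_varying_eventually_pos[OF L] top])
  show ?thesis
    using U W P slowly_varying_eventually_pos[OF L] eventually_ge_at_top[of "(real N + 1) / d"] eventually_gt_at_top[of 0]
  proof eventually_elim
    case (elim x)
    show ?case
    proof (intro allI impI)
      fix k assume k: "d * x \<le> real k \<and> real k \<le> A * x"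
      have "real N + 1 \<le> d * x" using elim d by (simp add: field_simps)
      then have kN: "N \<le> k" "0 < k" using k by linarith+
      have dx: "0 < d * x" using elim d by simp
      define a where "a = real k / (d * x)"
      have "real k \<le> 2 * A * x" using k A elim by (auto intro: order_trans)
      then have "a \<in> {1..2 * A / d}" using k dx d elim by (simp add: a_def field_simps)
      moreover have "a * (d * x) = real k" using d elim by (simp add: a_def)
      ultimately have 1: "\<bar>L (real k) / L (d * x) - 1\<bar> < h" using bspec[OF elim(1)] by metis
      then have "L (real k) / L (d * x) > 0" using h by linarith
      then have Lk: "L (real k) > 0" using elim by (simp add: zero_less_divide_iff)
      have "\<bar>p k / (L (real k) / (real k)\<^sup>2) * (L (real k) / L (d * x)) * (L (d * x) / L x) - 1\<bar> \<le> 7 * h"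
        using N[OF kN(1)] 1 elim(2) h by (intro abs_prod3_minus_1_le) auto
      also have "p k / (L (real k) / (real k)\<^sup>2) * (L (real k) / L (d * x)) * (L (d * x) / L x) = p k * (real k)\<^sup>2 / L x"
        using Lk elim by (simp add: field_simps)
      finally have "\<bar>p k * (real k)\<^sup>2 / L x - 1\<bar> \<le> e" using h by linarith
      then have "p k * (real k)\<^sup>2 / L x \<le> 1 + e" "1 - e \<le> p k * (real k)\<^sup>2 / L x" by linarith+
      then show "(1 - e) * L x / (real k)\<^sup>2 \<le> p k \<and> p k \<le> (1 + e) * L x / (real k)\<^sup>2"
        using elim kN by (simp add: field_simps)
    qed
  qed
qed

lemma nat_floor_diff_bounds:
  assumes "0 \<le> x" "x \<le> y"
  shows "real (card {nat \<lfloor>x\<rfloor><..nat \<lfloor>y\<rfloor>}) \<le> y - x + 1" "y - x - 1 \<le> real (card {nat \<lfloor>x\<rfloor><..nat \<lfloor>y\<rfloor>})"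
proof -
  have "nat \<lfloor>x\<rfloor> \<le> nat \<lfloor>y\<rfloor>" using assms by (intro nat_mono floor_mono)
  then have "real (card {nat \<lfloor>x\<rfloor><..nat \<lfloor>y\<rfloor>}) = real_of_int \<lfloor>y\<rfloor> - real_of_int \<lfloor>x\<rfloor>"
    using assms by (simp add: of_nat_diff)
  then show "real (card {nat \<lfloor>x\<rfloor><..nat \<lfloor>y\<rfloor>}) \<le> y - x + 1" "y - x - 1 \<le> real (card {nat \<lfloor>x\<rfloor><..nat \<lfloor>y\<rfloor>})"
    by linarith+
qed

text \<open>
  Each of the \<open>N\<close> dyadic blocks after \<open>x\<close> contributes to \<open>ell x\<close> at least a fixed fraction of the first.
\<close>

lemma ell_block_ratio:
  "eventually (\<lambda>x. 0 < ell x \<and> real N * (ell x - ell (2 * x)) \<le> 24 * ell x) at_top"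
proof -
  have "eventually (\<lambda>x. \<forall>k. 1 * x \<le> real k \<and> real k \<le> 2 ^ Suc N * x \<longrightarrow>
    (1 - 1/2) * L x / (real k)\<^sup>2 \<le> p k \<and> p k \<le> (1 + 1/2) * L x / (real k)\<^sup>2) at_top"
    by (rule p_asymp_uniform) (auto simp: one_le_power simp del: power_Suc)
  then show ?thesis
    using eventually_ge_at_top[of 2] slowly_varying_eventually_pos[OF L]
  proof eventually_elim
    case (elim x)
    \<comment> \<open>The block after \<open>2 ^ i * x\<close> contains at least half of
      \<open>2 ^ i * x\<close> integers after rounding, each contributing at least
      \<open>L x / (4 * (2 ^ i * x))\<close>.\<close>
    have low: "L x / 8 \<le> ell (2 ^ i * x) - ell (2 ^ Suc i * x)" if "i \<le> N" for i
    proof -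
      let ?I = "{nat \<lfloor>2 ^ i * x\<rfloor><..nat \<lfloor>2 ^ Suc i * x\<rfloor>}"
      have X: "2 * 1 \<le> 2 ^ i * x" using elim by (subst mult.commute, intro mult_mono) auto
      have "L x / (4 * (2 ^ i * x)) \<le> real k * p k" if "k \<in> ?I" for k
      proof -
        have k: "2 ^ i * x < real k" "real k \<le> 2 ^ Suc i * x"
          using that mem_nat_floor_interval[of "2 ^ i * x" "2 ^ Suc i * x" k] elim by simp_all
        have "1 * x \<le> 2 ^ i * x" using elim by (intro mult_right_mono) auto
        moreover have "2 ^ Suc i * x \<le> 2 ^ Suc N * x"
          using elim \<open>i \<le> N\<close> by (intro mult_right_mono power_increasing) auto
        ultimately have "L x / 2 / (real k)\<^sup>2 \<le> p k" using k elim(1)[rule_format, of k] by simp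
        then have "L x / 2 / real k \<le> real k * p k"
          using k X by (simp add: field_simps power2_eq_square)
        moreover have "L x / (4 * (2 ^ i * x)) \<le> L x / (2 * real k)"
          using k X elim by (intro divide_left_mono) (auto simp: mult_ac)
        ultimately show ?thesis by simp
      qed
      then have "real (card ?I) * (L x / (4 * (2 ^ i * x))) \<le> (\<Sum>k\<in>?I. real k * p k)"
        by (intro sum_bounded_below)
      also have "\<dots> = ell (2 ^ i * x) - ell (2 ^ Suc i * x)"
        using elim by (subst ell_diff) auto
      finally have "real (card ?I) * (L x / (4 * (2 ^ i * x))) \<le> ell (2 ^ i * x) - ell (2 ^ Suc i * x)" .
      moreover have "(2 ^ i * x) / 2 \<le> real (card ?I)"
        using nat_floor_diff_bounds(2)[of "2 ^ i * x" "2 ^ Suc i * x"] X elim by (simp add: mult_ac)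
      then have "(2 ^ i * x) / 2 * (L x / (4 * (2 ^ i * x))) \<le> real (card ?I) * (L x / (4 * (2 ^ i * x)))"
        using X elim by (intro mult_right_mono) auto
      moreover have "(2 ^ i * x) / 2 * (L x / (4 * (2 ^ i * x))) = L x / 8" using elim by simp
      ultimately show ?thesis by linarith
    qed
    \<comment> \<open>At most \<open>x + 1 \<le> 2 * x\<close> integers, each contributing at most
      \<open>3/2 * L x / x\<close>. Comparing 3 with 1/8 gives the constant 24.\<close>
    have up: "ell x - ell (2 * x) \<le> 3 * L x"
    proof -
      let ?I = "{nat \<lfloor>x\<rfloor><..nat \<lfloor>2 * x\<rfloor>}"
      have "real k * p k \<le> 3 / 2 * L x / x" if "k \<in> ?I" for k
      proof -
        have k: "x < real k" "real k \<le> 2 * x"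
          using that elim mem_nat_floor_interval[of x "2 * x" k] by auto
        moreover have "2 * x \<le> 2 ^ Suc N * x" using elim by (intro mult_right_mono) auto
        then have "real k \<le> 2 ^ Suc N * x" using k by linarith
        ultimately have "p k \<le> 3/2 * L x / (real k)\<^sup>2" using elim(1)[rule_format, of k] by (simp del: power_Suc)
        then have "real k * p k \<le> 3 / 2 * L x / real k"
          using k elim by (simp add: field_simps power2_eq_square)
        also have "\<dots> \<le> 3 / 2 * L x / x" using k elim by (intro divide_left_mono) auto
        finally show ?thesis .
      qed
      then have "(\<Sum>k\<in>?I. real k * p k) \<le> real (card ?I) * (3 / 2 * L x / x)"
        by (intro sum_bounded_above)
      also have "\<dots> \<le> (2 * x) * (3 / 2 * L x / x)"
        using nat_floor_diff_bounds(1)[of x "2 * x"] elim by (intro mult_right_mono) auto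
      also have "\<dots> = 3 * L x" using elim by simp
      finally show ?thesis using elim by (subst ell_diff) auto
    qed
    have ell0: "0 \<le> ell y" for y
    proof (rule tendsto_upperbound[OF ell_tendsto_0])
      show "eventually (\<lambda>z. ell z \<le> ell y) at_top"
        using eventually_ge_at_top[of y] by eventually_elim (rule ell_antimono)
    qed simp
    have sum: "ell x - ell (2 ^ n * x) = (\<Sum>i<n. ell (2 ^ i * x) - ell (2 ^ Suc i * x))" for n :: nat
      by (induction n) auto
    have "real N * (L x / 8) \<le> (\<Sum>i<N. ell (2 ^ i * x) - ell (2 ^ Suc i * x))"
      using sum_bounded_below[of "{..<N}" "L x / 8" "\<lambda>i. ell (2 ^ i * x) - ell (2 ^ Suc i * x)"] low by simp
    also have "\<dots> = ell x - ell (2 ^ N * x)" by (rule sum[symmetric])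
    also have "\<dots> \<le> ell x" using ell0 by simp
    finally have "real N * (3 * L x) \<le> 24 * ell x" by (simp add: mult_ac)
    moreover have "real N * (ell x - ell (2 * x)) \<le> real N * (3 * L x)"
      using up by (intro mult_left_mono) auto
    moreover have "0 < ell x" using low[of 0] ell0[of "2 * x"] elim by simp
    ultimately show ?case by linarith
  qed
qed

lemma ell_pos: "0 < ell x"
proof -
  have "eventually (\<lambda>y. 0 < ell y \<and> x \<le> y) at_top"
    using ell_block_ratio[of 0] eventually_ge_at_top[of x] by eventually_elim auto
  then obtain y where "0 < ell y" "x \<le> y" by (auto simp: eventually_at_top_linorder)
  then show ?thesis using ell_antimono[of x y] by linarith
qed

text \<open>By \<open>ell_block_ratio\<close> one doubling loses at most the fraction
  \<open>24 / N\<close> of \<open>ell x\<close>, for every \<open>N\<close>, and for a monotone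
  function doublings decide.\<close>

lemma ell_slowly_varying: "slowly_varying ell"
proof (rule slowly_varying_antimonoI)
  show "antimono ell" using ell_antimono by (auto simp: antimono_def)
  show "((\<lambda>x. ell (2 * x) / ell x) \<longlongrightarrow> 1) at_top"
    unfolding tendsto_iff
  proof (intro allI impI)
    fix e :: real assume e: "e > 0"
    obtain N where N: "24 / e < real N" using reals_Archimedean2 by blast
    moreover have "0 < 24 / e" using e by simp
    ultimately have Npos: "0 < real N" by linarith
    show "eventually (\<lambda>x. dist (ell (2 * x) / ell x) 1 < e) at_top"
      using ell_block_ratio[of N] eventually_ge_at_top[of 0]
    proof eventually_elim
      case (elim x)
      have "24 < e * real N" using N e by (simp add: field_simps)
      then have "24 * ell x < e * real N * ell x" using elim by (intro mult_strict_right_mono) auto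
      then have "24 * ell x < real N * (e * ell x)" by (simp only: mult_ac)
      then have "real N * (ell x - ell (2 * x)) < real N * (e * ell x)" using elim by linarith
      then have "ell x - ell (2 * x) < e * ell x" using Npos by (simp only: mult_less_cancel_left_pos)
      moreover have "ell (2 * x) \<le> ell x" using elim by (intro ell_antimono) auto
      moreover have "dist (ell (2 * x) / ell x) 1 = (ell x - ell (2 * x)) / ell x"
        using elim calculation(2) by (simp add: dist_real_def field_simps)
      ultimately show ?case using elim by (simp add: pos_divide_less_eq)
    qed
  qed
qed (rule ell_pos)

text \<open>The Potter bound keeps \<open>ell x\<close> above a multiple of
  \<open>1 / sqrt x\<close>.\<close>

lemma x_ell_at_top: "filterlim (\<lambda>x. x * ell x) at_top at_top"
proof -
  obtain X where X: "X > 0" "\<And>x y. X \<le> x \<Longrightarrow> x \<le> y \<Longrightarrow> ell x \<le> 2 * sqrt (y / x) * ell y"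
    using potter_bounds[OF ell_slowly_varying] by metis
  have "filterlim (\<lambda>x. (ell X * sqrt X / 2) * sqrt x) at_top at_top"
    using X ell_pos by (intro filterlim_tendsto_pos_mult_at_top[OF tendsto_const _ sqrt_at_top]) auto
  then show ?thesis
  proof (rule filterlim_at_top_mono)
    show "eventually (\<lambda>x. (ell X * sqrt X / 2) * sqrt x \<le> x * ell x) at_top"
      using eventually_ge_at_top[of X]
    proof eventually_elim
      case (elim x)
      have "ell X * sqrt X / 2 * sqrt x \<le> (2 * sqrt (x / X) * ell x) * sqrt X / 2 * sqrt x"
        using X(2)[of X x] elim X(1) by (intro mult_right_mono divide_right_mono) auto
      also have "\<dots> = x * ell x" using X(1) elim by (simp add: real_sqrt_divide)
      finally show ?case .
    qed
  qed
qed

lemma V_halving: "0 \<le> x \<Longrightarrow> V x \<le> V (x / 2) + x * (ell (x / 2) - ell x)"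
proof -
  assume x: "0 \<le> x"
  have "V x - V (x / 2) = (\<Sum>k\<in>{nat \<lfloor>x / 2\<rfloor><..nat \<lfloor>x\<rfloor>}. (real k)\<^sup>2 * p k)"
    using x by (intro V_diff) auto
  also have "\<dots> \<le> (\<Sum>k\<in>{nat \<lfloor>x / 2\<rfloor><..nat \<lfloor>x\<rfloor>}. x * (real k * p k))"
  proof (intro sum_mono)
    fix k assume "k \<in> {nat \<lfloor>x / 2\<rfloor><..nat \<lfloor>x\<rfloor>}"
    then have "real k \<le> x" using x mem_nat_floor_interval[of "x / 2" x k] by auto
    then have "real k * (real k * p k) \<le> x * (real k * p k)" using p_nonneg by (intro mult_right_mono) auto
    then show "(real k)\<^sup>2 * p k \<le> x * (real k * p k)" by (simp add: power2_eq_square mult.assoc)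
  qed
  also have "\<dots> = x * (ell (x / 2) - ell x)"
    using x by (subst ell_diff) (auto simp: sum_distrib_left)
  finally show ?thesis by linarith
qed

text \<open>On one dyadic block \<open>V\<close> grows by at most
  \<open>x * (ell (x / 2) - ell x)\<close>, which is \<open>o(x * ell x)\<close> by slow variation.
  Summing the blocks from the top downwards is a geometric series, and the remaining constant
  \<open>V X\<close> is absorbed because \<open>x * ell x\<close> is unbounded.\<close>

lemma V_over_x_ell: "((\<lambda>x. V x / (x * ell x)) \<longlongrightarrow> 0) at_top"
  unfolding tendsto_iff
proof (intro allI impI)
  fix e' :: real assume e': "e' > 0"
  define e where "e = min (e' / 6) (1 / 2)"
  have e: "0 < e" "e \<le> 1/2" "6 * e \<le> e'" using e' by (auto simp: e_def)
  have "eventually (\<lambda>x. dist (ell (1/2 * x) / ell x) 1 < e) at_top"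
    using slowly_varying_lim[OF ell_slowly_varying, of "1/2"] e by (auto simp: tendsto_iff)
  then obtain X0 where X0: "\<And>x. x \<ge> X0 \<Longrightarrow> dist (ell (1/2 * x) / ell x) 1 < e"
    by (auto simp: eventually_at_top_linorder)
  define X where "X = max X0 1"
  have ratio: "ell (x / 2) \<le> (1 + e) * ell x" if "x \<ge> X" for x
    using X0[of x] that ell_pos[of x] by (auto simp: X_def dist_real_def field_simps abs_less_iff)
  have bound: "0 \<le> x \<Longrightarrow> x \<le> 2 ^ i * X \<Longrightarrow> V x \<le> V X + 4 * e * (x * ell x)" for x and i :: nat
  proof (induction i arbitrary: x)
    case 0
    then have "V x \<le> V X" by (intro V_mono) auto
    moreover have "0 \<le> 4 * e * (x * ell x)" using 0 e less_imp_le[OF ell_pos] by (intro mult_nonneg_nonneg) auto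
    ultimately show ?case by linarith
  next
    case (Suc i)
    show ?case
    proof (cases "x \<le> X")
      case True
      then have "V x \<le> V X" by (intro V_mono) auto
      moreover have "0 \<le> 4 * e * (x * ell x)" using Suc e less_imp_le[OF ell_pos] by (intro mult_nonneg_nonneg) auto
      ultimately show ?thesis by linarith
    next
      case False
      have r: "ell (x / 2) \<le> (1 + e) * ell x" using ratio False by simp
      have "V x \<le> V (x / 2) + x * (ell (x / 2) - ell x)" using Suc by (intro V_halving)
      also have "V (x / 2) \<le> V X + 4 * e * (x / 2 * ell (x / 2))" using Suc by (intro Suc.IH) auto
      also have "4 * e * (x / 2 * ell (x / 2)) \<le> 4 * e * (x / 2 * ((1 + e) * ell x))"
        using Suc e r by (intro mult_left_mono) auto
      also have "x * (ell (x / 2) - ell x) \<le> x * (e * ell x)"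
        using Suc r by (intro mult_left_mono) (auto simp: algebra_simps)
      \<comment> \<open>The induction hypothesis at \<open>x / 2\<close> supplies
        \<open>2 * (1 + e)\<close> and the new block supplies 1. The sum is at most 4 as
        \<open>e \<le> 1/2\<close>, so the constant reproduces itself.\<close>
      finally have "V x \<le> V X + (2 * (1 + e) + 1) * (e * (x * ell x))"
        by (simp add: algebra_simps)
      also have "(2 * (1 + e) + 1) * (e * (x * ell x)) \<le> 4 * (e * (x * ell x))"
        using e Suc less_imp_le[OF ell_pos] by (intro mult_right_mono mult_nonneg_nonneg) auto
      finally show ?thesis by (simp add: mult.assoc)
    qed
  qed
  have "((\<lambda>x. V X / (x * ell x)) \<longlongrightarrow> 0) at_top"
    by (rule tendsto_divide_0[OF tendsto_const filterlim_at_top_imp_at_infinity[OF x_ell_at_top]])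
  then have "eventually (\<lambda>x. V X / (x * ell x) < e) at_top"
    using e by (intro order_tendstoD(2)) auto
  then show "eventually (\<lambda>x. dist (V x / (x * ell x)) 0 < e') at_top"
    using eventually_gt_at_top[of 0]
  proof eventually_elim
    case (elim x)
    obtain i where "x / X < 2 ^ i" using real_arch_pow[of 2 "x / X"] by auto
    then have "x \<le> 2 ^ i * X" by (simp add: X_def field_simps)
    then have "V x \<le> V X + 4 * e * (x * ell x)" using bound elim by auto
    moreover have xp: "0 < x * ell x" using elim ell_pos by simp
    ultimately have "V x / (x * ell x) \<le> V X / (x * ell x) + 4 * e"
      using elim ell_pos[of x] by (simp add: field_simps)
    then have "V x / (x * ell x) < e'" using elim e by linarith
    moreover have "0 \<le> V x / (x * ell x)" using V_nonneg[of x] xp by (intro divide_nonneg_nonneg) auto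
    ultimately show ?case by (simp add: dist_real_def)
  qed
qed

lemma tail_diff_le: "0 < x \<Longrightarrow> x \<le> y \<Longrightarrow> x * (tail x - tail y) \<le> ell x - ell y"
proof -
  assume x: "0 < x" "x \<le> y"
  have "x * p k \<le> real k * p k" if "k \<in> {nat \<lfloor>x\<rfloor><..nat \<lfloor>y\<rfloor>}" for k
    using that mem_nat_floor_interval[of x y k] x p_nonneg by (intro mult_right_mono) auto
  then show ?thesis
    unfolding ell_diff[OF x(2)] tail_diff[OF x(2)] sum_distrib_left by (rule sum_mono)
qed

lemma tail_le: "0 < x \<Longrightarrow> x * tail x \<le> ell x"
proof -
  assume x: "0 < x"
  have "((\<lambda>y. x * (tail x - tail y)) \<longlongrightarrow> x * (tail x - 0)) at_top"
    by (intro tendsto_intros tail_tendsto_0)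
  moreover have "((\<lambda>y. ell x - ell y) \<longlongrightarrow> ell x - 0) at_top"
    by (intro tendsto_intros ell_tendsto_0)
  moreover have "eventually (\<lambda>y. x * (tail x - tail y) \<le> ell x - ell y) at_top"
    using eventually_ge_at_top[of x] by eventually_elim (rule tail_diff_le[OF x])
  ultimately have "x * (tail x - 0) \<le> ell x - 0"
    by (intro tendsto_le[OF trivial_limit_at_top_linorder])
  then show ?thesis by simp
qed

lemma tail_nonneg: "0 \<le> tail x"
proof (rule tendsto_upperbound[OF tail_tendsto_0])
  show "eventually (\<lambda>z. tail z \<le> tail x) at_top"
    using eventually_ge_at_top[of x]
  proof eventually_elim
    case (elim y)
    have "0 \<le> (\<Sum>k\<in>{nat \<lfloor>x\<rfloor><..nat \<lfloor>y\<rfloor>}. p k)" by (intro sum_nonneg p_nonneg)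
    then show ?case using tail_diff[OF elim] by simp
  qed
qed simp

text \<open>Split at \<open>A * x\<close>. Between \<open>x\<close> and \<open>A * x\<close> the
  contribution is at most \<open>ell x - ell (A * x)\<close>, small by slow variation; beyond,
  Markov's inequality with the larger threshold gains the factor \<open>1 / A\<close>.\<close>

lemma x_tail_over_ell: "((\<lambda>x. x * tail x / ell x) \<longlongrightarrow> 0) at_top"
  unfolding tendsto_iff
proof (intro allI impI)
  fix e :: real assume e: "e > 0"
  define A where "A = 1 + 2 / e"
  have A: "A > 1" "1 / A < e / 2" using e by (auto simp: A_def field_simps)
  have "eventually (\<lambda>x. dist (ell (A * x) / ell x) 1 < e / 2) at_top"
    using A e by (intro tendstoD slowly_varying_lim[OF ell_slowly_varying]) auto
  then show "eventually (\<lambda>x. dist (x * tail x / ell x) 0 < e) at_top"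
    using eventually_gt_at_top[of 0]
  proof eventually_elim
    case (elim x)
    have x: "x \<le> A * x" using elim A by simp
    have "A * (x * tail (A * x)) \<le> ell (A * x)" using tail_le[of "A * x"] elim A by (simp add: mult.assoc)
    also have "\<dots> \<le> ell x" by (rule ell_antimono[OF x])
    finally have "x * tail (A * x) \<le> 1 / A * ell x" using A by (simp add: field_simps)
    then have "x * tail x \<le> ell x - ell (A * x) + 1 / A * ell x"
      using tail_diff_le[OF elim(2) x] by (simp add: algebra_simps)
    moreover have "ell x - ell (A * x) < e / 2 * ell x"
      using elim(1) ell_pos[of x] ell_antimono[OF x] by (simp add: dist_real_def field_simps abs_if split: if_splits)
    moreover have "1 / A * ell x < e / 2 * ell x" using A ell_pos[of x] by (intro mult_strict_right_mono) auto
    ultimately have "x * tail x < e * ell x" by linarith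
    then show ?case using ell_pos[of x] tail_nonneg[of x] elim by (simp add: dist_real_def abs_mult field_simps)
  qed
qed

text \<open>
  Up to asymptotic equivalence, \<open>b x\<close> is the solution \<open>y\<close> of \<open>y = x * ell y\<close>; since \<open>ell\<close> jumps, there need
  not be an exact one.
\<close>

definition b :: "real \<Rightarrow> real" where
  "b x = Sup {y. 0 \<le> y \<and> y \<le> x * ell y}"

lemma b_set_bdd: "0 \<le> x \<Longrightarrow> bdd_above {y. 0 \<le> y \<and> y \<le> x * ell y}"
proof (rule bdd_aboveI)
  fix y assume "0 \<le> x" "y \<in> {y. 0 \<le> y \<and> y \<le> x * ell y}"
  then have "y \<le> x * ell y" "x * ell y \<le> x" using mult_left_mono[OF ell_le_1, of x y] by auto
  then show "y \<le> x" by simp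
qed

lemma b_set_0: "0 \<le> x \<Longrightarrow> 0 \<in> {y. 0 \<le> y \<and> y \<le> x * ell y}"
  using ell_pos[of 0] by simp

lemma b_ge: "0 \<le> x \<Longrightarrow> 0 \<le> y \<Longrightarrow> y \<le> x * ell y \<Longrightarrow> y \<le> b x"
  unfolding b_def by (rule cSup_upper) (auto intro: b_set_bdd)

lemma b_nonneg: "0 \<le> x \<Longrightarrow> 0 \<le> b x"
  by (rule b_ge) (use ell_pos[of 0] in auto)

lemma b_le: "0 \<le> x \<Longrightarrow> b x \<le> x"
  unfolding b_def
proof (rule cSup_least)
  fix y assume "0 \<le> x" "y \<in> {y. 0 \<le> y \<and> y \<le> x * ell y}"
  then have "y \<le> x * ell y" "x * ell y \<le> x" using mult_left_mono[OF ell_le_1, of x y] by auto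
  then show "y \<le> x" by simp
qed (use b_set_0 in blast)

text \<open>As \<open>ell\<close> decreases, the set defining \<open>b x\<close> is an interval
  starting at 0. This lemma and \<open>b_greater\<close> replace the equation
  \<open>y = x * ell y\<close> by inequalities on either side of \<open>b x\<close>.\<close>

lemma b_less: "0 \<le> x \<Longrightarrow> 0 \<le> y \<Longrightarrow> y < b x \<Longrightarrow> y \<le> x * ell y"
proof -
  assume x: "0 \<le> x" "0 \<le> y" "y < b x"
  then obtain z where z: "0 \<le> z" "z \<le> x * ell z" "y < z"
    unfolding b_def using less_cSup_iff[OF _ b_set_bdd[OF x(1)]] b_set_0[OF x(1)] by blast
  then have "x * ell z \<le> x * ell y" using x by (intro mult_left_mono ell_antimono) auto
  then show ?thesis using z by linarith
qed

lemma b_greater: "0 \<le> x \<Longrightarrow> b x < y \<Longrightarrow> x * ell y < y"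
  using b_ge[of x y] b_nonneg[of x] by force

lemma b_mono: "0 \<le> x \<Longrightarrow> x \<le> x' \<Longrightarrow> b x \<le> b x'"
  unfolding b_def
proof (rule cSup_mono)
  assume x: "0 \<le> x" "x \<le> x'"
  show "\<exists>y'\<in>{y. 0 \<le> y \<and> y \<le> x' * ell y}. y \<le> y'" if "y \<in> {y. 0 \<le> y \<and> y \<le> x * ell y}" for y
  proof (rule bexI[of _ y])
    have "x * ell y \<le> x' * ell y" using x less_imp_le[OF ell_pos] by (intro mult_right_mono)
    then show "y \<in> {y. 0 \<le> y \<and> y \<le> x' * ell y}" using that by auto
  qed simp
qed (use b_set_0 b_set_bdd[of x'] in \<open>blast, auto\<close>)

lemma b_double: "0 \<le> x \<Longrightarrow> b (2 * x) \<le> 2 * b x"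
proof -
  assume x: "0 \<le> x"
  have "y \<le> 2 * b x" if "y \<in> {y. 0 \<le> y \<and> y \<le> 2 * x * ell y}" for y
  proof -
    have y: "0 \<le> y" "y \<le> 2 * x * ell y" using that by auto
    have "x * ell y \<le> x * ell (y / 2)" using x y by (intro mult_left_mono ell_antimono) auto
    then have "y / 2 \<le> b x" using x y by (intro b_ge) auto
    then show ?thesis by simp
  qed
  then show ?thesis unfolding b_def[of "2 * x"] using b_set_0[of "2 * x"] x by (intro cSup_least) auto
qed

lemma b_at_top: "filterlim b at_top at_top"
  unfolding filterlim_at_top_ge[where c = 0]
proof (intro allI impI)
  fix Z :: real assume Z: "0 \<le> Z"
  show "eventually (\<lambda>x. Z \<le> b x) at_top"
    using eventually_ge_at_top[of "Z / ell Z"] eventually_ge_at_top[of 0]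
  proof eventually_elim
    case (elim x)
    then show ?case using Z ell_pos[of Z] by (intro b_ge) (auto simp: field_simps)
  qed
qed

text \<open>The inequalities are applied at \<open>(1 - d) * b x\<close> and
  \<open>(1 + d) * b x\<close>, where they are certain, and slow variation transfers them to
  \<open>b x\<close>; the accumulated relative error stays below \<open>3 * d\<close>.\<close>

lemma b_asymp: "((\<lambda>x. x * ell (b x) / b x) \<longlongrightarrow> 1) at_top"
  unfolding tendsto_iff
proof (intro allI impI)
  fix e' :: real assume e': "e' > 0"
  define d where "d = min (e' / 3) (1 / 3)"
  have d: "0 < d" "d \<le> 1/3" "3 * d \<le> e'" using e' by (auto simp: d_def)
  have lim: "((\<lambda>x. ell (a * b x) / ell (b x)) \<longlongrightarrow> 1) at_top" if "a > 0" for a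
    by (rule filterlim_compose[OF slowly_varying_lim[OF ell_slowly_varying that] b_at_top])
  have 1: "eventually (\<lambda>x. dist (ell ((1 - d) * b x) / ell (b x)) 1 < d) at_top"
    and 2: "eventually (\<lambda>x. dist (ell ((1 + d) * b x) / ell (b x)) 1 < d) at_top"
    using lim[of "1 - d"] lim[of "1 + d"] d by (auto simp: tendsto_iff)
  have "eventually (\<lambda>x. 0 < b x) at_top"
    by (rule eventually_compose_filterlim[OF eventually_gt_at_top b_at_top])
  with 1 2 show "eventually (\<lambda>x. dist (x * ell (b x) / b x) 1 < e') at_top"
    using eventually_gt_at_top[of 0]
  proof eventually_elim
    case (elim x)
    note lp = ell_pos[of "b x"]
    have "(1 - d) * b x \<le> x * ell ((1 - d) * b x)" using elim d by (intro b_less) auto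
    also have "\<dots> \<le> x * ((1 + d) * ell (b x))"
      using elim(1,4) lp by (intro mult_left_mono) (auto simp: dist_real_def field_simps abs_less_iff)
    finally have l: "1 - d \<le> (1 + d) * (x * ell (b x) / b x)" using elim by (simp add: field_simps)
    have "x * ((1 - d) * ell (b x)) \<le> x * ell ((1 + d) * b x)"
      using elim(2,4) lp by (intro mult_left_mono) (auto simp: dist_real_def field_simps abs_less_iff)
    also have "\<dots> < (1 + d) * b x" using elim d by (intro b_greater) auto
    finally have u: "(1 - d) * (x * ell (b x) / b x) < 1 + d" using elim by (simp add: field_simps)
    define r where "r = x * ell (b x) / b x"
    have "(1 + d) * (1 - 3 * d) < (1 + d) * r"
    proof -
      have "0 < d * d" using d by simp
      then have "(1 + d) * (1 - 3 * d) < 1 - d" using d(1) by (simp add: algebra_simps add_pos_pos)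
      then show ?thesis using l by (simp add: r_def)
    qed
    then have "1 - 3 * d < r" using d by simp
    moreover have "r < 1 + 3 * d"
    proof -
      have "1 + d \<le> (1 - d) * (1 + 3 * d)"
      proof -
        have "0 \<le> d * (1 - 3 * d)" using d by (intro mult_nonneg_nonneg) auto
        then show ?thesis by (simp add: algebra_simps)
      qed
      then have "(1 - d) * r < (1 - d) * (1 + 3 * d)" using u by (simp add: r_def)
      then show ?thesis using d by simp
    qed
    ultimately show ?case using d by (simp add: r_def dist_real_def abs_less_iff)
  qed
qed

section \<open>The normalising function\<close>

text \<open>\<open>b\<close> is controlled for nonnegative arguments only; clipping at 0 makes
  \<open>Lam\<close> monotone on the whole line, as the doubling criterion for monotone functions
  requires.\<close>

definition Lam :: "real \<Rightarrow> real" where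
  "Lam x = 1 / ell (b (max x 0))"

lemma Lam_pos: "Lam x > 0"
  using ell_pos by (simp add: Lam_def)

lemma Lam_slowly_varying: "slowly_varying Lam"
proof -
  have "slowly_varying (\<lambda>x. ell (b (max x 0)))"
  proof (rule slowly_varying_antimonoI)
    show "antimono (\<lambda>x. ell (b (max x 0)))"
      by (auto simp: antimono_def intro!: ell_antimono b_mono)
    show "((\<lambda>x. ell (b (max (2 * x) 0)) / ell (b (max x 0))) \<longlongrightarrow> 1) at_top"
    proof (rule tendsto_sandwich[OF _ _ _ tendsto_const])
      show "((\<lambda>x. ell (2 * b x) / ell (b x)) \<longlongrightarrow> 1) at_top"
        by (rule filterlim_compose[OF slowly_varying_lim[OF ell_slowly_varying] b_at_top]) simp
      show "eventually (\<lambda>x. ell (2 * b x) / ell (b x) \<le> ell (b (max (2 * x) 0)) / ell (b (max x 0))) at_top"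
        using eventually_ge_at_top[of 0]
      proof eventually_elim
        case (elim x)
        then show ?case using b_double[of x] less_imp_le[OF ell_pos] by (simp add: max_absorb1 divide_right_mono ell_antimono)
      qed
      show "eventually (\<lambda>x. ell (b (max (2 * x) 0)) / ell (b (max x 0)) \<le> 1) at_top"
        using eventually_ge_at_top[of 0]
      proof eventually_elim
        case (elim x)
        then show ?case using b_mono[of x "2 * x"] ell_pos by (simp add: max_absorb1 ell_antimono)
      qed
    qed
  qed (rule ell_pos)
  note S = this
  obtain X where X: "set_borel_measurable borel {X..} (\<lambda>x. ell (b (max x 0)))"
    using S by (auto simp: slowly_varying_def)
  have "set_borel_measurable borel {X..} Lam"
  proof -
    have "(\<lambda>x. indicator {X..} x *\<^sub>R Lam x) =
       (\<lambda>x. indicator {X..} x * inverse (indicator {X..} x *\<^sub>R ell (b (max x 0))))"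
      by (auto simp: Lam_def fun_eq_iff indicator_def divide_inverse)
    then show ?thesis using X unfolding set_borel_measurable_def
      by (simp only:) (intro borel_measurable_times borel_measurable_inverse, auto)
  qed
  moreover have "((\<lambda>x. Lam (a * x) / Lam x) \<longlongrightarrow> 1) at_top" if "a > 0" for a
  proof -
    have "((\<lambda>x. inverse (ell (b (max (a * x) 0)) / ell (b (max x 0)))) \<longlongrightarrow> inverse 1) at_top"
      by (intro tendsto_inverse slowly_varying_lim[OF S that]) simp
    then show ?thesis by (simp add: Lam_def)
  qed
  ultimately show ?thesis unfolding slowly_varying_def using Lam_pos by blast
qed

lemma Lam_at_top: "filterlim Lam at_top at_top"
proof -
  have "((\<lambda>x. ell (b x)) \<longlongrightarrow> 0) at_top" by (rule filterlim_compose[OF ell_tendsto_0 b_at_top])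
  then have "filterlim (\<lambda>x. inverse (ell (b x))) at_top at_top"
    using ell_pos by (intro filterlim_inverse_at_top) auto
  moreover have "eventually (\<lambda>x. inverse (ell (b x)) = Lam x) at_top"
    using eventually_ge_at_top[of 0] by eventually_elim (simp add: Lam_def max_absorb1 divide_inverse)
  ultimately show ?thesis using filterlim_cong by fast
qed

end

section \<open>Concentration\<close>

text \<open>Markov's inequality for the measure with masses \<open>coeff F i\<close>. The sign of
  \<open>l\<close> is free, so upper and lower tails are both covered.\<close>

lemma coeff_sum_chernoff:
  fixes F :: "real poly"
  assumes nn: "\<And>i. 0 \<le> coeff F i" and I: "finite I" "\<And>i. i \<in> I \<Longrightarrow> c \<le> l * real i"
  shows "(\<Sum>i\<in>I. coeff F i) \<le> exp (- c) * poly F (exp l)"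
proof -
  have "(\<Sum>i\<in>I. coeff F i) \<le> (\<Sum>i\<in>I. coeff F i * (exp (- c) * exp l ^ i))"
  proof (intro sum_mono)
    fix i assume "i \<in> I"
    then have "0 \<le> l * real i - c" using I by simp
    then have "1 \<le> exp (l * real i - c)" by simp
    also have "\<dots> = exp (- c) * exp l ^ i" by (simp add: exp_diff exp_minus exp_of_nat_mult[symmetric] field_simps)
    finally have "coeff F i * 1 \<le> coeff F i * (exp (- c) * exp l ^ i)" using nn by (intro mult_left_mono)
    then show "coeff F i \<le> coeff F i * (exp (- c) * exp l ^ i)" by simp
  qed
  also have "\<dots> \<le> (\<Sum>i\<in>I \<union> {..degree F}. coeff F i * (exp (- c) * exp l ^ i))"
    using I nn by (intro sum_mono2) auto
  also have "\<dots> = (\<Sum>i\<le>degree F. coeff F i * (exp (- c) * exp l ^ i))"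
    using I by (intro sum.mono_neutral_right) (auto simp: coeff_eq_0)
  also have "\<dots> = exp (- c) * poly F (exp l)"
    by (simp add: poly_altdef sum_distrib_left mult_ac)
  finally show ?thesis .
qed

lemma exp_le_quadratic:
  fixes u s :: real assumes "0 \<le> u" "u \<le> s" shows "exp u \<le> 1 + u + u\<^sup>2 * exp s"
proof -
  obtain t where t: "\<bar>t\<bar> \<le> \<bar>u\<bar>" "exp u = (\<Sum>m<2. u ^ m / fact m) + exp t / fact 2 * u ^ 2"
    using Maclaurin_exp_le[of u 2] by blast
  have "exp t \<le> exp s" using t(1) assms by simp
  then have "exp t / 2 \<le> exp s" using exp_gt_zero[of t] by linarith
  then have "exp t / 2 * u\<^sup>2 \<le> exp s * u\<^sup>2" by (intro mult_right_mono) auto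
  then show ?thesis using t(2) by (simp add: numeral_2_eq_2 mult.commute)
qed

lemma exp_le_linear:
  fixes u s :: real assumes "0 \<le> u" "u \<le> s" shows "exp u \<le> 1 + u * exp s"
proof -
  obtain t where t: "\<bar>t\<bar> \<le> \<bar>u\<bar>" "exp u = (\<Sum>m<1. u ^ m / fact m) + exp t / fact 1 * u ^ 1"
    using Maclaurin_exp_le[of u 1] by blast
  have "exp t * u \<le> exp s * u" using t(1) assms by (intro mult_right_mono) auto
  then show ?thesis using t(2) by (simp add: mult.commute)
qed

lemma exp_uminus_le_quadratic:
  fixes u :: real assumes "0 \<le> u" shows "exp (- u) \<le> 1 - u + u\<^sup>2"
proof -
  have "exp (- u) * (1 + u) \<le> exp (- u) * exp u" by (intro mult_left_mono exp_ge_add_one_self) auto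
  also have "\<dots> = 1" by (simp add: exp_minus)
  also have "1 \<le> 1 + u * u\<^sup>2" using assms by simp
  also have "\<dots> = (1 - u + u\<^sup>2) * (1 + u)" by (simp add: algebra_simps power2_eq_square)
  finally show ?thesis using assms by (simp add: mult_le_cancel_right)
qed

context cauchy_offspring
begin

lemma ell_floor: "ell (real (nat \<lfloor>x\<rfloor>)) = ell x" and V_floor: "V (real (nat \<lfloor>x\<rfloor>)) = V x"
  and tail_floor: "tail (real (nat \<lfloor>x\<rfloor>)) = tail x"
  by (simp_all add: ell_def V_def tail_def)

abbreviation P :: "nat \<Rightarrow> real poly" where "P K \<equiv> trunc_poly p K"

lemma poly_P: "poly (P K) z = (\<Sum>k\<le>K. p k * z ^ k)"
  by (simp add: trunc_poly_def poly_sum poly_monom)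

lemma poly_pderiv_P: "poly (pderiv (P K)) z = (\<Sum>k\<in>{1..K}. real k * p k * z ^ (k - 1))"
  by (simp add: pderiv_trunc_poly poly_sum poly_monom)

lemma sum_from_1: "f 0 = 0 \<Longrightarrow> (\<Sum>k\<in>{1..K}. f k) = (\<Sum>k\<le>K. f k)" for f :: "nat \<Rightarrow> real"
  by (rule sum.mono_neutral_left) (auto simp: not_le)

lemma poly_P_1: "poly (P K) 1 = 1 - tail (real K)"
  by (simp add: poly_P tail_def)

lemma poly_pderiv_P_1: "poly (pderiv (P K)) 1 = 1 - ell (real K)"
  using sum_from_1[of "\<lambda>k. real k * p k" K] by (simp add: poly_pderiv_P ell_def)

lemma sum_p_le_1: "(\<Sum>k\<le>K. p k) \<le> 1"
  using tail_nonneg[of "real K"] by (simp add: tail_def)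

text \<open>Truncation keeps \<open>l * k\<close> below \<open>s\<close>, so the Taylor remainder of
  the exponential is controlled by the truncated second moment; the linear term is the truncated
  mean \<open>1 - ell K\<close>.\<close>

lemma poly_P_exp_le:
  assumes "0 \<le> l" "l * real K \<le> s"
  shows "poly (P K) (exp l) \<le> exp (l * (1 - ell (real K)) + l\<^sup>2 * exp s * V (real K))"
proof -
  have "poly (P K) (exp l) \<le> (\<Sum>k\<le>K. p k * (1 + l * real k + (l * real k)\<^sup>2 * exp s))"
    unfolding poly_P
  proof (intro sum_mono mult_left_mono p_nonneg)
    fix k assume "k \<in> {..K}"
    then have "l * real k \<le> l * real K" using assms by (intro mult_left_mono) auto
    then have "exp (l * real k) \<le> 1 + l * real k + (l * real k)\<^sup>2 * exp s"
      using assms by (intro exp_le_quadratic) auto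
    then show "exp l ^ k \<le> 1 + l * real k + (l * real k)\<^sup>2 * exp s"
      by (simp add: exp_of_nat_mult[symmetric] mult.commute)
  qed
  also have "\<dots> = (\<Sum>k\<le>K. p k) + l * (\<Sum>k\<le>K. real k * p k) + l\<^sup>2 * exp s * (\<Sum>k\<le>K. (real k)\<^sup>2 * p k)"
    by (simp add: sum_distrib_left sum.distrib[symmetric] algebra_simps power_mult_distrib)
  also have "\<dots> \<le> 1 + (l * (1 - ell (real K)) + l\<^sup>2 * exp s * V (real K))"
    using sum_p_le_1[of K] by (simp add: ell_def V_def)
  also have "\<dots> \<le> exp (l * (1 - ell (real K)) + l\<^sup>2 * exp s * V (real K))"
    by (rule exp_ge_add_one_self)
  finally show ?thesis .
qed

text \<open>The derivative is the generating function of the siblings of a spine child, that is, of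
  the size-biased law minus 1. A first order bound is enough since only about \<open>Lam n\<close>
  such factors occur.\<close>

lemma poly_pderiv_P_exp_le:
  assumes "0 \<le> l" "l * real K \<le> s"
  shows "poly (pderiv (P K)) (exp l) \<le> exp (l * exp s * V (real K))"
proof -
  have "poly (pderiv (P K)) (exp l) \<le> (\<Sum>k\<in>{1..K}. real k * p k * (1 + l * real k * exp s))"
    unfolding poly_pderiv_P
  proof (intro sum_mono mult_left_mono mult_nonneg_nonneg p_nonneg)
    fix k assume k: "k \<in> {1..K}"
    then have "l * real k \<le> l * real K" using assms by (intro mult_left_mono) auto
    then have "exp (l * real k) \<le> 1 + l * real k * exp s"
      using assms by (intro exp_le_linear) auto
    moreover have "exp l ^ (k - 1) \<le> exp l ^ k" using assms by (intro power_increasing) auto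
    moreover have "exp l ^ k = exp (l * real k)" by (simp add: exp_of_nat_mult[symmetric] mult.commute)
    ultimately show "exp l ^ (k - 1) \<le> 1 + l * real k * exp s" by linarith
  qed auto
  also have "\<dots> = (\<Sum>k\<le>K. real k * p k * (1 + l * real k * exp s))"
    by (rule sum_from_1) simp
  also have "\<dots> = (\<Sum>k\<le>K. real k * p k) + l * exp s * (\<Sum>k\<le>K. (real k)\<^sup>2 * p k)"
    by (simp add: sum_distrib_left sum.distrib[symmetric] algebra_simps power2_eq_square)
  also have "\<dots> \<le> 1 + l * exp s * V (real K)"
    using less_imp_le[OF ell_pos[of "real K"]] by (simp add: ell_def V_def)
  also have "\<dots> \<le> exp (l * exp s * V (real K))" by (rule exp_ge_add_one_self)
  finally show ?thesis .
qed

lemma poly_P_exp_uminus_le: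
  assumes "0 \<le> l"
  shows "poly (P K) (exp (- l)) \<le> exp (- l * (1 - ell (real K)) + l\<^sup>2 * V (real K))"
proof -
  have "poly (P K) (exp (- l)) \<le> (\<Sum>k\<le>K. p k * (1 - l * real k + (l * real k)\<^sup>2))"
    unfolding poly_P
  proof (intro sum_mono mult_left_mono p_nonneg)
    fix k
    have "exp (- (l * real k)) \<le> 1 - l * real k + (l * real k)\<^sup>2"
      using assms by (intro exp_uminus_le_quadratic) auto
    then show "exp (- l) ^ k \<le> 1 - l * real k + (l * real k)\<^sup>2"
      by (simp add: exp_of_nat_mult[symmetric] mult.commute)
  qed
  also have "\<dots> = (\<Sum>k\<le>K. p k) - l * (\<Sum>k\<le>K. real k * p k) + l\<^sup>2 * (\<Sum>k\<le>K. (real k)\<^sup>2 * p k)"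
    by (simp add: sum_distrib_left sum.distrib[symmetric] sum_subtractf[symmetric] algebra_simps power_mult_distrib)
  also have "\<dots> \<le> 1 + (- l * (1 - ell (real K)) + l\<^sup>2 * V (real K))"
    using sum_p_le_1[of K] by (simp add: ell_def V_def)
  also have "\<dots> \<le> exp (- l * (1 - ell (real K)) + l\<^sup>2 * V (real K))"
    by (rule exp_ge_add_one_self)
  finally show ?thesis .
qed

lemma poly_pderiv_P_exp_uminus_le: "0 \<le> l \<Longrightarrow> poly (pderiv (P K)) (exp (- l)) \<le> 1"
proof -
  assume l: "0 \<le> l"
  have "poly (pderiv (P K)) (exp (- l)) \<le> (\<Sum>k\<in>{1..K}. real k * p k * 1)"
    unfolding poly_pderiv_P using l p_nonneg by (intro sum_mono mult_left_mono power_le_one) auto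
  also have "\<dots> = (\<Sum>k\<le>K. real k * p k * 1)" by (rule sum_from_1) simp
  also have "\<dots> \<le> 1" using less_imp_le[OF ell_pos[of "real K"]] by (simp add: ell_def)
  finally show ?thesis .
qed

lemma poly_P_nonneg: "0 \<le> z \<Longrightarrow> 0 \<le> poly (P K) z" "0 \<le> z \<Longrightarrow> 0 \<le> poly (pderiv (P K)) z"
  by (auto simp: poly_P poly_pderiv_P intro!: sum_nonneg mult_nonneg_nonneg p_nonneg)

lemma coeff_P_power_nonneg: "0 \<le> coeff (pderiv (P K) ^ h * P K ^ m) i"
proof -
  have "nonneg_fps (fps_of_poly (pderiv (P K)) ^ h * fps_of_poly (P K) ^ m)"
    by (intro nonneg_fps_mult nonneg_fps_power nonneg_fps_trunc_poly p_nonneg)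
  then show ?thesis
    by (simp add: nonneg_fps_def fps_of_poly_mult[symmetric] fps_of_poly_power[symmetric] del: fps_of_poly_pderiv)
qed

text \<open>The coefficients of \<open>F\<close> have total mass \<open>poly F 1\<close>, a product
  of the masses left by truncation. Subtracting the Chernoff bounds for the indices
  \<open>m - k\<close> with \<open>k\<close> too small or too large leaves the window;
  \<open>B\<close> stands for \<open>bn n\<close>.\<close>

lemma window_bound:
  fixes h :: nat
  assumes "0 \<le> l" "l * real K \<le> s" and e: "0 < e" "e < 1" and B: "0 < B" "(1 + e) * B \<le> real m"
  defines "F \<equiv> pderiv (P K) ^ h * P K ^ m"
  shows "(1 - ell (real K)) ^ h * (1 - tail (real K)) ^ m
     - exp (l * ((1 - e) * B - real m * ell (real K)) + real h * (l * exp s * V (real K))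
           + real m * (l\<^sup>2 * exp s * V (real K)))
     - exp (l * (real m * ell (real K) - (1 + e) * B) + real m * (l\<^sup>2 * V (real K)))
     \<le> (\<Sum>k | (1 - e) * B \<le> real k \<and> real k \<le> (1 + e) * B. coeff F (m - k))"
proof -
  define W where "W = {k. (1 - e) * B \<le> real k \<and> real k \<le> (1 + e) * B}"
  \<comment> \<open>With \<open>i = m - k\<close>, \<open>Up\<close> collects the degrees
    \<open>k\<close> below the window and \<open>Low\<close> those above it.\<close>
  define Up where "Up = {i. i \<le> degree F \<and> real m - (1 - e) * B \<le> real i}"
  define Low where "Low = {i. i \<le> degree F \<and> real i \<le> real m - (1 + e) * B}"
  have F: "0 \<le> coeff F i" for i unfolding F_def by (rule coeff_P_power_nonneg)
  have nn: "0 \<le> sum (coeff F) A" for A by (intro sum_nonneg F)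
  have Wm: "k \<le> m" if "k \<in> W" for k using that B(2) unfolding W_def by auto
  have fin: "finite W" by (rule finite_subset[of _ "{..m}"]) (use Wm in auto)
  have fin': "finite Up" "finite Low" by (auto simp: Up_def Low_def)
  have "{..degree F} \<subseteq> (\<lambda>k. m - k) ` W \<union> (Up \<union> Low)"
  proof
    fix i assume i: "i \<in> {..degree F}"
    show "i \<in> (\<lambda>k. m - k) ` W \<union> (Up \<union> Low)"
    proof (cases "i \<in> Up \<union> Low")
      case False
      then have *: "real i < real m - (1 - e) * B" "real m - (1 + e) * B < real i"
        using i by (auto simp: Up_def Low_def)
      moreover have "0 \<le> (1 - e) * B" using e B by auto
      ultimately have "i \<le> m" by linarith
      then have "m - i \<in> W" "i = m - (m - i)" using * by (auto simp: W_def of_nat_diff)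
      then show ?thesis by blast
    qed auto
  qed
  then have "(\<Sum>i\<le>degree F. coeff F i) \<le> (\<Sum>i\<in>(\<lambda>k. m - k) ` W \<union> (Up \<union> Low). coeff F i)"
    using fin fin' F by (intro sum_mono2) auto
  also have "\<dots> \<le> (\<Sum>i\<in>(\<lambda>k. m - k) ` W. coeff F i) + ((\<Sum>i\<in>Up. coeff F i) + (\<Sum>i\<in>Low. coeff F i))"
    using fin fin' nn[of "Up \<inter> Low"] nn[of "(\<lambda>k. m - k) ` W \<inter> (Up \<union> Low)"] by (simp add: sum_Un)
  also have "(\<Sum>i\<in>(\<lambda>k. m - k) ` W. coeff F i) = (\<Sum>k\<in>W. coeff F (m - k))"
    by (subst sum.reindex) (auto simp: inj_on_def dest!: Wm)
  also have "(\<Sum>i\<le>degree F. coeff F i) = poly F 1" by (simp add: poly_altdef)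
  also have "poly F 1 = (1 - ell (real K)) ^ h * (1 - tail (real K)) ^ m"
    by (simp add: F_def poly_P_1 poly_pderiv_P_1)
  finally have main: "(1 - ell (real K)) ^ h * (1 - tail (real K)) ^ m \<le>
    (\<Sum>k\<in>W. coeff F (m - k)) + ((\<Sum>i\<in>Up. coeff F i) + (\<Sum>i\<in>Low. coeff F i))" .
  have "(\<Sum>i\<in>Up. coeff F i) \<le> exp (- (l * (real m - (1 - e) * B))) * poly F (exp l)"
    using F fin' assms(1) by (intro coeff_sum_chernoff) (auto simp: Up_def intro!: mult_left_mono)
  also have "\<dots> \<le> exp (- (l * (real m - (1 - e) * B))) * (exp (l * exp s * V (real K)) ^ h *
      exp (l * (1 - ell (real K)) + l\<^sup>2 * exp s * V (real K)) ^ m)"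
    unfolding F_def poly_mult poly_power using assms(1,2)
    by (intro mult_left_mono mult_mono power_mono poly_P_exp_le poly_pderiv_P_exp_le poly_P_nonneg zero_le_power) auto
  also have "\<dots> = exp (l * ((1 - e) * B - real m * ell (real K)) + real h * (l * exp s * V (real K))
           + real m * (l\<^sup>2 * exp s * V (real K)))"
    unfolding exp_of_nat_mult[symmetric] exp_add[symmetric] by (simp add: algebra_simps)
  finally have up: "(\<Sum>i\<in>Up. coeff F i) \<le> exp (l * ((1 - e) * B - real m * ell (real K))
    + real h * (l * exp s * V (real K)) + real m * (l\<^sup>2 * exp s * V (real K)))" .
  have "(\<Sum>i\<in>Low. coeff F i) \<le> exp (- (- l * (real m - (1 + e) * B))) * poly F (exp (- l))"
  proof (intro coeff_sum_chernoff F fin')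
    fix i assume "i \<in> Low"
    then have "l * real i \<le> l * (real m - (1 + e) * B)"
      using assms(1) by (intro mult_left_mono) (auto simp: Low_def)
    then show "- l * (real m - (1 + e) * B) \<le> - l * real i" by simp
  qed
  also have "\<dots> \<le> exp (- (- l * (real m - (1 + e) * B))) * (1 ^ h *
      exp (- l * (1 - ell (real K)) + l\<^sup>2 * V (real K)) ^ m)"
    unfolding F_def poly_mult poly_power using assms(1,2)
    by (intro mult_left_mono mult_mono power_mono poly_P_exp_uminus_le poly_pderiv_P_exp_uminus_le poly_P_nonneg zero_le_power) auto
  also have "\<dots> = exp (l * (real m * ell (real K) - (1 + e) * B) + real m * (l\<^sup>2 * V (real K)))"
    unfolding exp_of_nat_mult[symmetric] exp_add[symmetric] power_one mult_1 by (simp add: algebra_simps)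
  finally have low: "(\<Sum>i\<in>Low. coeff F i) \<le> exp (l * (real m * ell (real K) - (1 + e) * B) + real m * (l\<^sup>2 * V (real K)))" .
  show ?thesis using main up low unfolding W_def by linarith
qed

section \<open>Asymptotics at the level \<open>bn n\<close>\<close>

abbreviation bn :: "nat \<Rightarrow> real" where "bn n \<equiv> b (real n)"

lemma bn_at_top: "filterlim bn at_top sequentially"
  by (rule filterlim_compose[OF b_at_top filterlim_real_sequentially])

lemma dbn_at_top: "d > 0 \<Longrightarrow> filterlim (\<lambda>n. d * bn n) at_top sequentially"
  by (rule filterlim_tendsto_pos_mult_at_top[OF tendsto_const _ bn_at_top])

lemma bn_pos: "eventually (\<lambda>n. 0 < bn n) sequentially"
  by (rule eventually_compose_filterlim[OF eventually_gt_at_top bn_at_top])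

lemma lim_ell_d: "d > 0 \<Longrightarrow> (\<lambda>n. ell (d * bn n) / ell (bn n)) \<longlonglongrightarrow> 1"
  by (rule filterlim_compose[OF slowly_varying_lim[OF ell_slowly_varying] bn_at_top])

lemma lim_n_ell: "(\<lambda>n. real n * ell (bn n) / bn n) \<longlonglongrightarrow> 1"
  by (rule filterlim_compose[OF b_asymp filterlim_real_sequentially])

lemma lim_n_ell_d: "d > 0 \<Longrightarrow> (\<lambda>n. real n * ell (d * bn n) / bn n) \<longlonglongrightarrow> 1"
proof -
  assume d: "d > 0"
  have "(\<lambda>n. real n * ell (bn n) / bn n * (ell (d * bn n) / ell (bn n))) \<longlonglongrightarrow> 1 * 1"
    by (intro tendsto_mult lim_n_ell lim_ell_d d)
  moreover have "real n * ell (bn n) / bn n * (ell (d * bn n) / ell (bn n)) = real n * ell (d * bn n) / bn n" for n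
    using ell_pos[of "bn n"] by (simp add: field_simps)
  ultimately show ?thesis by simp
qed

text \<open>\<open>n\<close> steps truncated at \<open>d * bn n\<close> have variance of smaller
  order than \<open>(bn n)^2\<close>, hence their sum concentrates at scale
  \<open>bn n\<close>.\<close>

lemma lim_n_V_d: "d > 0 \<Longrightarrow> (\<lambda>n. real n * V (d * bn n) / (bn n)\<^sup>2) \<longlonglongrightarrow> 0"
proof -
  assume d: "d > 0"
  have "(\<lambda>n. V (d * bn n) / (d * bn n * ell (d * bn n)) * (d * (real n * ell (d * bn n) / bn n))) \<longlonglongrightarrow> 0 * (d * 1)"
    by (intro tendsto_mult tendsto_const lim_n_ell_d d filterlim_compose[OF V_over_x_ell dbn_at_top])
  moreover have "eventually (\<lambda>n. V (d * bn n) / (d * bn n * ell (d * bn n)) * (d * (real n * ell (d * bn n) / bn n))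
     = real n * V (d * bn n) / (bn n)\<^sup>2) sequentially"
    using bn_pos
  proof eventually_elim
    case (elim n)
    then show ?case using ell_pos[of "d * bn n"] d by (simp add: field_simps power2_eq_square)
  qed
  ultimately show ?thesis by (simp add: tendsto_cong)
qed

text \<open>Typically none of \<open>n\<close> steps exceeds \<open>d * bn n\<close>, so truncating
  there costs no mass in the limit.\<close>

lemma lim_n_tail_d: "d > 0 \<Longrightarrow> (\<lambda>n. real n * tail (d * bn n)) \<longlonglongrightarrow> 0"
proof -
  assume d: "d > 0"
  have "(\<lambda>n. d * bn n * tail (d * bn n) / ell (d * bn n) * (real n * ell (d * bn n) / bn n / d)) \<longlonglongrightarrow> 0 * (1 / d)"
    using d by (intro tendsto_mult tendsto_divide tendsto_const lim_n_ell_d d filterlim_compose[OF x_tail_over_ell dbn_at_top]) auto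
  moreover have "eventually (\<lambda>n. d * bn n * tail (d * bn n) / ell (d * bn n) * (real n * ell (d * bn n) / bn n / d)
     = real n * tail (d * bn n)) sequentially"
    using bn_pos
  proof eventually_elim
    case (elim n)
    then show ?case using ell_pos[of "d * bn n"] d by (simp add: field_simps)
  qed
  ultimately show ?thesis by (simp add: tendsto_cong)
qed

lemma lim_Lam_V_d: "d > 0 \<Longrightarrow> (\<lambda>n. Lam n * V (d * bn n) / bn n) \<longlonglongrightarrow> 0"
proof -
  assume d: "d > 0"
  have "(\<lambda>n. V (d * bn n) / (d * bn n * ell (d * bn n)) * (d * (ell (d * bn n) / ell (bn n)))) \<longlonglongrightarrow> 0 * (d * 1)"
    by (intro tendsto_mult tendsto_const lim_ell_d d filterlim_compose[OF V_over_x_ell dbn_at_top])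
  moreover have "eventually (\<lambda>n. V (d * bn n) / (d * bn n * ell (d * bn n)) * (d * (ell (d * bn n) / ell (bn n)))
     = Lam n * V (d * bn n) / bn n) sequentially"
    using bn_pos
  proof eventually_elim
    case (elim n)
    then show ?case using ell_pos[of "d * bn n"] ell_pos[of "bn n"] d by (simp add: Lam_def field_simps)
  qed
  ultimately show ?thesis by (simp add: tendsto_cong)
qed

lemma Lam_of_nat: "Lam (real n) = 1 / ell (bn n)"
  by (simp add: Lam_def)

lemma lim_inverse_bn: "(\<lambda>n. 1 / bn n) \<longlonglongrightarrow> 0"
  by (rule tendsto_divide_0[OF tendsto_const filterlim_at_top_imp_at_infinity[OF bn_at_top]])

lemma lim_bn_over_n_Lam: "(\<lambda>n. bn n / real n * Lam n) \<longlonglongrightarrow> 1"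
proof -
  have "(\<lambda>n. inverse (real n * ell (bn n) / bn n)) \<longlonglongrightarrow> inverse 1"
    by (intro tendsto_inverse lim_n_ell) simp
  moreover have "inverse (real n * ell (bn n) / bn n) = bn n / real n * Lam n" for n
    by (simp add: Lam_of_nat field_simps)
  ultimately show ?thesis by simp
qed

lemma lim_ell_bn: "(\<lambda>n. ell (bn n)) \<longlonglongrightarrow> 0"
  by (rule filterlim_compose[OF ell_tendsto_0 bn_at_top])

lemma lim_bn_over_n: "(\<lambda>n. bn n / real n) \<longlonglongrightarrow> 0"
proof -
  have "(\<lambda>n. bn n / real n * Lam n * ell (bn n)) \<longlonglongrightarrow> 1 * 0"
    by (intro tendsto_mult lim_bn_over_n_Lam lim_ell_bn)
  moreover have "bn n / real n * Lam n * ell (bn n) = bn n / real n" for n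
    using ell_pos[of "bn n"] by (simp add: Lam_of_nat)
  ultimately show ?thesis by (simp only: mult_zero_right)
qed

lemma lim_Lam_over_n: "(\<lambda>n. Lam n / real n) \<longlonglongrightarrow> 0"
proof -
  have "(\<lambda>n. bn n / real n * Lam n * (1 / bn n)) \<longlonglongrightarrow> 1 * 0"
    by (intro tendsto_mult lim_bn_over_n_Lam lim_inverse_bn)
  moreover have "eventually (\<lambda>n. bn n / real n * Lam n * (1 / bn n) = Lam n / real n) sequentially"
    using bn_pos by eventually_elim simp
  ultimately show ?thesis by (simp add: tendsto_cong)
qed

text \<open>With \<open>l = s / bn n\<close> the drift makes both Chernoff exponents tend to
  \<open>- s * e\<close>, since \<open>n * ell (d * bn n)\<close> is asymptotic to
  \<open>bn n\<close>; all variance terms vanish. The heights up to \<open>y * Lam n\<close> are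
  treated uniformly, as they change the number of remaining steps and the exponents only by
  negligible amounts.\<close>

lemma window_concentration:
  assumes d: "0 < d" "d \<le> 1" and e: "0 < e" "e < 1" and y: "0 \<le> y" and eta: "0 < eta"
  shows "eventually (\<lambda>n. \<forall>h. real h \<le> y * Lam n \<longrightarrow>
     h + 1 < n \<and> (1 + e) * bn n \<le> real (n - 1 - h) \<and>
     (1 - ell (d * bn n)) ^ h - eta \<le> (\<Sum>k | (1 - e) * bn n \<le> real k \<and> real k \<le> (1 + e) * bn n.
        coeff (pderiv (P (nat \<lfloor>d * bn n\<rfloor>)) ^ h * P (nat \<lfloor>d * bn n\<rfloor>) ^ (n - 1 - h)) (n - 1 - h - k))) sequentially"
proof -
  \<comment> \<open>Chosen so that \<open>s * e / 2 = 3 / eta\<close>; then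
    \<open>exp (- 3 / eta) \<le> eta / 3\<close>. The error \<open>eta\<close> is shared equally by
    the two Chernoff bounds and the loss from \<open>tail\<close>.\<close>
  define s where "s = 6 / (eta * e)"
  have s: "0 < s" using eta e by (simp add: s_def)
  have es: "exp (- (s * e / 2)) \<le> eta / 3"
  proof -
    have "3 / eta \<le> exp (3 / eta)" using exp_ge_add_one_self[of "3 / eta"] by linarith
    then show ?thesis using eta e by (simp add: s_def exp_minus field_simps)
  qed
  let ?x = "\<lambda>n. d * bn n"
  have "(\<lambda>n. (1 + e) * (bn n / real n) + y * (Lam n / real n) + 2 * (1 / real n)) \<longlonglongrightarrow> (1 + e) * 0 + y * 0 + 2 * 0"
    by (intro tendsto_intros lim_bn_over_n lim_Lam_over_n lim_inverse_n')
  then have ev1: "eventually (\<lambda>n. (1 + e) * (bn n / real n) + y * (Lam n / real n) + 2 * (1 / real n) < 1) sequentially"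
    by (intro order_tendstoD(2)) auto
  \<comment> \<open>The two summands with \<open>1 / bn n\<close> account for the difference between
    \<open>n\<close> and \<open>m = n - 1 - h\<close>: one from the marked vertex, one from the
    spine.\<close>
  have "(\<lambda>n. s * ((1 - e) - real n * ell (?x n) / bn n + (1 / bn n) * ell (?x n) + y * (ell (?x n) / ell (bn n)) * (1 / bn n))
        + s * exp s * y * (Lam n * V (?x n) / bn n) + s\<^sup>2 * exp s * (real n * V (?x n) / (bn n)\<^sup>2))
    \<longlonglongrightarrow> s * ((1 - e) - 1 + 0 * 0 + y * 1 * 0) + s * exp s * y * 0 + s\<^sup>2 * exp s * 0"
    using d by (intro tendsto_intros lim_n_ell_d lim_inverse_bn lim_ell_d lim_Lam_V_d lim_n_V_d
        filterlim_compose[OF ell_tendsto_0 dbn_at_top])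
  then have ev2: "eventually (\<lambda>n. s * ((1 - e) - real n * ell (?x n) / bn n + (1 / bn n) * ell (?x n) + y * (ell (?x n) / ell (bn n)) * (1 / bn n))
        + s * exp s * y * (Lam n * V (?x n) / bn n) + s\<^sup>2 * exp s * (real n * V (?x n) / (bn n)\<^sup>2) < - (s * e / 2)) sequentially"
    using s e by (intro order_tendstoD(2)) (auto simp: field_simps)
  have "(\<lambda>n. s * (real n * ell (?x n) / bn n - (1 + e)) + s\<^sup>2 * (real n * V (?x n) / (bn n)\<^sup>2))
    \<longlonglongrightarrow> s * (1 - (1 + e)) + s\<^sup>2 * 0"
    using d by (intro tendsto_intros lim_n_ell_d lim_n_V_d)
  then have ev3: "eventually (\<lambda>n. s * (real n * ell (?x n) / bn n - (1 + e)) + s\<^sup>2 * (real n * V (?x n) / (bn n)\<^sup>2) < - (s * e / 2)) sequentially"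
    using s e by (intro order_tendstoD(2)) (auto simp: field_simps)
  have ev4: "eventually (\<lambda>n. real n * tail (?x n) < eta / 3) sequentially"
    using d eta by (intro order_tendstoD(2)[OF lim_n_tail_d]) auto
  show ?thesis
    using ev1 ev2 ev3 ev4 bn_pos eventually_gt_at_top[of 0]
  proof eventually_elim
    case (elim n)
    define B where "B = bn n"
    define K where "K = nat \<lfloor>d * B\<rfloor>"
    define l where "l = s / B"
    have B: "0 < B" using elim by (simp add: B_def)
    have n: "0 < real n" using elim by simp
    have KV: "ell (real K) = ell (d * B)" "V (real K) = V (d * B)" "tail (real K) = tail (d * B)"
      by (simp_all add: K_def ell_floor V_floor tail_floor)
    have sz: "(1 + e) * B + y * Lam n + 2 < real n"
      using elim(1) n by (simp add: B_def field_simps)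
    show ?case
    proof (intro allI impI)
      fix h assume h: "real h \<le> y * Lam n"
      have hn: "h + 1 < n" using h sz B e by (smt (verit) mult_pos_pos of_nat_1 of_nat_add of_nat_less_iff)
      define m where "m = n - 1 - h"
      have m: "real m = real n - 1 - real h" using hn by (simp add: m_def of_nat_diff)
      have mB: "(1 + e) * B \<le> real m" using h sz m by linarith
      have l: "0 \<le> l" "l * real K \<le> s"
      proof -
        show "0 \<le> l" using s B by (simp add: l_def)
        have "real K \<le> d * B" using d B by (simp add: K_def)
        also have "\<dots> \<le> B" using d B by simp
        finally show "l * real K \<le> s" using s B by (simp add: l_def field_simps)
      qed
      have x1: "l * ((1 - e) * B - real m * ell (d * B)) + real h * (l * exp s * V (d * B)) + real m * (l\<^sup>2 * exp s * V (d * B))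
         \<le> - (s * e / 2)"
      proof -
        have "real m * ell (d * B) = real n * ell (d * B) - ell (d * B) - real h * ell (d * B)"
          by (simp add: m algebra_simps)
        moreover have "real h * ell (d * B) \<le> y * Lam n * ell (d * B)"
          using h less_imp_le[OF ell_pos] by (intro mult_right_mono)
        ultimately have "l * ((1 - e) * B - real m * ell (d * B)) \<le>
            l * ((1 - e) * B - real n * ell (d * B) + ell (d * B) + y * Lam n * ell (d * B))"
          using l by (intro mult_left_mono) auto
        also have "\<dots> = s * ((1 - e) - real n * ell (d * B) / B + (1 / B) * ell (d * B) + y * (ell (d * B) / ell B) * (1 / B))"
          using B by (simp add: l_def Lam_of_nat B_def field_simps)
        finally have 1: "l * ((1 - e) * B - real m * ell (d * B)) \<le>
          s * ((1 - e) - real n * ell (d * B) / B + (1 / B) * ell (d * B) + y * (ell (d * B) / ell B) * (1 / B))" .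
        have "real h * (l * exp s * V (d * B)) \<le> y * Lam n * (l * exp s * V (d * B))"
          using h l V_nonneg by (intro mult_right_mono) auto
        also have "\<dots> = s * exp s * y * (Lam n * V (d * B) / B)" by (simp add: l_def)
        finally have 2: "real h * (l * exp s * V (d * B)) \<le> s * exp s * y * (Lam n * V (d * B) / B)" .
        have "real m * (l\<^sup>2 * exp s * V (d * B)) \<le> real n * (l\<^sup>2 * exp s * V (d * B))"
          using m l V_nonneg by (intro mult_right_mono) auto
        also have "\<dots> = s\<^sup>2 * exp s * (real n * V (d * B) / B\<^sup>2)" by (simp add: l_def power_divide)
        finally have 3: "real m * (l\<^sup>2 * exp s * V (d * B)) \<le> s\<^sup>2 * exp s * (real n * V (d * B) / B\<^sup>2)" .
        show ?thesis using 1 2 3 elim(2) unfolding B_def by linarith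
      qed
      have x2: "l * (real m * ell (d * B) - (1 + e) * B) + real m * (l\<^sup>2 * V (d * B)) \<le> - (s * e / 2)"
      proof -
        have "real m * ell (d * B) \<le> real n * ell (d * B)"
          using m less_imp_le[OF ell_pos] by (intro mult_right_mono) auto
        then have "l * (real m * ell (d * B) - (1 + e) * B) \<le> l * (real n * ell (d * B) - (1 + e) * B)"
          using l by (intro mult_left_mono) auto
        also have "\<dots> = s * (real n * ell (d * B) / B - (1 + e))" using B by (simp add: l_def field_simps)
        finally have 1: "l * (real m * ell (d * B) - (1 + e) * B) \<le> s * (real n * ell (d * B) / B - (1 + e))" .
        have "real m * (l\<^sup>2 * V (d * B)) \<le> real n * (l\<^sup>2 * V (d * B))"
          using m l V_nonneg by (intro mult_right_mono) auto
        also have "\<dots> = s\<^sup>2 * (real n * V (d * B) / B\<^sup>2)" by (simp add: l_def power_divide)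
        finally show ?thesis using 1 elim(3) unfolding B_def by linarith
      qed
      have x3: "(1 - ell (d * B)) ^ h - eta / 3 \<le> (1 - ell (d * B)) ^ h * (1 - tail (d * B)) ^ m"
      proof -
        have "real m * tail (d * B) \<le> real n * tail (d * B)" using m tail_nonneg by (intro mult_right_mono) auto
        then have t: "real m * tail (d * B) \<le> eta / 3" using elim(4) by (simp add: B_def)
        have tl: "tail (d * B) \<le> 1" unfolding tail_def using p_nonneg by (simp add: sum_nonneg)
        have "1 + real m * (- tail (d * B)) \<le> (1 + - tail (d * B)) ^ m"
          using tl by (intro Bernoulli_inequality) auto
        then have "1 - eta / 3 \<le> (1 - tail (d * B)) ^ m" using t by simp
        moreover have q: "0 \<le> (1 - ell (d * B)) ^ h" "(1 - ell (d * B)) ^ h \<le> 1"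
          using ell_le_1[of "d * B"] less_imp_le[OF ell_pos[of "d * B"]] by (auto intro: power_le_one)
        ultimately have "(1 - ell (d * B)) ^ h * (1 - eta / 3) \<le> (1 - ell (d * B)) ^ h * (1 - tail (d * B)) ^ m"
          by (intro mult_left_mono) auto
        moreover have "(1 - ell (d * B)) ^ h * (eta / 3) \<le> 1 * (eta / 3)" using q eta by (intro mult_right_mono) auto
        ultimately show ?thesis by (simp add: algebra_simps)
      qed
      have "exp (l * ((1 - e) * B - real m * ell (d * B)) + real h * (l * exp s * V (d * B)) + real m * (l\<^sup>2 * exp s * V (d * B))) \<le> eta / 3"
        "exp (l * (real m * ell (d * B) - (1 + e) * B) + real m * (l\<^sup>2 * V (d * B))) \<le> eta / 3"
        by (rule order_trans[OF exp_le_cancel_iff[THEN iffD2, OF x1] es])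
           (rule order_trans[OF exp_le_cancel_iff[THEN iffD2, OF x2] es])
      with window_bound[OF l e B mB, of h] x3
      have "(1 - ell (d * B)) ^ h - eta \<le> (\<Sum>k | (1 - e) * B \<le> real k \<and> real k \<le> (1 + e) * B. coeff (pderiv (P K) ^ h * P K ^ m) (m - k))"
        unfolding KV by linarith
      then show "h + 1 < n \<and> (1 + e) * bn n \<le> real (n - 1 - h) \<and>
        (1 - ell (d * bn n)) ^ h - eta \<le> (\<Sum>k | (1 - e) * bn n \<le> real k \<and> real k \<le> (1 + e) * bn n.
        coeff (pderiv (P (nat \<lfloor>d * bn n\<rfloor>)) ^ h * P (nat \<lfloor>d * bn n\<rfloor>) ^ (n - 1 - h)) (n - 1 - h - k))"
        using hn mB unfolding B_def K_def m_def by blast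
    qed
  qed
qed

end

section \<open>One big jump\<close>

lemma nonneg_fps_add: "nonneg_fps f \<Longrightarrow> nonneg_fps g \<Longrightarrow> nonneg_fps (f + g)"
  by (auto simp: nonneg_fps_def)

lemma nonneg_fps_of_nat: "nonneg_fps (of_nat n)"
  by (simp add: nonneg_fps_def fps_of_nat[symmetric] del: fps_of_nat)

lemma nonneg_fps_power_add_diff:
  assumes "nonneg_fps c" "nonneg_fps r"
  shows "nonneg_fps ((c + r) ^ n - c ^ n)"
proof (induction n)
  case 0
  then show ?case by (simp add: nonneg_fps_def)
next
  case (Suc n)
  have "(c + r) ^ Suc n - c ^ Suc n = (c + r) * ((c + r) ^ n - c ^ n) + r * c ^ n"
    by (simp add: algebra_simps)
  then show ?case using assms Suc by (auto intro!: nonneg_fps_add nonneg_fps_mult nonneg_fps_power)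
qed

text \<open>Union bound for coefficients: either all \<open>n\<close> factors come from
  \<open>c\<close>, or one of the \<open>n\<close> factors can be chosen that comes from
  \<open>r\<close>, the others being arbitrary.\<close>

lemma nonneg_fps_power_union_bound:
  assumes "nonneg_fps c" "nonneg_fps r"
  shows "nonneg_fps (c ^ n + of_nat n * (r * (c + r) ^ (n - 1)) - (c + r) ^ n)"
proof (induction n)
  case 0
  then show ?case by (simp add: nonneg_fps_def)
next
  case (Suc n)
  show ?case
  proof (cases n)
    case 0
    then show ?thesis by (simp add: nonneg_fps_def)
  next
    case (Suc m)
    let ?a = "c + r"
    have "c ^ Suc n + of_nat (Suc n) * (r * ?a ^ (Suc n - 1)) - ?a ^ Suc n =
        c * (c ^ n + of_nat n * (r * ?a ^ (n - 1)) - ?a ^ n) + of_nat n * (r * ?a ^ (n - 1) * r)"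
      using Suc by (simp add: algebra_simps)
    then show ?thesis using assms Suc.IH
      by (auto intro!: nonneg_fps_add nonneg_fps_mult nonneg_fps_power nonneg_fps_of_nat)
  qed
qed

lemma fps_power_union_bound:
  assumes "nonneg_fps c" "nonneg_fps r"
  shows "fps_nth ((c + r) ^ n) i \<le> fps_nth (c ^ n) i + real n * fps_nth (r * (c + r) ^ (n - 1)) i"
  using nonneg_fps_power_union_bound[OF assms, of n]
  by (simp add: nonneg_fps_def fps_mult_of_nat_nth)

text \<open>The exponent 4 is tuned to the dyadic levels: bounding \<open>p\<close> on level
  \<open>K\<close> costs three powers of \<open>B / K\<close>, and the fourth leaves the summable
  factor \<open>K / B\<close>. The constant is \<open>4 ^ 4\<close>.\<close>

lemma power4_le_exp: "0 \<le> u \<Longrightarrow> u ^ 4 \<le> 256 * exp u" for u :: real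
proof -
  assume u: "0 \<le> u"
  have "u / 4 \<le> exp (u / 4)" using exp_ge_add_one_self[of "u / 4"] by linarith
  then have "(u / 4) ^ 4 \<le> exp (u / 4) ^ 4" using u by (intro power_mono) auto
  also have "\<dots> = exp u" by (simp add: exp_of_nat_mult[symmetric])
  finally show ?thesis by (simp add: power_divide)
qed

lemma exp_uminus_le_power4: "0 < u \<Longrightarrow> exp (- u) \<le> 256 / u ^ 4" for u :: real
  using power4_le_exp[of u] by (simp add: exp_minus divide_simps mult.commute)

context cauchy_offspring
begin

text \<open>\<open>N\<close> steps truncated at \<open>K\<close> have mean
  \<open>N * (1 - ell K)\<close>, so coming within \<open>K\<close> of \<open>N\<close> is a
  deviation of about \<open>N * ell K\<close>. With exponent \<open>1 / K\<close> the second moment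
  uses up half of the gain, and the slack \<open>K\<close> costs the summand 1.\<close>

lemma P_power_chernoff:
  assumes K: "0 < K" "exp 1 * V (real K) \<le> real K * ell (real K) / 2"
    and I: "finite I" "\<And>i. i \<in> I \<Longrightarrow> N \<le> i + K"
  shows "(\<Sum>i\<in>I. coeff (P K ^ N) i) \<le> exp (1 - real N * ell (real K) / (2 * real K))"
proof -
  let ?l = "1 / real K"
  have "0 \<le> coeff (P K ^ N) i" for i using coeff_P_power_nonneg[of K 0 N i] by simp
  then have "(\<Sum>i\<in>I. coeff (P K ^ N) i) \<le> exp (- (?l * (real N - real K))) * poly (P K ^ N) (exp ?l)"
  proof (intro coeff_sum_chernoff I)
    fix i assume "i \<in> I"
    then have "real N \<le> real (i + K)" using I(2) of_nat_le_iff by blast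
    then show "?l * (real N - real K) \<le> ?l * real i" by (intro mult_left_mono) auto
  qed
  also have "\<dots> \<le> exp (- (?l * (real N - real K))) * exp (?l * (1 - ell (real K)) + ?l\<^sup>2 * exp 1 * V (real K)) ^ N"
    unfolding poly_power using K by (intro mult_left_mono power_mono poly_P_exp_le poly_P_nonneg) auto
  also have "\<dots> = exp (- (?l * (real N - real K)) + real N * (?l * (1 - ell (real K)) + ?l\<^sup>2 * exp 1 * V (real K)))"
    by (simp only: exp_of_nat_mult[symmetric] exp_add[symmetric])
  also have "\<dots> \<le> exp (1 - real N * ell (real K) / (2 * real K))"
  proof -
    have "real N * (exp 1 * V (real K)) / (real K)\<^sup>2 \<le> real N * (real K * ell (real K) / 2) / (real K)\<^sup>2"
      using K(2) by (intro divide_right_mono mult_left_mono) auto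
    also have "\<dots> = real N * ell (real K) / (2 * real K)" using K by (simp add: power2_eq_square)
    finally have "- (?l * (real N - real K)) + real N * (?l * (1 - ell (real K)) + ?l\<^sup>2 * exp 1 * V (real K))
       \<le> 1 - real N * ell (real K) / (2 * real K)"
      using K(1) by (simp add: field_simps power2_eq_square)
    then show ?thesis by simp
  qed
  finally show ?thesis .
qed

text \<open>A step in \<open>(K', K]\<close> takes each value with mass at most \<open>M\<close>;
  summing over its values replaces the exact constraint on the sum by an interval of length
  \<open>K\<close> for the other \<open>n - 1\<close> steps, where the Chernoff bound
  applies.\<close>

lemma P_power_step:
  assumes K: "0 < K" "exp 1 * V (real K) \<le> real K * ell (real K) / 2" "K' \<le> K"
    and M: "\<And>k. K' < k \<Longrightarrow> k \<le> K \<Longrightarrow> p k \<le> M" "0 \<le> M" and n: "0 < n"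
  shows "coeff (P K ^ n) (n - 1) \<le> coeff (P K' ^ n) (n - 1)
     + real n * (M * exp (1 - real (n - 1) * ell (real K) / (2 * real K)))"
proof -
  let ?c = "fps_of_poly (P K')" and ?r = "fps_of_poly (P K - P K')"
  have c: "nonneg_fps ?c" by (intro nonneg_fps_trunc_poly p_nonneg)
  have r: "nonneg_fps ?r" using K(3) p_nonneg by (auto simp: nonneg_fps_def coeff_trunc_poly)
  have cr: "?c + ?r = fps_of_poly (P K)" by (simp add: fps_of_poly_add[symmetric])
  have G: "0 \<le> coeff (P K ^ (n - 1)) i" for i using coeff_P_power_nonneg[of K 0 "n - 1" i] by simp
  have "coeff (P K ^ n) (n - 1) \<le> coeff (P K' ^ n) (n - 1) + real n * coeff ((P K - P K') * P K ^ (n - 1)) (n - 1)"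
    using fps_power_union_bound[OF c r, of n "n - 1"] unfolding cr
    by (simp add: fps_of_poly_power[symmetric] fps_of_poly_mult[symmetric])
  moreover have "coeff ((P K - P K') * P K ^ (n - 1)) (n - 1) \<le> M * exp (1 - real (n - 1) * ell (real K) / (2 * real K))"
  proof -
    have "coeff ((P K - P K') * P K ^ (n - 1)) (n - 1) = (\<Sum>i\<le>n - 1. coeff (P K - P K') i * coeff (P K ^ (n - 1)) (n - 1 - i))"
      by (simp add: coeff_mult)
    also have "\<dots> \<le> (\<Sum>i\<le>n - 1. if i \<le> K then M * coeff (P K ^ (n - 1)) (n - 1 - i) else 0)"
      using M G K(3) by (intro sum_mono) (auto simp: coeff_trunc_poly intro!: mult_right_mono)
    also have "\<dots> = M * (\<Sum>i | i \<le> n - 1 \<and> i \<le> K. coeff (P K ^ (n - 1)) (n - 1 - i))"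
      by (subst sum.inter_filter[symmetric]) (auto simp: sum_distrib_left)
    also have "(\<Sum>i | i \<le> n - 1 \<and> i \<le> K. coeff (P K ^ (n - 1)) (n - 1 - i)) =
        (\<Sum>i\<in>(\<lambda>i. n - 1 - i) ` {i. i \<le> n - 1 \<and> i \<le> K}. coeff (P K ^ (n - 1)) i)"
      by (subst sum.reindex) (auto simp: inj_on_def)
    also have "\<dots> \<le> exp (1 - real (n - 1) * ell (real K) / (2 * real K))"
      by (rule P_power_chernoff[OF K(1,2)]) auto
    finally show ?thesis using M(2) by (simp add: mult_left_mono)
  qed
  ultimately show ?thesis by (smt (verit) mult_left_mono of_nat_0_le_iff)
qed

text \<open>The order of \<open>p k\<close> for \<open>k\<close> near \<open>bn n\<close>, and thus
  the weight that a single big jump predicts for all trees with \<open>n\<close> vertices.\<close>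

definition rho :: "nat \<Rightarrow> real" where
  "rho n = L (bn n) / (bn n)\<^sup>2"

lemma p_le_L: obtains X where "X > 0" "\<And>k. X \<le> real k \<Longrightarrow> p k \<le> 2 * L (real k) / (real k)\<^sup>2"
proof -
  \<comment> \<open>The degenerate window \<open>k = x\<close> with tolerance 1 gives a pointwise
    upper bound.\<close>
  have "eventually (\<lambda>x. \<forall>k. 1 * x \<le> real k \<and> real k \<le> 1 * x \<longrightarrow>
    (1 - 1) * L x / (real k)\<^sup>2 \<le> p k \<and> p k \<le> (1 + 1) * L x / (real k)\<^sup>2) at_top"
    by (rule p_asymp_uniform) auto
  then obtain X where X: "\<And>x. X \<le> x \<Longrightarrow> \<forall>k. 1 * x \<le> real k \<and> real k \<le> 1 * x \<longrightarrow>
    (1 - 1) * L x / (real k)\<^sup>2 \<le> p k \<and> p k \<le> (1 + 1) * L x / (real k)\<^sup>2"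
    by (auto simp: eventually_at_top_linorder)
  show ?thesis
  proof (rule that[of "max X 1"])
    fix k assume "max X 1 \<le> real k"
    then show "p k \<le> 2 * L (real k) / (real k)\<^sup>2" using X[of "real k"] by simp
  qed simp
qed

lemma sqrt_le_self: "1 \<le> x \<Longrightarrow> sqrt x \<le> x"
  by (rule real_le_lsqrt) (auto simp: power2_eq_square)

text \<open>
  Removing the dyadic levels of jumps one by one replaces a local limit theorem: the largest jump, whose
  law is smooth on its level, absorbs the local constraint, and the Chernoff bound with exponent \<open>1 / K\<close>
  makes the contribution of level \<open>K\<close> exponentially small in \<open>b n / K\<close>.
\<close>

lemma small_jumps:
  obtains C where "C > 0" "\<And>d. 0 < d \<Longrightarrow> d \<le> 1 \<Longrightarrow>
    eventually (\<lambda>n. coeff (P (nat \<lfloor>d * bn n\<rfloor>) ^ n) (n - 1) \<le> C * d * (real n * rho n)) sequentially"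
proof -
  obtain X1 where X1: "X1 > 0" "\<And>k. X1 \<le> real k \<Longrightarrow> p k \<le> 2 * L (real k) / (real k)\<^sup>2"
    using p_le_L by blast
  obtain X2 where X2: "X2 > 0" "\<And>x. x \<ge> X2 \<Longrightarrow> L x > 0"
    "\<And>x y. X2 \<le> x \<Longrightarrow> x \<le> y \<Longrightarrow> L x \<le> 2 * sqrt (y / x) * L y"
    using potter_bounds[OF L] by metis
  have "eventually (\<lambda>x. V x / (x * ell x) < 1 / (2 * exp 1)) at_top"
    by (rule order_tendstoD(2)[OF V_over_x_ell]) simp
  then obtain X3 where X3: "\<And>x. x \<ge> X3 \<Longrightarrow> V x / (x * ell x) < 1 / (2 * exp 1)"
    by (auto simp: eventually_at_top_linorder)
  obtain K0 where K0: "max (max X1 X2) (max X3 1) < real K0" using reals_Archimedean2 by blast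
  have VK: "exp 1 * V (real K) \<le> real K * ell (real K) / 2" if "K0 \<le> K" for K
  proof -
    have K: "X3 \<le> real K" "0 < real K" using that K0 by auto
    then have "V (real K) \<le> (real K * ell (real K)) * (1 / (2 * exp 1))"
      using X3[of "real K"] ell_pos[of "real K"] by (simp add: pos_divide_less_eq mult.commute)
    then have "exp 1 * V (real K) \<le> exp 1 * ((real K * ell (real K)) * (1 / (2 * exp 1)))"
      by (intro mult_left_mono) auto
    then show ?thesis by simp
  qed
  \<comment> \<open>32 is the constant of \<open>M\<close> below and 65536 is
    \<open>256 * 4 ^ 4\<close>, from the fourth-power bound at \<open>B / K / 4\<close>.\<close>
  define C1 where "C1 = 32 * 65536 * exp (1 :: real)"
  have C1: "C1 > 0" by (simp add: C1_def)
  \<comment> \<open>Strong induction along \<open>K div 2\<close>: level \<open>K\<close>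
    contributes \<open>C1 * K / bn n\<close> and the levels below it at most as much again, whence
    the factor 2.\<close>
  have iter: "coeff (P K ^ n) (n - 1) \<le> coeff (P (2 * K0) ^ n) (n - 1) + 2 * C1 * (real n * rho n) * (real K / bn n)"
    if n: "0 < n" "bn n / 2 \<le> real (n - 1) * ell (bn n)" "real K0 \<le> bn n" and K: "real K \<le> bn n" for n K
    using K
  proof (induction K rule: less_induct)
    case (less K)
    define B where "B = bn n"
    have B: "0 < B" "X2 \<le> B" using n K0 by (auto simp: B_def)
    have rho: "0 < rho n" using X2(2)[OF B(2)] B by (simp add: rho_def B_def)
    show ?case
    proof (cases "K \<le> 2 * K0")
      case True
      let ?c = "fps_of_poly (P K)" and ?r = "fps_of_poly (P (2 * K0) - P K)"
      have "nonneg_fps ((?c + ?r) ^ n - ?c ^ n)"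
        using True p_nonneg
        by (intro nonneg_fps_power_add_diff nonneg_fps_trunc_poly) (auto simp: nonneg_fps_def coeff_trunc_poly)
      then have "coeff (P K ^ n) (n - 1) \<le> coeff (P (2 * K0) ^ n) (n - 1)"
        by (simp add: nonneg_fps_def fps_of_poly_add[symmetric] fps_of_poly_power[symmetric])
      moreover have "0 \<le> 2 * C1 * (real n * rho n) * (real K / bn n)" using C1 rho B by (simp add: B_def)
      ultimately show ?thesis by linarith
    next
      case False
      have K: "0 < real K" "K0 \<le> K" "0 < K" "K div 2 < K" "K0 \<le> K div 2" using False K0 by auto
      \<comment> \<open>On \<open>(K/2, K]\<close> the Potter bound, with the square root weakened
        to the ratio itself, gives \<open>p k \<le> 4 * B * L B / k^3\<close>; the cube of the half
        supplies the remaining 8.\<close>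
      define M where "M = 32 * rho n * (B / real K) ^ 3"
      have M: "p k \<le> M" if k: "K div 2 < k" "k \<le> K" for k
      proof -
        have kk: "X1 \<le> real k" "X2 \<le> real k" "0 < real k" "real k \<le> B" "real K / 2 \<le> real k"
          using k K K0 less.prems X1(1) by (auto simp: B_def)
        have "L (real k) \<le> 2 * sqrt (B / real k) * L B" using kk by (intro X2(3)) auto
        also have "\<dots> \<le> 2 * (B / real k) * L B"
          using kk X2(2)[OF B(2)] by (intro mult_right_mono mult_left_mono sqrt_le_self) auto
        finally have Lk: "L (real k) \<le> 2 * (B / real k) * L B" .
        have "p k \<le> 2 * L (real k) / (real k)\<^sup>2" by (rule X1(2)[OF kk(1)])
        also have "\<dots> \<le> 2 * (2 * (B / real k) * L B) / (real k)\<^sup>2"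
          using Lk by (intro divide_right_mono mult_left_mono) auto
        also have "\<dots> = 4 * B * L B / real k ^ 3" by (simp add: power2_eq_square power3_eq_cube)
        also have "\<dots> \<le> 4 * B * L B / (real K / 2) ^ 3"
          using kk K B X2(2)[OF B(2)] by (intro divide_left_mono power_mono) auto
        also have "\<dots> = M" using B by (simp add: M_def rho_def B_def[symmetric] power2_eq_square power3_eq_cube)
        finally show ?thesis .
      qed
      have M0: "0 \<le> M" using rho B by (simp add: M_def)
      have "coeff (P K ^ n) (n - 1) \<le> coeff (P (K div 2) ^ n) (n - 1)
        + real n * (M * exp (1 - real (n - 1) * ell (real K) / (2 * real K)))"
        using K by (intro P_power_step VK M M0 n) auto
      also have "coeff (P (K div 2) ^ n) (n - 1) \<le> coeff (P (2 * K0) ^ n) (n - 1) + 2 * C1 * (real n * rho n) * (real (K div 2) / bn n)"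
        using less.prems K by (intro less.IH) auto
      also have "2 * C1 * (real n * rho n) * (real (K div 2) / bn n) \<le> 2 * C1 * (real n * rho n) * ((real K / 2) / bn n)"
        using C1 rho B by (intro mult_left_mono divide_right_mono) (auto simp: B_def)
      also have "real n * (M * exp (1 - real (n - 1) * ell (real K) / (2 * real K))) \<le> real n * (C1 * rho n * (real K / B))"
      proof (intro mult_left_mono)
        have "bn n / 2 \<le> real (n - 1) * ell (real K)"
          using less.prems by (intro order_trans[OF n(2)] mult_left_mono ell_antimono) auto
        then have "B / 2 / (2 * real K) \<le> real (n - 1) * ell (real K) / (2 * real K)"
          unfolding B_def by (intro divide_right_mono) auto
        then have "exp (1 - real (n - 1) * ell (real K) / (2 * real K)) \<le> exp (1 - (B / real K) / 4)" by simp
        also have "\<dots> = exp 1 * exp (- (B / real K / 4))" by (simp only: exp_add[symmetric] diff_conv_add_uminus)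
        also have "\<dots> \<le> exp 1 * (256 / (B / real K / 4) ^ 4)"
          using B K by (intro mult_left_mono exp_uminus_le_power4) auto
        also have "\<dots> = exp 1 * (65536 / (B / real K) ^ 4)" by (simp add: power_divide)
        finally have "M * exp (1 - real (n - 1) * ell (real K) / (2 * real K)) \<le> M * (exp 1 * (65536 / (B / real K) ^ 4))"
          using M0 by (intro mult_left_mono)
        also have "\<dots> = C1 * rho n * (real K / B)"
          using B K by (simp add: M_def C1_def field_simps power3_eq_cube power4_eq_xxxx)
        finally show "M * exp (1 - real (n - 1) * ell (real K) / (2 * real K)) \<le> C1 * rho n * (real K / B)" .
      qed simp
      finally show ?thesis by (simp add: B_def field_simps)
    qed
  qed
  define c where "c = ell (real (2 * K0)) / (2 * real (2 * K0))"
  have c: "c > 0" using ell_pos K0 by (simp add: c_def)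
  have X2': "X2 \<le> real K0" "1 \<le> real K0" using K0 by auto
  have LX: "L (real K0) > 0" using X2(2) X2' by simp
  show ?thesis
  proof (rule that[of "2 * C1 + 1"])
    fix d :: real assume d: "0 < d" "d \<le> 1"
    \<comment> \<open>Below the fixed level \<open>2 * K0\<close> the mass decays like
      \<open>exp (- c * n)\<close>, which beats the crude lower bound
      \<open>L K0 / (2 * n^3)\<close> for \<open>rho n\<close> once
      \<open>D \<le> n^2\<close>.\<close>
    define D where "D = 512 * exp 1 / (c ^ 4 * d * L (real K0))"
    have "eventually (\<lambda>n. 1 / 2 < real n * ell (bn n) / bn n - ell (bn n) * (1 / bn n)) sequentially"
      by (rule order_tendstoD(1)[OF tendsto_diff[OF lim_n_ell tendsto_mult[OF lim_ell_bn lim_inverse_bn]]]) simp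
    moreover have "eventually (\<lambda>n. real K0 \<le> bn n) sequentially"
      using bn_at_top by (auto simp: filterlim_at_top)
    moreover have "eventually (\<lambda>n. D \<le> real n) sequentially"
      using filterlim_real_sequentially by (auto simp: filterlim_at_top)
    ultimately show "eventually (\<lambda>n. coeff (P (nat \<lfloor>d * bn n\<rfloor>) ^ n) (n - 1) \<le> (2 * C1 + 1) * d * (real n * rho n)) sequentially"
      using eventually_gt_at_top[of 0]
    proof eventually_elim
      case (elim n)
      define B where "B = bn n"
      have B: "real K0 \<le> B" "1 \<le> B" "B \<le> real n" "0 < B" using elim X2' b_le[of "real n"] by (auto simp: B_def)
      have n: "1 \<le> real n" using elim by simp
      let ?K = "nat \<lfloor>d * B\<rfloor>"
      have KB: "real ?K \<le> d * B" using d B by simp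
      also have "d * B \<le> B" using d B by simp
      finally have KB': "real ?K \<le> B" .
      have LB: "L (real K0) / (2 * B) \<le> L B"
      proof -
        have "L (real K0) \<le> 2 * sqrt (B / real K0) * L B" using X2' B by (intro X2(3)) auto
        also have "\<dots> \<le> 2 * B * L B"
        proof (intro mult_right_mono mult_left_mono)
          have "B / real K0 \<le> B / 1" using B X2' by (intro divide_left_mono) auto
          then have "sqrt (B / real K0) \<le> sqrt B" by simp
          also have "\<dots> \<le> B" using B by (intro sqrt_le_self)
          finally show "sqrt (B / real K0) \<le> B" .
        qed (use X2(2)[of B] X2' B in auto)
        finally show ?thesis using B by (simp add: field_simps)
      qed
      have rho: "L (real K0) / (2 * real n ^ 3) \<le> rho n"
      proof -
        have "L (real K0) / (2 * real n ^ 3) \<le> L (real K0) / (2 * B ^ 3)"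
          using B LX by (intro divide_left_mono mult_left_mono power_mono) auto
        also have "\<dots> = (L (real K0) / (2 * B)) / B\<^sup>2" by (simp add: power2_eq_square power3_eq_cube)
        also have "\<dots> \<le> rho n" unfolding rho_def B_def[symmetric] using LB by (intro divide_right_mono) auto
        finally show ?thesis .
      qed
      have "coeff (P (2 * K0) ^ n) (n - 1) = (\<Sum>i\<in>{n - 1}. coeff (P (2 * K0) ^ n) i)" by simp
      also have "\<dots> \<le> exp (1 - real n * ell (real (2 * K0)) / (2 * real (2 * K0)))"
        using X2' VK[of "2 * K0"] by (intro P_power_chernoff) auto
      also have "\<dots> = exp 1 * exp (- (real n * c))"
        by (simp add: c_def exp_add[symmetric] del: of_nat_mult)
      also have "\<dots> \<le> exp 1 * (256 / (real n * c) ^ 4)"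
        using c n by (intro mult_left_mono exp_uminus_le_power4) auto
      also have "\<dots> \<le> d * (real n * (L (real K0) / (2 * real n ^ 3)))"
      proof -
        have "D * 1 \<le> real n * real n" using elim n c d LX by (intro mult_mono) (auto simp: D_def)
        then have "512 * exp 1 \<le> real n * real n * (c ^ 4 * d * L (real K0))"
          using c d LX by (simp add: D_def pos_divide_le_eq)
        then show ?thesis using n c by (simp add: field_simps power3_eq_cube power4_eq_xxxx power_mult_distrib)
      qed
      also have "\<dots> \<le> d * (real n * rho n)" using d rho by (intro mult_left_mono) auto
      finally have base: "coeff (P (2 * K0) ^ n) (n - 1) \<le> d * (real n * rho n)" .
      have "rho n \<ge> 0" using rho LX n by (smt (verit) divide_nonneg_nonneg zero_le_power)
      then have "2 * C1 * (real n * rho n) * (real ?K / B) \<le> 2 * C1 * (real n * rho n) * d"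
        using C1 KB B by (intro mult_left_mono) (auto simp: pos_divide_le_eq)
      moreover have "coeff (P ?K ^ n) (n - 1) \<le> coeff (P (2 * K0) ^ n) (n - 1) + 2 * C1 * (real n * rho n) * (real ?K / bn n)"
      proof (rule iter)
        show "bn n / 2 \<le> real (n - 1) * ell (bn n)"
          using elim(1,4) B unfolding B_def[symmetric] by (simp add: of_nat_diff field_simps)
      qed (use elim KB' in \<open>auto simp: B_def\<close>)
      ultimately show ?case using base by (simp add: B_def algebra_simps)
    qed
  qed (use C1 in simp)
qed


lemma sum_fps_power_le_1: "(\<Sum>t\<le>N. fps_nth (Abs_fps p ^ m) t) \<le> 1"
proof (induction m)
  case 0
  then show ?case by simp
next
  case (Suc m)
  let ?g = "\<lambda>t. fps_nth (Abs_fps p ^ m) t"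
  have g: "0 \<le> ?g t" for t
    using nonneg_fps_power[of "Abs_fps p" m] p_nonneg by (simp add: nonneg_fps_def)
  have "(\<Sum>t\<le>N. fps_nth (Abs_fps p ^ Suc m) t) = (\<Sum>t\<le>N. \<Sum>i\<le>t. p i * ?g (t - i))"
    by (simp add: fps_mult_nth atLeast0AtMost)
  also have "\<dots> = (\<Sum>i\<le>N. \<Sum>t\<in>{i..N}. p i * ?g (t - i))"
    by (simp add: sum.Sigma) (rule sum.reindex_bij_witness[of _ "\<lambda>(x, y). (y, x)" "\<lambda>(x, y). (y, x)"], auto)
  also have "\<dots> \<le> (\<Sum>i\<le>N. p i * 1)"
  proof (rule sum_mono)
    fix i assume i: "i \<in> {..N}"
    have "(\<Sum>t\<in>{i..N}. ?g (t - i)) = (\<Sum>s\<le>N - i. ?g s)"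
      using i by (intro sum.reindex_bij_witness[of _ "\<lambda>s. s + i" "\<lambda>t. t - i"]) auto
    also have "\<dots> \<le> (\<Sum>s\<le>N. ?g s)" using g by (intro sum_mono2) auto
    also have "\<dots> \<le> 1" by (rule Suc)
    finally show "(\<Sum>t\<in>{i..N}. p i * ?g (t - i)) \<le> p i * 1"
      using p_nonneg by (simp only: sum_distrib_left[symmetric]) (intro mult_left_mono, auto)
  qed
  also have "\<dots> \<le> 1" using sum_p_le_1 by simp
  finally show ?case .
qed

text \<open>By the Potter bound \<open>L k\<close> grows at most linearly beyond
  \<open>d * bn n\<close>, slower than \<open>k^2\<close>, so the bound at the left end, of order
  \<open>rho n\<close>, persists for all larger \<open>k\<close>.\<close>

lemma p_le_rho:
  assumes d: "0 < d" "d \<le> 1"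
  shows "eventually (\<lambda>n. \<forall>k. d * bn n < real k \<longrightarrow> p k \<le> 8 * rho n / d\<^sup>2) sequentially"
proof -
  obtain X1 where X1: "X1 > 0" "\<And>k. X1 \<le> real k \<Longrightarrow> p k \<le> 2 * L (real k) / (real k)\<^sup>2"
    using p_le_L by blast
  obtain X2 where X2: "X2 > 0" "\<And>x. x \<ge> X2 \<Longrightarrow> L x > 0"
    "\<And>x y. X2 \<le> x \<Longrightarrow> x \<le> y \<Longrightarrow> L y \<le> 2 * sqrt (y / x) * L x"
    using potter_bounds[OF L] by metis
  have "eventually (\<lambda>n. L (d * bn n) / L (bn n) < 2) sequentially"
    by (rule order_tendstoD(2)[OF filterlim_compose[OF slowly_varying_lim[OF L d(1)] bn_at_top]]) simp
  moreover have "eventually (\<lambda>n. max X1 X2 \<le> d * bn n) sequentially"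
    using dbn_at_top[OF d(1)] unfolding filterlim_at_top by blast
  ultimately show ?thesis
  proof eventually_elim
    case (elim n)
    define B where "B = bn n"
    have dB: "X1 \<le> d * B" "X2 \<le> d * B" "0 < d * B" using elim X1(1) by (auto simp: B_def)
    then have "0 < B" using d by (simp add: zero_less_mult_iff)
    moreover from this have "d * B \<le> 1 * B" using d by (intro mult_right_mono) auto
    ultimately have B: "0 < B" "X2 \<le> B" using dB by linarith+
    have LB: "0 < L B" by (rule X2(2)[OF B(2)])
    have LdB: "L (d * B) \<le> 2 * L B" using elim(1) LB by (simp add: B_def[symmetric] field_simps)
    show ?case
    proof (intro allI impI)
      fix k assume "d * bn n < real k"
      then have k: "d * B < real k" by (simp add: B_def)
      then have k0: "0 < real k" using dB by linarith
      have "L (real k) \<le> 2 * sqrt (real k / (d * B)) * L (d * B)" using k dB by (intro X2(3)) auto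
      also have "\<dots> \<le> 2 * (real k / (d * B)) * L (d * B)"
        using k dB X2(2)[OF dB(2)] by (intro mult_right_mono mult_left_mono sqrt_le_self) auto
      also have "\<dots> \<le> 2 * (real k / (d * B)) * (2 * L B)"
        using LdB dB k0 by (intro mult_left_mono) auto
      finally have Lk: "L (real k) \<le> 4 * L B * real k / (d * B)" by (simp add: mult_ac)
      have "p k \<le> 2 * L (real k) / (real k)\<^sup>2" using X1(2) k dB by auto
      also have "\<dots> \<le> 2 * (4 * L B * real k / (d * B)) / (real k)\<^sup>2"
        using Lk by (intro divide_right_mono mult_left_mono) auto
      also have "\<dots> = 8 * L B / (d * B) / real k" using k0 by (simp add: power2_eq_square)
      also have "\<dots> \<le> 8 * L B / (d * B) / (d * B)"
        using k dB LB k0 by (intro divide_left_mono divide_nonneg_pos) auto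
      also have "\<dots> = 8 * rho n / d\<^sup>2" by (simp add: rho_def B_def power2_eq_square)
      finally show "p k \<le> 8 * rho n / d\<^sup>2" .
    qed
  qed
qed

lemma rho_pos: "eventually (\<lambda>n. 0 < rho n) sequentially"
  using eventually_compose_filterlim[OF slowly_varying_eventually_pos[OF L] bn_at_top] bn_pos
  by eventually_elim (simp add: rho_def)

lemma p_window:
  assumes e: "0 < e" "e < 1"
  shows "eventually (\<lambda>n. \<forall>k. (1 - e) * bn n \<le> real k \<and> real k \<le> (1 + e) * bn n \<longrightarrow>
    (1 - e) / (1 + e)\<^sup>2 * rho n \<le> p k \<and> p k \<le> (1 + e) / (1 - e)\<^sup>2 * rho n) sequentially"
proof -
  have "eventually (\<lambda>n. \<forall>k. (1 - e) * bn n \<le> real k \<and> real k \<le> (1 + e) * bn n \<longrightarrow>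
    (1 - e) * L (bn n) / (real k)\<^sup>2 \<le> p k \<and> p k \<le> (1 + e) * L (bn n) / (real k)\<^sup>2) sequentially"
    using e by (intro eventually_compose_filterlim[OF p_asymp_uniform bn_at_top]) auto
  then show ?thesis
    using bn_pos eventually_compose_filterlim[OF slowly_varying_eventually_pos[OF L] bn_at_top]
  proof eventually_elim
    case (elim n)
    show ?case
    proof (intro allI impI)
      fix k assume k: "(1 - e) * bn n \<le> real k \<and> real k \<le> (1 + e) * bn n"
      have pos: "0 < (1 - e) * bn n" using e elim by simp
      then have k0: "0 < real k" using k by linarith
      have pos': "0 < (1 + e) * bn n" using e elim by simp
      have "(1 - e) / (1 + e)\<^sup>2 * rho n = (1 - e) * L (bn n) / ((1 + e) * bn n)\<^sup>2"
        by (simp add: rho_def power_mult_distrib)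
      also have "\<dots> \<le> (1 - e) * L (bn n) / (real k)\<^sup>2"
        using k e elim k0 pos' by (intro divide_left_mono power_mono mult_pos_pos zero_less_power) auto
      finally have 1: "(1 - e) / (1 + e)\<^sup>2 * rho n \<le> (1 - e) * L (bn n) / (real k)\<^sup>2" .
      have "(1 + e) * L (bn n) / (real k)\<^sup>2 \<le> (1 + e) * L (bn n) / ((1 - e) * bn n)\<^sup>2"
        using k e elim less_imp_le[OF pos] by (intro frac_le power_mono zero_less_power pos) auto
      also have "\<dots> = (1 + e) / (1 - e)\<^sup>2 * rho n" by (simp add: rho_def power_mult_distrib)
      finally show "(1 - e) / (1 + e)\<^sup>2 * rho n \<le> p k \<and> p k \<le> (1 + e) / (1 - e)\<^sup>2 * rho n"
        using 1 elim(1)[rule_format, OF k] by linarith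
    qed
  qed
qed

text \<open>
  The sum of the jumps can only reach \<open>n - 1\<close> through one jump close to \<open>b n\<close>: a big jump of another
  size is ruled out by the law of large numbers for the remaining steps.
\<close>

lemma total_power_le:
  assumes kap: "0 < kap"
  shows "eventually (\<lambda>n. fps_nth (Abs_fps p ^ n) (n - 1) \<le> (1 + kap) * (real n * rho n)) sequentially"
proof -
  obtain C where C: "C > 0" "\<And>d. 0 < d \<Longrightarrow> d \<le> 1 \<Longrightarrow>
    eventually (\<lambda>n. coeff (P (nat \<lfloor>d * bn n\<rfloor>) ^ n) (n - 1) \<le> C * d * (real n * rho n)) sequentially"
    by (rule small_jumps) blast
  \<comment> \<open>The excess \<open>kap\<close> is split into thirds: jumps of the wanted size
    (through \<open>e\<close>), only small jumps (through \<open>d\<close>), and big jumps of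
    another size (through \<open>eta\<close>).\<close>
  define e where "e = min (kap / 30) (1 / 8)"
  have e: "0 < e" "e < 1" "e \<le> kap / 30" "e \<le> 1 / 8" using kap by (auto simp: e_def)
  have ee: "(1 + e) / (1 - e)\<^sup>2 \<le> 1 + kap / 3"
  proof -
    have "e * kap \<le> 1/8 * kap" using e kap by (intro mult_right_mono) auto
    moreover have "(1 + kap / 3) * (1 - 2 * e) = 1 + kap / 3 - 2 * e - 2 / 3 * (e * kap)"
      by (simp add: field_simps)
    ultimately have "1 + e \<le> (1 + kap / 3) * (1 - 2 * e)" using e kap by linarith
    also have "\<dots> \<le> (1 + kap / 3) * (1 - e)\<^sup>2"
      using kap by (intro mult_left_mono) (auto simp: power2_eq_square algebra_simps)
    finally show ?thesis using e by (simp add: pos_divide_le_eq)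
  qed
  define d where "d = min 1 (kap / (3 * C))"
  have d: "0 < d" "d \<le> 1" "C * d \<le> kap / 3"
  proof -
    show "0 < d" "d \<le> 1" using kap C by (auto simp: d_def)
    have "C * d \<le> C * (kap / (3 * C))" using C by (intro mult_left_mono) (auto simp: d_def)
    then show "C * d \<le> kap / 3" using C by simp
  qed
  \<comment> \<open>A jump of another size has mass at most \<open>8 * rho n / d^2\<close>, so
    \<open>eta\<close> is scaled to make the product \<open>kap / 3 * rho n\<close>.\<close>
  define eta where "eta = kap * d\<^sup>2 / 24"
  have eta: "0 < eta" using kap d by (simp add: eta_def)
  \<comment> \<open>The case \<open>h = 0\<close>: without a spine this is the concentration of the
    sum of the other \<open>n - 1\<close> steps near \<open>n - 1 - bn n\<close>.\<close>
  have win: "eventually (\<lambda>n. \<forall>h. real h \<le> 0 * Lam n \<longrightarrow>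
     h + 1 < n \<and> (1 + e) * bn n \<le> real (n - 1 - h) \<and>
     (1 - ell (d * bn n)) ^ h - eta \<le> (\<Sum>k | (1 - e) * bn n \<le> real k \<and> real k \<le> (1 + e) * bn n.
        coeff (pderiv (P (nat \<lfloor>d * bn n\<rfloor>)) ^ h * P (nat \<lfloor>d * bn n\<rfloor>) ^ (n - 1 - h)) (n - 1 - h - k))) sequentially"
    by (rule window_concentration[OF d(1,2) e(1,2) _ eta]) simp
  show ?thesis
    using win C(2)[OF d(1,2)] p_le_rho[OF d(1,2)] p_window[OF e(1,2)] rho_pos bn_pos
  proof eventually_elim
    case (elim n)
    define K where "K = nat \<lfloor>d * bn n\<rfloor>"
    define W where "W = {k. (1 - e) * bn n \<le> real k \<and> real k \<le> (1 + e) * bn n}"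
    have w: "1 < n" "(1 + e) * bn n \<le> real (n - 1)"
       "1 - eta \<le> (\<Sum>k\<in>W. coeff (P K ^ (n - 1)) (n - 1 - k))"
      using elim(1)[rule_format, of 0] by (auto simp: K_def W_def)
    have WS: "W \<subseteq> {..n - 1}"
    proof
      fix k assume "k \<in> W"
      then have "real k \<le> real (n - 1)" using w(2) by (auto simp: W_def)
      then show "k \<in> {..n - 1}" by simp
    qed
    let ?c = "fps_of_poly (P K)" and ?r = "Abs_fps (\<lambda>k. if k \<le> K then 0 else p k)"
    have c: "nonneg_fps ?c" by (intro nonneg_fps_trunc_poly p_nonneg)
    have r: "nonneg_fps ?r" using p_nonneg by (auto simp: nonneg_fps_def)
    have cr: "?c + ?r = Abs_fps p" by (rule fps_ext) (simp add: coeff_trunc_poly)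
    define G where "G t = fps_nth (Abs_fps p ^ (n - 1)) t" for t
    have G0: "0 \<le> G t" for t
      using nonneg_fps_power[of "Abs_fps p" "n - 1"] p_nonneg by (simp add: nonneg_fps_def G_def)
    have GP: "coeff (P K ^ (n - 1)) t \<le> G t" for t
      using nonneg_fps_power_add_diff[OF c r, of "n - 1"] unfolding cr
      by (simp add: nonneg_fps_def G_def fps_of_poly_power[symmetric])
    define S where "S = (\<Sum>i\<le>n - 1. G (n - 1 - i))"
    define SW where "SW = (\<Sum>i\<in>W. G (n - 1 - i))"
    have "S = (\<Sum>t\<le>n - 1. G t)" unfolding S_def
      by (rule sum.reindex_bij_witness[of _ "\<lambda>t. n - 1 - t" "\<lambda>t. n - 1 - t"]) auto
    then have S1: "S \<le> 1" using sum_fps_power_le_1 by (simp add: G_def)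
    have SWS: "SW \<le> S" unfolding SW_def S_def using WS G0 by (intro sum_mono2) auto
    have SW0: "0 \<le> SW" unfolding SW_def by (intro sum_nonneg G0)
    have SW1: "1 - eta \<le> SW" unfolding SW_def by (intro order_trans[OF w(3)] sum_mono GP)
    have fin: "finite W" using WS finite_subset by blast
    let ?A = "(1 + kap / 3) * rho n" and ?D = "8 * rho n / d\<^sup>2"
    have A0: "0 \<le> ?A" "0 \<le> ?D" using kap elim(5) by auto
    have "fps_nth (?r * Abs_fps p ^ (n - 1)) (n - 1) = (\<Sum>i\<le>n - 1. (if i \<le> K then 0 else p i) * G (n - 1 - i))"
      by (simp add: fps_mult_nth G_def atLeast0AtMost)
    also have "\<dots> \<le> (\<Sum>i\<le>n - 1. (if i \<in> W then ?A * G (n - 1 - i) else 0) + (if i \<in> W then 0 else ?D * G (n - 1 - i)))"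
    proof (rule sum_mono)
      fix i
      have "(if i \<le> K then 0 else p i) \<le> (if i \<in> W then ?A else ?D)"
      proof (cases "i \<le> K")
        case True
        then show ?thesis using A0 by auto
      next
        case False
        then have "d * bn n < real i" using d elim(6) by (simp add: K_def le_nat_floor_iff not_le)
        then have "p i \<le> ?D" using elim(3) by blast
        moreover have "p i \<le> ?A" if "i \<in> W"
        proof -
          have "p i \<le> (1 + e) / (1 - e)\<^sup>2 * rho n" using elim(4) that by (auto simp: W_def)
          also have "\<dots> \<le> ?A" using ee elim(5) by (intro mult_right_mono) auto
          finally show ?thesis .
        qed
        ultimately show ?thesis using False by auto
      qed
      then have "(if i \<le> K then 0 else p i) * G (n - 1 - i) \<le> (if i \<in> W then ?A else ?D) * G (n - 1 - i)"
        using G0 by (intro mult_right_mono)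
      then show "(if i \<le> K then 0 else p i) * G (n - 1 - i) \<le>
        (if i \<in> W then ?A * G (n - 1 - i) else 0) + (if i \<in> W then 0 else ?D * G (n - 1 - i))"
        by (auto split: if_splits)
    qed
    also have "\<dots> = ?A * SW + ?D * (S - SW)"
    proof -
      have SW: "(\<Sum>i\<le>n - 1. if i \<in> W then c * G (n - 1 - i) else 0) = c * SW" for c
        unfolding SW_def sum_distrib_left using WS by (intro sum.mono_neutral_cong_right) auto
      have "(\<Sum>i\<le>n - 1. if i \<in> W then 0 else ?D * G (n - 1 - i)) + (\<Sum>i\<le>n - 1. if i \<in> W then ?D * G (n - 1 - i) else 0) = ?D * S"
        unfolding sum.distrib[symmetric] S_def sum_distrib_left by (intro sum.cong) auto
      then show ?thesis unfolding sum.distrib SW right_diff_distrib by linarith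
    qed
    \<comment> \<open>The other \<open>n - 1\<close> steps have mass at most 1 in all and at least
      \<open>1 - eta\<close> inside the window, hence at most \<open>eta\<close> outside.\<close>
    also have "\<dots> \<le> ?A * 1 + ?D * eta"
      using A0 S1 SWS SW1 by (intro add_mono mult_left_mono) auto
    also have "\<dots> = (1 + 2 * kap / 3) * rho n" using d by (simp add: eta_def field_simps)
    finally have "real n * fps_nth (?r * Abs_fps p ^ (n - 1)) (n - 1) \<le> real n * ((1 + 2 * kap / 3) * rho n)"
      by (intro mult_left_mono) auto
    moreover have "fps_nth (Abs_fps p ^ n) (n - 1) \<le> fps_nth (?c ^ n) (n - 1) + real n * fps_nth (?r * Abs_fps p ^ (n - 1)) (n - 1)"
      using fps_power_union_bound[OF c r, of n "n - 1"] unfolding cr .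
    moreover have "fps_nth (?c ^ n) (n - 1) \<le> kap / 3 * (real n * rho n)"
    proof -
      have "fps_nth (?c ^ n) (n - 1) \<le> C * d * (real n * rho n)"
        using elim(2) by (simp add: K_def fps_of_poly_power[symmetric])
      also have "\<dots> \<le> kap / 3 * (real n * rho n)" using d elim(5) by (intro mult_right_mono) auto
      finally show ?thesis .
    qed
    ultimately show ?case by (simp add: algebra_simps)
  qed
qed

end

section \<open>The height of the vertex with maximal degree\<close>

lemma one_minus_power_tendsto_exp:
  fixes a :: "nat \<Rightarrow> real" and k :: "nat \<Rightarrow> nat"
  assumes a: "a \<longlonglongrightarrow> 0" "\<And>n. 0 < a n" and k: "(\<lambda>n. real (k n) * a n) \<longlonglongrightarrow> x"
  shows "(\<lambda>n. (1 - a n) ^ k n) \<longlonglongrightarrow> exp (- x)"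
proof -
  have ev: "eventually (\<lambda>n. a n < 1 / 2) sequentially" using a(1) by (intro order_tendstoD(2)) auto
  have "(\<lambda>n. real (k n) * ln (1 - a n)) \<longlonglongrightarrow> - x"
  proof (rule tendsto_sandwich)
    have "(\<lambda>n. - (real (k n) * a n) - 2 * ((real (k n) * a n) * a n)) \<longlonglongrightarrow> - x - 2 * (x * 0)"
      by (intro tendsto_intros a k)
    then show "(\<lambda>n. - (real (k n) * a n) - 2 * ((real (k n) * a n) * a n)) \<longlonglongrightarrow> - x" by simp
    show "(\<lambda>n. - (real (k n) * a n)) \<longlonglongrightarrow> - x" by (intro tendsto_intros k)
    show "eventually (\<lambda>n. - (real (k n) * a n) - 2 * ((real (k n) * a n) * a n) \<le> real (k n) * ln (1 - a n)) sequentially"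
      using ev
    proof eventually_elim
      case (elim n)
      have "real (k n) * (- a n - 2 * (a n)\<^sup>2) \<le> real (k n) * ln (1 - a n)"
        using elim a(2)[of n] by (intro mult_left_mono ln_one_minus_pos_lower_bound) auto
      then show ?case by (simp add: algebra_simps power2_eq_square)
    qed
    show "eventually (\<lambda>n. real (k n) * ln (1 - a n) \<le> - (real (k n) * a n)) sequentially"
      using ev
    proof eventually_elim
      case (elim n)
      have "real (k n) * ln (1 - a n) \<le> real (k n) * (- a n)"
        using elim a(2)[of n] by (intro mult_left_mono ln_one_minus_pos_upper_bound) auto
      then show ?case by simp
    qed
  qed
  then have "(\<lambda>n. exp (real (k n) * ln (1 - a n))) \<longlonglongrightarrow> exp (- x)" by (rule tendsto_exp)
  moreover have "eventually (\<lambda>n. exp (real (k n) * ln (1 - a n)) = (1 - a n) ^ k n) sequentially"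
    using ev by eventually_elim (simp add: exp_of_nat_mult)
  ultimately show ?thesis by (simp add: tendsto_cong)
qed

lemma geometric_interval_sum: "h0 \<le> h1 \<Longrightarrow> (1 - q) * (\<Sum>h\<in>{h0..<h1}. q ^ h) = q ^ h0 - q ^ h1" for q :: real
proof (induction h1 rule: dec_induct)
  case (step n)
  have "(1 - q) * (\<Sum>h\<in>{h0..<Suc n}. q ^ h) = (1 - q) * (\<Sum>h\<in>{h0..<n}. q ^ h) + (1 - q) * q ^ n"
    using step by (simp add: distrib_left)
  also have "\<dots> = q ^ h0 - q ^ n + (1 - q) * q ^ n" using step by simp
  finally show ?case by (simp add: algebra_simps)
qed simp

lemma nat_ceiling_ratio_tendsto:
  assumes F: "filterlim F at_top sequentially" and x: "0 \<le> x"
  shows "(\<lambda>n. real (nat \<lceil>x * F n\<rceil>) / F n) \<longlonglongrightarrow> x"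
proof (rule tendsto_sandwich)
  have pos: "eventually (\<lambda>n. 0 < F n) sequentially"
    by (rule eventually_compose_filterlim[OF eventually_gt_at_top F])
  show "eventually (\<lambda>n. x \<le> real (nat \<lceil>x * F n\<rceil>) / F n) sequentially"
    using pos
  proof eventually_elim
    case (elim n)
    have "x * F n \<le> real (nat \<lceil>x * F n\<rceil>)" by (rule real_nat_ceiling_ge)
    then show "x \<le> real (nat \<lceil>x * F n\<rceil>) / F n" using elim by (simp add: pos_le_divide_eq)
  qed
  show "eventually (\<lambda>n. real (nat \<lceil>x * F n\<rceil>) / F n \<le> x + 1 / F n) sequentially"
    using pos
  proof eventually_elim
    case (elim n)
    have "0 \<le> \<lceil>x * F n\<rceil>" using elim x by (simp add: ceiling_mono[of 0, simplified])
    then have "real (nat \<lceil>x * F n\<rceil>) \<le> x * F n + 1" by (simp add: less_imp_le ceiling_less_iff)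
    then show "real (nat \<lceil>x * F n\<rceil>) / F n \<le> x + 1 / F n" using elim by (simp add: field_simps)
  qed
  have "(\<lambda>n. x + 1 / F n) \<longlonglongrightarrow> x + 0"
    by (intro tendsto_add tendsto_const tendsto_divide_0[OF tendsto_const filterlim_at_top_imp_at_infinity[OF F]])
  then show "(\<lambda>n. x + 1 / F n) \<longlonglongrightarrow> x" by simp
qed simp

context cauchy_offspring
begin

text \<open>The truncation level \<open>bn n / 2\<close> lies below the window as
  \<open>e < 1/2\<close>, so every \<open>k\<close> of the window is the unique maximal degree. The
  additive error \<open>eta\<close> is harmless: the prefactor \<open>bn n / n\<close> is of order
  \<open>1 / Lam n\<close>, and about \<open>Lam n\<close> heights are summed later.\<close>

lemma height_weight_ge:
  assumes e: "0 < e" "e < 1 / 2" and eta: "0 < eta" and y: "0 \<le> y"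
  shows "eventually (\<lambda>n. \<forall>h. real h \<le> y * Lam n \<longrightarrow>
     ((1 - e) / (1 + e))\<^sup>2 * rho n * (bn n / real n) * ((1 - ell (1/2 * bn n)) ^ h - eta)
     \<le> (\<Sum>t | max_degree_height t = h \<and> card (vertices t) = n. tree_weight p t)) sequentially"
proof -
  have win: "eventually (\<lambda>n. \<forall>h. real h \<le> y * Lam n \<longrightarrow>
     h + 1 < n \<and> (1 + e) * bn n \<le> real (n - 1 - h) \<and>
     (1 - ell (1/2 * bn n)) ^ h - eta \<le> (\<Sum>k | (1 - e) * bn n \<le> real k \<and> real k \<le> (1 + e) * bn n.
        coeff (pderiv (P (nat \<lfloor>1/2 * bn n\<rfloor>)) ^ h * P (nat \<lfloor>1/2 * bn n\<rfloor>) ^ (n - 1 - h)) (n - 1 - h - k))) sequentially"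
    using e eta y by (intro window_concentration) auto
  have "eventually (\<lambda>n. \<forall>k. (1 - e) * bn n \<le> real k \<and> real k \<le> (1 + e) * bn n \<longrightarrow>
    (1 - e) / (1 + e)\<^sup>2 * rho n \<le> p k \<and> p k \<le> (1 + e) / (1 - e)\<^sup>2 * rho n) sequentially"
    using e by (intro p_window) auto
  with win show ?thesis using bn_pos rho_pos
  proof eventually_elim
    case (elim n)
    define K where "K = nat \<lfloor>1/2 * bn n\<rfloor>"
    define W where "W = {k. (1 - e) * bn n \<le> real k \<and> real k \<le> (1 + e) * bn n}"
    show ?case
    proof (intro allI impI)
      fix h assume h: "real h \<le> y * Lam n"
      define m where "m = n - 1 - h"
      define c where "c k = coeff (pderiv (P K) ^ h * P K ^ m) (m - k)" for k
      have c0: "0 \<le> c k" for k unfolding c_def by (rule coeff_P_power_nonneg)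
      have w: "h + 1 < n" "(1 + e) * bn n \<le> real m" "(1 - ell (1/2 * bn n)) ^ h - eta \<le> (\<Sum>k\<in>W. c k)"
        using elim(1) h unfolding m_def c_def K_def W_def by blast+
      have Wm: "K < k \<and> k \<le> m" if "k \<in> W" for k
      proof
        have "real K \<le> 1/2 * bn n" unfolding K_def using elim(3) by (intro of_nat_floor) auto
        also have "\<dots> < (1 - e) * bn n" using e elim(3) by (intro mult_strict_right_mono) auto
        also have "\<dots> \<le> real k" using that by (simp add: W_def)
        finally show "K < k" by simp
        have "real k \<le> real m" using w(2) that unfolding W_def by auto
        then show "k \<le> m" by simp
      qed
      have fin: "finite W" by (rule finite_subset[of _ "{..m}"]) (use Wm in auto)
      have m0: "0 < m" using w(1) by (simp add: m_def)
      have mn: "Suc h + m = n" using w(1) by (simp add: m_def)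
      define a where "a = ((1 - e) / (1 + e))\<^sup>2 * rho n * (bn n / real n)"
      have a0: "0 \<le> a" using e elim by (simp add: a_def)
      have "a * ((1 - ell (1/2 * bn n)) ^ h - eta) \<le> a * (\<Sum>k\<in>W. c k)"
        using w(3) a0 by (intro mult_left_mono)
      also have "\<dots> = (\<Sum>k\<in>W. a * c k)" by (rule sum_distrib_left)
      also have "\<dots> \<le> (\<Sum>k\<in>W. p k * (real k / real m) * c k)"
      proof (intro sum_mono mult_right_mono c0)
        fix k assume k: "k \<in> W"
        have "a = ((1 - e) / (1 + e)\<^sup>2 * rho n) * ((1 - e) * bn n / real n)"
          by (simp add: a_def power_divide power2_eq_square)
        also have "\<dots> \<le> p k * (real k / real m)"
        proof (rule mult_mono)
          show "(1 - e) / (1 + e)\<^sup>2 * rho n \<le> p k" using elim(2) k unfolding W_def by blast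
          show "(1 - e) * bn n / real n \<le> real k / real m"
            using k mn m0 e elim(3) by (intro frac_le) (auto simp: W_def)
        qed (use p_nonneg e elim in auto)
        finally show "a \<le> p k * (real k / real m)" .
      qed
      also have "\<dots> \<le> (\<Sum>t | max_degree_height t = h \<and> card (vertices t) = Suc h + m. tree_weight p t)"
        unfolding c_def by (rule max_degree_height_weight_ge[OF p_nonneg fin Wm m0])
      finally show "((1 - e) / (1 + e))\<^sup>2 * rho n * (bn n / real n) * ((1 - ell (1/2 * bn n)) ^ h - eta)
        \<le> (\<Sum>t | max_degree_height t = h \<and> card (vertices t) = n. tree_weight p t)"
        unfolding a_def mn .
    qed
  qed
qed

lemma Lam_n_at_top: "filterlim (\<lambda>n. Lam (real n)) at_top sequentially"
  by (rule filterlim_compose[OF Lam_at_top filterlim_real_sequentially])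

text \<open>The geometric sum over the heights equals a difference of powers divided by
  \<open>E n\<close>. As \<open>bn n / n\<close> and \<open>E n\<close> are both asymptotic to
  \<open>1 / Lam n\<close>, the prefactors cancel and the powers converge to exponentials.\<close>

lemma height_interval_weight_ge:
  assumes xy: "0 \<le> x" "x < y" and eps: "0 < eps"
  shows "eventually (\<lambda>n. (exp (- x) - exp (- y) - eps) * rho n \<le>
     (\<Sum>t | (x * Lam n \<le> real (max_degree_height t) \<and> real (max_degree_height t) < y * Lam n)
        \<and> card (vertices t) = n. tree_weight p t)) sequentially"
proof -
  \<comment> \<open>The summed additive error is \<open>eta * (y - x) = eps / 4\<close>, and the
    choice of \<open>e\<close> costs another factor \<open>1 - eps / 4\<close>.\<close>
  define eta where "eta = eps / (4 * (y - x))"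
  have eta: "0 < eta" using xy eps by (simp add: eta_def)
  define e where "e = min (1 / 4) (eps / 16)"
  have e: "0 < e" "e < 1 / 2" "4 * e \<le> eps / 4" using eps by (auto simp: e_def)
  define c where "c = ((1 - e) / (1 + e))\<^sup>2"
  have c: "1 - eps / 4 \<le> c" "c \<le> 1" "0 \<le> c"
  proof -
    have "0 \<le> e * e" "0 \<le> e * (e * e)" using e by auto
    then have "(1 - 4 * e) * (1 + e)\<^sup>2 \<le> (1 - e)\<^sup>2"
      by (simp add: power2_eq_square algebra_simps)
    then have "1 - 4 * e \<le> c" using e by (simp add: c_def power_divide pos_le_divide_eq)
    then show "1 - eps / 4 \<le> c" using e by linarith
    have "(1 - e) / (1 + e) \<le> 1" using e by simp
    then show "c \<le> 1" unfolding c_def using e by (intro power_le_one) auto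
    show "0 \<le> c" by (simp add: c_def)
  qed
  define E where "E n = ell (1/2 * bn n)" for n :: nat
  have E0: "0 < E n" for n by (simp add: E_def ell_pos)
  \<comment> \<open>With ceilings, \<open>{h0 n..<h1 n}\<close> contains precisely the integers from
    \<open>x * Lam n\<close> inclusive to \<open>y * Lam n\<close> exclusive.\<close>
  define h0 where "h0 n = nat \<lceil>x * Lam n\<rceil>" for n :: nat
  define h1 where "h1 n = nat \<lceil>y * Lam n\<rceil>" for n :: nat
  have r0: "(\<lambda>n. real (h0 n) / Lam n) \<longlonglongrightarrow> x" and r1: "(\<lambda>n. real (h1 n) / Lam n) \<longlonglongrightarrow> y"
    unfolding h0_def h1_def using xy by (auto intro!: nat_ceiling_ratio_tendsto Lam_n_at_top)
  have Elim: "E \<longlonglongrightarrow> 0" unfolding E_def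
    by (rule filterlim_compose[OF ell_tendsto_0 dbn_at_top]) simp
  have LE: "(\<lambda>n. Lam n * E n) \<longlonglongrightarrow> 1"
    using lim_ell_d[of "1/2"] by (simp add: E_def Lam_of_nat)
  have LamNZ: "Lam z \<noteq> 0" for z using Lam_pos[of z] by simp
  have pw: "(\<lambda>n. (1 - E n) ^ k n) \<longlonglongrightarrow> exp (- z)" if "(\<lambda>n. real (k n) / Lam n) \<longlonglongrightarrow> z" for k :: "nat \<Rightarrow> nat" and z
  proof (rule one_minus_power_tendsto_exp[OF Elim E0])
    have "(\<lambda>n. real (k n) / Lam n * (Lam n * E n)) \<longlonglongrightarrow> z * 1" by (intro tendsto_mult that LE)
    then show "(\<lambda>n. real (k n) * E n) \<longlonglongrightarrow> z" using LamNZ by simp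
  qed
  define A where "A n = bn n / real n * (((1 - E n) ^ h0 n - (1 - E n) ^ h1 n) / E n - eta * (real (h1 n) - real (h0 n)))" for n :: nat
  have "(\<lambda>n. bn n / real n * Lam n * (((1 - E n) ^ h0 n - (1 - E n) ^ h1 n) / (Lam n * E n)
      - eta * (real (h1 n) / Lam n - real (h0 n) / Lam n))) \<longlonglongrightarrow> 1 * ((exp (- x) - exp (- y)) / 1 - eta * (y - x))"
    by (intro tendsto_intros lim_bn_over_n_Lam pw[OF r0] pw[OF r1] LE) (simp_all add: r0 r1)
  moreover have "bn n / real n * Lam n * (((1 - E n) ^ h0 n - (1 - E n) ^ h1 n) / (Lam n * E n)
      - eta * (real (h1 n) / Lam n - real (h0 n) / Lam n)) = A n" for n
  proof -
    have "Lam n * (((1 - E n) ^ h0 n - (1 - E n) ^ h1 n) / (Lam n * E n)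
      - eta * (real (h1 n) / Lam n - real (h0 n) / Lam n)) =
      ((1 - E n) ^ h0 n - (1 - E n) ^ h1 n) / E n - eta * (real (h1 n) - real (h0 n))"
      using LamNZ[of "real n"] E0[of n] by (simp add: field_simps)
    then show ?thesis unfolding A_def mult.assoc by (simp only:)
  qed
  ultimately have "A \<longlonglongrightarrow> (exp (- x) - exp (- y)) - eta * (y - x)" by simp
  then have "(\<lambda>n. c * A n) \<longlonglongrightarrow> c * ((exp (- x) - exp (- y)) - eta * (y - x))" by (intro tendsto_intros)
  moreover have "exp (- x) - exp (- y) - eps < c * ((exp (- x) - exp (- y)) - eta * (y - x))"
  proof -
    let ?d = "exp (- x) - exp (- y)"
    have "exp (- x) \<le> 1" using xy by simp
    then have d: "0 \<le> ?d" "?d \<le> 1" using xy exp_gt_zero[of "- y"] by (simp, linarith)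
    have "(1 - eps / 4) * ?d \<le> c * ?d" using c d by (intro mult_right_mono) auto
    moreover have "eps / 4 * ?d \<le> eps / 4 * 1" using eps d by (intro mult_left_mono) auto
    moreover have "eps / (4 * D) * D = eps / 4" if "D \<noteq> 0" for D using that by simp
    from this[of "y - x"] have "eta * (y - x) = eps / 4" unfolding eta_def using xy by simp
    then have "c * (eta * (y - x)) \<le> 1 * (eps / 4)" using c eps by (intro mult_mono) auto
    ultimately show ?thesis using eps by (simp add: algebra_simps)
  qed
  ultimately have ev: "eventually (\<lambda>n. exp (- x) - exp (- y) - eps < c * A n) sequentially"
    by (rule order_tendstoD(1))
  have hw: "eventually (\<lambda>n. \<forall>h. real h \<le> y * Lam n \<longrightarrow>
     ((1 - e) / (1 + e))\<^sup>2 * rho n * (bn n / real n) * ((1 - ell (1/2 * bn n)) ^ h - eta)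
     \<le> (\<Sum>t | max_degree_height t = h \<and> card (vertices t) = n. tree_weight p t)) sequentially"
    using height_weight_ge[OF e(1,2) eta] xy by simp
  show ?thesis
    using ev hw rho_pos
  proof eventually_elim
    case (elim n)
    let ?T = "\<lambda>h. {t. max_degree_height t = h \<and> card (vertices t) = n}"
    have h01: "h0 n \<le> h1 n" unfolding h0_def h1_def
      using xy Lam_pos[of "real n"] by (intro nat_mono ceiling_mono mult_right_mono) auto
    have mem: "x * Lam n \<le> real h" "real h < y * Lam n" if "h \<in> {h0 n..<h1 n}" for h
      using that by (auto simp: h0_def h1_def nat_le_iff zless_nat_eq_int_zless ceiling_le_iff less_ceiling_iff)
    have "(exp (- x) - exp (- y) - eps) * rho n \<le> c * A n * rho n"
      using elim by (intro mult_right_mono) auto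
    also have "c * A n * rho n = c * rho n * (bn n / real n) *
        (((1 - E n) ^ h0 n - (1 - E n) ^ h1 n) / E n - eta * (real (h1 n) - real (h0 n)))"
      by (simp add: A_def mult_ac)
    also have "((1 - E n) ^ h0 n - (1 - E n) ^ h1 n) / E n - eta * (real (h1 n) - real (h0 n)) =
        (\<Sum>h\<in>{h0 n..<h1 n}. (1 - E n) ^ h - eta)"
    proof -
      have "E n * (\<Sum>h\<in>{h0 n..<h1 n}. (1 - E n) ^ h) = (1 - E n) ^ h0 n - (1 - E n) ^ h1 n"
        using geometric_interval_sum[OF h01, of "1 - E n"] by simp
      then have "((1 - E n) ^ h0 n - (1 - E n) ^ h1 n) / E n = (\<Sum>h\<in>{h0 n..<h1 n}. (1 - E n) ^ h)"
        using E0[of n] by (simp add: field_simps)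
      then show ?thesis using h01 by (simp add: sum_subtractf of_nat_diff)
    qed
    also have "c * rho n * (bn n / real n) * (\<Sum>h\<in>{h0 n..<h1 n}. (1 - E n) ^ h - eta) =
        (\<Sum>h\<in>{h0 n..<h1 n}. c * rho n * (bn n / real n) * ((1 - E n) ^ h - eta))"
      by (rule sum_distrib_left)
    also have "\<dots> \<le> (\<Sum>h\<in>{h0 n..<h1 n}. \<Sum>t\<in>?T h. tree_weight p t)"
      unfolding c_def E_def using elim(2) mem(2) by (intro sum_mono) (auto dest: less_imp_le)
    also have "\<dots> = (\<Sum>t\<in>(\<Union>h\<in>{h0 n..<h1 n}. ?T h). tree_weight p t)"
      by (rule sum.UNION_disjoint[symmetric]) auto
    also have "\<dots> \<le> (\<Sum>t | (x * Lam n \<le> real (max_degree_height t) \<and> real (max_degree_height t) < y * Lam n)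
        \<and> card (vertices t) = n. tree_weight p t)"
      using mem by (intro sum_mono2 tree_weight_nonneg p_nonneg) auto
    finally show ?case .
  qed
qed

definition total_weight :: "nat \<Rightarrow> real" where
  "total_weight n = (\<Sum>t | card (vertices t) = n. tree_weight p t)"

lemma total_weight_le:
  assumes "0 < kap"
  shows "eventually (\<lambda>n. total_weight n \<le> (1 + kap) * rho n) sequentially"
  using total_power_le[OF assms] eventually_gt_at_top[of 0]
proof (eventually_elim)
  case (elim n)
  then show ?case by (simp add: total_weight_def total_weight_eq field_simps)
qed

text \<open>The lower bound on the interval from 0 to 1 is already positive, so the conditioning is
  meaningful for large \<open>n\<close>.\<close>

lemma total_weight_pos: "eventually (\<lambda>n. 0 < total_weight n) sequentially"
proof -
  define eps where "eps = (1 - exp (- 1 :: real)) / 2"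
  have "exp (- 1 :: real) < 1" by simp
  then have eps: "0 < eps" by (simp add: eps_def)
  show ?thesis
    using height_interval_weight_ge[of 0 1, OF _ _ eps, simplified] rho_pos
  proof eventually_elim
    case (elim n)
    have "0 < (1 - exp (- 1) - eps) * rho n" using elim(2) eps by (simp add: eps_def)
    also have "\<dots> \<le> (\<Sum>t | real (max_degree_height t) < Lam n \<and> card (vertices t) = n. tree_weight p t)"
      using elim(1) Lam_pos[of n] by simp
    also have "\<dots> \<le> total_weight n"
      unfolding total_weight_def using finite_trees[of "\<lambda>_. True" n]
      by (intro sum_mono2 tree_weight_nonneg p_nonneg) auto
    finally show ?case .
  qed
qed

lemma height_interval_prob_ge:
  assumes xy: "0 \<le> x" "x < y" and eps: "0 < eps"
  shows "eventually (\<lambda>n. exp (- x) - exp (- y) - eps \<le>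
     (\<Sum>t | (x * Lam n \<le> real (max_degree_height t) \<and> real (max_degree_height t) < y * Lam n)
        \<and> card (vertices t) = n. tree_weight p t) / total_weight n) sequentially"
  using height_interval_weight_ge[OF xy half_gt_zero[OF eps]] total_weight_le[OF half_gt_zero[OF eps]]
    total_weight_pos rho_pos
proof eventually_elim
  case (elim n)
  let ?S = "\<Sum>t | (x * Lam n \<le> real (max_degree_height t) \<and> real (max_degree_height t) < y * Lam n)
        \<and> card (vertices t) = n. tree_weight p t"
  let ?d = "exp (- x) - exp (- y)"
  have S0: "0 \<le> ?S" by (intro sum_nonneg tree_weight_nonneg p_nonneg)
  have "(?d - eps) * total_weight n \<le> ?S"
  \<comment> \<open>The upper bound on the total weight may be multiplied only by a nonnegative
    factor; otherwise the left side is nonpositive.\<close>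
  proof (cases "0 \<le> ?d - eps")
    case True
    have "?d \<le> 1" using xy exp_gt_zero[of "- y"] by (smt (verit) exp_le_one_iff)
    have "(?d - eps) * total_weight n \<le> (?d - eps) * ((1 + eps / 2) * rho n)"
      using elim True by (intro mult_left_mono) auto
    also have "\<dots> = ((?d - eps) * (1 + eps / 2)) * rho n" by simp
    also have "\<dots> \<le> (?d - eps / 2) * rho n"
    proof (intro mult_right_mono)
      have "?d * (eps / 2) \<le> 1 * (eps / 2)" using \<open>?d \<le> 1\<close> eps by (intro mult_right_mono) auto
      moreover have "0 \<le> eps * eps" by simp
      moreover have "(?d - eps) * (1 + eps / 2) = ?d - eps + ?d * (eps / 2) - eps * eps / 2"
        by (simp add: field_simps)
      ultimately show "(?d - eps) * (1 + eps / 2) \<le> ?d - eps / 2" by linarith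
    qed (use elim in auto)
    also have "\<dots> \<le> ?S" using elim by simp
    finally show ?thesis .
  next
    case False
    then have "(?d - eps) * total_weight n \<le> 0" using elim by (intro mult_nonpos_nonneg) auto
    then show ?thesis using S0 by linarith
  qed
  then show ?case using elim by (simp add: pos_le_divide_eq)
qed

text \<open>The upper bound on the distribution function is the lower bound for the disjoint
  interval from \<open>z + eps\<close> to \<open>y\<close>, subtracted from the total mass 1. The
  gap \<open>eps\<close> separates that interval from the closed half-line ending at
  \<open>z\<close>.\<close>

lemma height_cdf_tendsto:
  assumes z: "0 \<le> z"
  shows "(\<lambda>n. (\<Sum>t | real (max_degree_height t) \<le> z * Lam n \<and> card (vertices t) = n. tree_weight p t) / total_weight n)
     \<longlonglongrightarrow> 1 - exp (- z)"
  unfolding tendsto_iff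
proof (intro allI impI)
  fix r :: real assume r: "r > 0"
  define eps where "eps = r / 4"
  have eps: "0 < eps" using r by (simp add: eps_def)
  let ?F = "\<lambda>n. (\<Sum>t | real (max_degree_height t) \<le> z * Lam n \<and> card (vertices t) = n. tree_weight p t)"
  let ?I = "\<lambda>x y n. (\<Sum>t | (x * Lam n \<le> real (max_degree_height t) \<and> real (max_degree_height t) < y * Lam n)
        \<and> card (vertices t) = n. tree_weight p t)"
  define y where "y = max (z + eps + 1) (1 / eps)"
  have y: "z + eps < y" "exp (- y) \<le> eps"
  proof -
    show "z + eps < y" by (simp add: y_def)
    have "1 / eps \<le> exp (1 / eps)" using exp_ge_add_one_self[of "1 / eps"] by linarith
    also have "\<dots> \<le> exp y" by (simp add: y_def)
    finally show "exp (- y) \<le> eps" using eps by (simp add: exp_minus field_simps)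
  qed
  have zeps: "0 \<le> z + eps" using z eps by simp
  have z': "exp (- z) - eps \<le> exp (- (z + eps))"
  proof -
    have "exp (- z) * (1 + - eps) \<le> exp (- z) * exp (- eps)" by (intro mult_left_mono exp_ge_add_one_self) auto
    moreover have "exp (- z) * eps \<le> 1 * eps" using z eps by (intro mult_right_mono) auto
    moreover have "exp (- (z + eps)) = exp (- z) * exp (- eps)" by (simp add: exp_add[symmetric])
    ultimately show ?thesis by (simp add: algebra_simps)
  qed
  have low: "eventually (\<lambda>n. 1 - exp (- z) - eps \<le> ?F n / total_weight n) sequentially"
  \<comment> \<open>The interval estimate needs \<open>0 < z\<close>; at \<open>z = 0\<close> the
    claimed bound is negative.\<close>
  proof (cases "z = 0")
    case True
    have "0 \<le> ?F n / total_weight n" for n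
      unfolding total_weight_def by (intro divide_nonneg_nonneg sum_nonneg tree_weight_nonneg p_nonneg)
    moreover have "1 - exp (- z) - eps \<le> 0" using True eps by simp
    ultimately show ?thesis by (intro always_eventually allI) (rule order_trans)
  next
    case False
    then have zp: "0 < z" using z by simp
    show ?thesis
      using height_interval_prob_ge[OF order_refl zp eps] total_weight_pos
    proof eventually_elim
      case (elim n)
      have "?I 0 z n \<le> ?F n" by (intro sum_mono2 tree_weight_nonneg p_nonneg) auto
      then have "?I 0 z n / total_weight n \<le> ?F n / total_weight n" using elim by (intro divide_right_mono) auto
      then show ?case using elim(1) by simp
    qed
  qed
  show "eventually (\<lambda>n. dist (?F n / total_weight n) (1 - exp (- z)) < r) sequentially"
    using low height_interval_prob_ge[OF zeps y(1) eps] total_weight_pos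
  proof eventually_elim
    case (elim n)
    have "?F n + ?I (z + eps) y n = (\<Sum>t\<in>{t. real (max_degree_height t) \<le> z * Lam n \<and> card (vertices t) = n} \<union>
       {t. ((z + eps) * Lam n \<le> real (max_degree_height t) \<and> real (max_degree_height t) < y * Lam n)
        \<and> card (vertices t) = n}. tree_weight p t)"
    proof (rule sum.union_disjoint[symmetric])
      have "z * Lam n < (z + eps) * Lam n" using eps Lam_pos[of n] by (intro mult_strict_right_mono) auto
      then show "{t. real (max_degree_height t) \<le> z * Lam n \<and> card (vertices t) = n} \<inter>
       {t. ((z + eps) * Lam n \<le> real (max_degree_height t) \<and> real (max_degree_height t) < y * Lam n)
        \<and> card (vertices t) = n} = {}" by auto
    qed auto
    also have "\<dots> \<le> total_weight n"
      unfolding total_weight_def using finite_trees[of "\<lambda>_. True" n]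
      by (intro sum_mono2 tree_weight_nonneg p_nonneg) auto
    finally have "(?F n + ?I (z + eps) y n) / total_weight n \<le> 1" using elim by simp
    then have "?F n / total_weight n + ?I (z + eps) y n / total_weight n \<le> 1" by (simp only: add_divide_distrib)
    moreover have "exp (- (z + eps)) - exp (- y) - eps \<le> ?I (z + eps) y n / total_weight n" using elim by simp
    ultimately have "?F n / total_weight n \<le> 1 - exp (- z) + 3 * eps" using z' y(2) by linarith
    then show ?case using elim(1) eps by (simp add: dist_real_def eps_def abs_less_iff)
  qed
qed

end

theorem theorem2:
  fixes L :: "real \<Rightarrow> real" and \<mu> :: "nat pmf"
  assumes "slowly_varying L"
    and "(\<lambda>i. real i * pmf \<mu> i) sums 1"
    and "(\<lambda>n. pmf \<mu> n) \<sim>[at_top] (\<lambda>n. L (real n) / (real n)\<^sup>2)"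
  shows "\<exists>\<Lambda> :: real \<Rightarrow> real. slowly_varying \<Lambda> \<and> filterlim \<Lambda> at_top at_top \<and>
    weak_conv_m
      (\<lambda>n. distr (BGW_cond \<mu> n) borel (\<lambda>t. real (max_degree_height t) / \<Lambda> (real n)))
      (density lborel (\<lambda>x. ennreal (exponential_density 1 x)))"
proof -
  have "pmf \<mu> sums 1"
  proof -
    show ?thesis using sums_infsetsum_nat'[OF pmf_abs_summable[of \<mu> UNIV]] by (simp add: infsetsum_pmf_eq_1)
  qed
  then interpret cauchy_offspring L "pmf \<mu>"
    using assms by unfold_locales auto
  show ?thesis
  proof (intro exI[of _ Lam] conjI Lam_slowly_varying Lam_at_top)
    show "weak_conv_m (\<lambda>n. distr (BGW_cond \<mu> n) borel (\<lambda>t. real (max_degree_height t) / Lam (real n)))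
      (density lborel (\<lambda>x. ennreal (exponential_density 1 x)))"
      unfolding weak_conv_m_def weak_conv_def
    proof (intro allI impI)
      \<comment> \<open>The limiting distribution function is continuous, so convergence is due at
        every real \<open>z\<close>, also at negative ones, where both sides vanish.\<close>
      fix z :: real
      have sets: "sets (BGW_cond \<mu> n) = UNIV" for n
        by (simp add: BGW_cond_def BGW_def)
      have "cdf (distr (BGW_cond \<mu> n) borel (\<lambda>t. real (max_degree_height t) / Lam (real n))) z =
          (\<Sum>t | real (max_degree_height t) \<le> z * Lam n \<and> card (vertices t) = n. tree_weight (pmf \<mu>) t) / total_weight n" for n
      proof -
        have "space (BGW_cond \<mu> n) = UNIV" using sets by (metis sets.top sets_eq_imp_space_eq space_count_space sets_count_space Pow_UNIV)
        moreover have "(\<lambda>t. real (max_degree_height t) / Lam (real n)) \<in> measurable (BGW_cond \<mu> n) borel"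
          by (simp add: measurable_def sets)
        moreover have "(\<lambda>t. real (max_degree_height t) / Lam (real n)) -` {..z} = {t. real (max_degree_height t) \<le> z * Lam n}"
          using Lam_pos[of n] by (auto simp: pos_divide_le_eq)
        ultimately show ?thesis
          by (simp add: cdf_def2 measure_distr measure_BGW_cond total_weight_def)
      qed
      moreover have "(\<lambda>n. (\<Sum>t | real (max_degree_height t) \<le> z * Lam n \<and> card (vertices t) = n. tree_weight (pmf \<mu>) t) / total_weight n)
        \<longlonglongrightarrow> cdf (density lborel (\<lambda>x. ennreal (exponential_density 1 x))) z"
      proof -
        have cdf: "cdf (density lborel (\<lambda>x. ennreal (exponential_density 1 x))) z = (if 0 \<le> z then 1 - exp (- z) else 0)"
          by (simp add: cdf_def2 measure_def emeasure_erlang_density erlang_CDF_0)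
        have neg: "{t. real (max_degree_height t) \<le> z * Lam n \<and> card (vertices t) = n} = {}" if "z < 0" for n :: nat
        proof -
          have "z * Lam n < 0" using that Lam_pos[of n] by (simp add: mult_neg_pos)
          then have "\<not> real k \<le> z * Lam n" for k by (simp add: not_le order_less_le_trans)
          then show ?thesis by blast
        qed
        show ?thesis
        proof (cases "0 \<le> z")
          case False
          then have "z < 0" and "cdf (density lborel (\<lambda>x. ennreal (exponential_density 1 x))) z = 0"
            using cdf by auto
          then show ?thesis by (simp only: neg sum.empty div_0 tendsto_const)
        qed (use cdf height_cdf_tendsto[of z] in simp)
      qed
      ultimately show "(\<lambda>n. cdf (distr (BGW_cond \<mu> n) borel (\<lambda>t. real (max_degree_height t) / Lam (real n))) z)
        \<longlonglongrightarrow> cdf (density lborel (\<lambda>x. ennreal (exponential_density 1 x))) z"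
        by simp
    qed
  qed
qed

end
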